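(* Let $1\le d\le n$, $\mathcal{L}=I_{d,n}$, and let $\tau=\sigma_{ij}$ for some $1\le i\le n-d-1$, $1\le j\le d-1$. Let $Z=\{x_1x_4-x_2x_3=0\}\subset\mathbb{A}^4$ be the cone over the quadric surface $x_1x_4-x_2x_3=0$ in $\mathbb{P}^3$. Then: (1) $P_\tau\in\mathrm{Sing}\,X_\sigma$. (2) The tangent cone $TC_{P_\tau}X_\sigma$ is identified with (is isomorphic to) $Z\times K^{\#J(\mathcal{L})-3}$; in particular, $TC_{P_\tau}X_\sigma$ is a toric variety. (3) The singularity of $X_\sigma$ at $P_\tau$ is of the same type as that at the vertex of the cone over the quadric surface $x_1x_4-x_2x_3=0$ in $\mathbb{P}^3$. In particular, $\mathrm{mult}_{P_\tau}X_\sigma=2$.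
   Context: $K$ is an algebraically closed field of arbitrary characteristic. $I_{d,n}=\{(i_1,\dots,i_d)\in\mathbb{Z}^d: 1\le i_1<\dots<i_d\le n\}$ with the componentwise order; it is a finite distributive lattice (join and meet are componentwise max and min). For a finite distributive lattice $\mathcal{L}$, the Hibi toric variety $X(\mathcal{L})\subset\mathbb{A}^{\#\mathcal{L}}$ is the affine variety whose vanishing ideal in $K[X_\alpha,\alpha\in\mathcal{L}]$ is generated by the binomials $X_\alpha X_\beta-X_{\alpha\vee\beta}X_{\alpha\wedge\beta}$. Let $J=J(\mathcal{L})$ be the poset of join-irreducible elements ($z$ such that $z=x\vee y$ implies $z=x$ or $z=y$; the minimal element $\hat 0$ of $\mathcal{L}$ is included), and for $\alpha\in\mathcal{L}$ put $I_\alpha=\{z\in J: z\le\alpha\}$. Let $M$ be the free abelian group with basis $\{f_z\}_{z\in J}$, $N$ its dual with dual basis $\{e_z\}_{z\in J}$, and $f_{I_\alpha}=\sum_{z\in I_\alpha}f_z$. Let $\sigma\subset N_{\mathbb{R}}$ be the cone generated by the $e_z$ with $z$ maximal in $J$ and the $e_{y'}-e_y$ with $y$ covering $y'$ in $J$. The semigroup $\sigma^\vee\cap M$ is generated by the $f_{I_\alpha}$, and $X(\mathcal{L})=X_\sigma=\mathrm{Spec}\,K[\sigma^\vee\cap M]$, the coordinate $X_\alpha$ corresponding to $f_{I_\alpha}$. For a face $\tau$ of $\sigma$, $P_\tau\in X(\mathcal{L})$ is the point whose $\alpha$-th coordinate is $1$ if $f_{I_\alpha}\in\tau^\perp$ and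 $0$ otherwise, and $D_\tau=\{\alpha\in\mathcal{L}: P_\tau(\alpha)\ne0\}$. A sublattice $\mathcal{L}'\subset\mathcal{L}$ is embedded if $\alpha\vee\beta,\alpha\wedge\beta\in\mathcal{L}'$ implies $\alpha,\beta\in\mathcal{L}'$; the map $\tau\mapsto D_\tau$ is a bijection between faces of $\sigma$ and embedded sublattices of $\mathcal{L}$. For $1\le i\le n-d-1$, $1\le j\le d-1$ let $\mu_{ij}=(1,\dots,j,i+j+1,\dots,i+d)$, $\lambda_{ij}=(i+1,\dots,i+j,n+1+j-d,\dots,n)$ and $\mathcal{L}_{ij}=\mathcal{L}\setminus[\mu_{ij},\lambda_{ij}]$, which is an embedded sublattice; $\sigma_{ij}$ denotes the face of $\sigma$ with $D_{\sigma_{ij}}=\mathcal{L}_{ij}$. The tangent cone at a closed point $P$ is $TC_PX=\mathrm{Spec}\,\mathrm{gr}(\mathcal{O}_{X,P},\mathfrak{m}_P)$, and $\mathrm{mult}_PX$ is the degree of the graded ring $\mathrm{gr}(\mathcal{O}_{X,P},\mathfrak{m}_P)$ (for a graded ring of dimension $r+1$, its degree $e$ is defined by the leading coefficient $e/r!$ of the Hilbert polynomial). "Same type as at the vertex of the cone" means: some open neighbourhood of $P_\tau$ in $X_\sigma$ is isomorphic to $Z\times Y$ with $Y$ smooth, with $P_\tau$ mapping to a point of $\{0\}\times Y$. *)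

theory Defs
  imports
    "HOL-Computational_Algebra.Polynomial"
    "HOL-Library.Poly_Mapping"
    "HOL-Library.Extended_Nat"
    "HOL-Analysis.Abstract_Topology"
    "HOL-Algebra.Ideal_Product"
    "HOL-Algebra.Embedded_Algebras"
    "HOL-Algebra.QuotRing"
    "HOL-Algebra.Lattice"
begin

section \<open>Classical varieties over an algebraically closed field\<close>

text \<open>
  Affine space with coordinates indexed by a set \<open>V\<close> is realised inside the functions
  \<open>'v \<Rightarrow> 'k\<close> as the functions vanishing outside \<open>V\<close>.  Polynomials may use any
  variable of type \<open>'v\<close>; on a subset of \<open>affine_space V\<close> the superfluous variables
  are identically 0, so the regular functions and the topology induced on such a subset are
  exactly those coming from the polynomial ring on \<open>V\<close>.
\<close>

definition affine_space :: "'v set \<Rightarrow> ('v \<Rightarrow> 'k::field) set" where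
  "affine_space V = {x. \<forall>v. v \<notin> V \<longrightarrow> x v = 0}"

inductive_set polyfun :: "(('v \<Rightarrow> 'k::field) \<Rightarrow> 'k) set" where
  const: "(\<lambda>x. c) \<in> polyfun"
| coord: "(\<lambda>x. x v) \<in> polyfun"
| add: "f \<in> polyfun \<Longrightarrow> g \<in> polyfun \<Longrightarrow> (\<lambda>x. f x + g x) \<in> polyfun"
| mult: "f \<in> polyfun \<Longrightarrow> g \<in> polyfun \<Longrightarrow> (\<lambda>x. f x * g x) \<in> polyfun"

definition zariski_open :: "('v \<Rightarrow> 'k::field) set \<Rightarrow> bool" where
  "zariski_open U \<longleftrightarrow> (\<exists>S\<subseteq>polyfun. U = {x. \<exists>f\<in>S. f x \<noteq> 0})"

definition zariski :: "('v \<Rightarrow> 'k::field) topology" where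
  "zariski = topology zariski_open"

lemma istopology_zariski_open: "istopology (zariski_open :: ('v \<Rightarrow> 'k::field) set \<Rightarrow> bool)"
  unfolding istopology_def
proof (intro conjI allI impI)
  fix S T :: "('v \<Rightarrow> 'k) set"
  assume "zariski_open S" "zariski_open T"
  then obtain A B where A: "A \<subseteq> polyfun" "S = {x. \<exists>f\<in>A. f x \<noteq> 0}"
    and B: "B \<subseteq> polyfun" "T = {x. \<exists>f\<in>B. f x \<noteq> 0}"
    unfolding zariski_open_def by blast
  let ?C = "{(\<lambda>x. f x * g x) | f g. f \<in> A \<and> g \<in> B}"
  have "?C \<subseteq> polyfun"
    using A(1) B(1) by (auto intro: polyfun.mult)
  moreover have "S \<inter> T = {x. \<exists>h\<in>?C. h x \<noteq> 0}"
  proof (intro Set.set_eqI iffI)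
    fix x assume "x \<in> S \<inter> T"
    then obtain f g where fg: "f \<in> A" "f x \<noteq> 0" "g \<in> B" "g x \<noteq> 0"
      unfolding A(2) B(2) by blast
    have C: "(\<lambda>x. f x * g x) \<in> ?C"
      using fg(1,3) by blast
    have "f x * g x \<noteq> 0"
      using fg(2,4) by simp
    then show "x \<in> {x. \<exists>h\<in>?C. h x \<noteq> 0}"
      by (intro CollectI bexI[OF _ C])
  next
    fix x assume "x \<in> {x. \<exists>h\<in>?C. h x \<noteq> 0}"
    then obtain f g where fg: "f \<in> A" "g \<in> B" "f x * g x \<noteq> 0"
      by blast
    from fg(3) have "f x \<noteq> 0" "g x \<noteq> 0"
      by simp_all
    with fg(1,2) show "x \<in> S \<inter> T"
      unfolding A(2) B(2) by blast
  qed
  ultimately show "zariski_open (S \<inter> T)"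
    unfolding zariski_open_def by blast
next
  fix \<K> :: "('v \<Rightarrow> 'k) set set"
  assume *: "\<forall>K\<in>\<K>. zariski_open K"
  let ?S = "{f \<in> polyfun. \<exists>K\<in>\<K>. \<forall>x. f x \<noteq> 0 \<longrightarrow> x \<in> K}"
  have "\<Union>\<K> = {x. \<exists>f\<in>?S. f x \<noteq> 0}"
  proof (intro Set.set_eqI iffI)
    fix x assume "x \<in> \<Union>\<K>"
    then obtain K where K: "K \<in> \<K>" "x \<in> K" by blast
    with * obtain A where A: "A \<subseteq> polyfun" "K = {x. \<exists>f\<in>A. f x \<noteq> 0}"
      unfolding zariski_open_def by blast
    from K(2) obtain f where f: "f \<in> A" "f x \<noteq> 0"
      unfolding A(2) by blast
    have "\<forall>x. f x \<noteq> 0 \<longrightarrow> x \<in> K"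
      using f(1) unfolding A(2) by blast
    with f A(1) K(1) show "x \<in> {x. \<exists>f\<in>?S. f x \<noteq> 0}" by blast
  qed blast
  moreover have "?S \<subseteq> polyfun" by blast
  ultimately show "zariski_open (\<Union>\<K>)"
    unfolding zariski_open_def by blast
qed

lemma openin_zariski: "openin zariski U \<longleftrightarrow> zariski_open U"
  unfolding zariski_def by (simp only: topology_inverse'[OF istopology_zariski_open])

lemma topspace_zariski: "topspace (zariski :: ('a \<Rightarrow> 'b::field) topology) = UNIV"
proof -
  have "{\<lambda>x. 1} \<subseteq> (polyfun :: (('a \<Rightarrow> 'b) \<Rightarrow> 'b) set)"
    by (simp add: polyfun.const)
  moreover have "(UNIV :: ('a \<Rightarrow> 'b) set) = {x. \<exists>f\<in>{\<lambda>x. 1 :: 'b}. f x \<noteq> 0}"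
    by simp
  ultimately have "zariski_open (UNIV :: ('a \<Rightarrow> 'b) set)"
    unfolding zariski_open_def by blast
  then have "openin zariski (UNIV :: ('a \<Rightarrow> 'b) set)"
    by (simp only: openin_zariski)
  from openin_subset[OF this] show ?thesis by (simp only: UNIV_I subset_antisym[OF subset_UNIV])
qed

definition quasi_affine :: "'v set \<Rightarrow> ('v \<Rightarrow> 'k::field) set \<Rightarrow> bool" where
  "quasi_affine V X \<longleftrightarrow> finite V \<and> X \<subseteq> affine_space V
     \<and> (\<exists>C. closedin zariski C \<and> openin (subtopology zariski C) X)"

definition regular_at :: "('v \<Rightarrow> 'k::field) set \<Rightarrow> ('v \<Rightarrow> 'k) \<Rightarrow> (('v \<Rightarrow> 'k) \<Rightarrow> 'k) \<Rightarrow> bool" where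
  "regular_at X P f \<longleftrightarrow>
     (\<exists>U. openin (subtopology zariski X) U \<and> P \<in> U \<and>
        (\<exists>g\<in>polyfun. \<exists>h\<in>polyfun. \<forall>x\<in>U. h x \<noteq> 0 \<and> f x = g x / h x))"

definition regular_on :: "('v \<Rightarrow> 'k::field) set \<Rightarrow> ('v \<Rightarrow> 'k) set \<Rightarrow> (('v \<Rightarrow> 'k) \<Rightarrow> 'k) \<Rightarrow> bool" where
  "regular_on X U f \<longleftrightarrow> (\<forall>P\<in>U. regular_at X P f)"

definition variety_morphism ::
    "('v \<Rightarrow> 'k::field) set \<Rightarrow> ('w \<Rightarrow> 'k) set \<Rightarrow> (('v \<Rightarrow> 'k) \<Rightarrow> ('w \<Rightarrow> 'k)) \<Rightarrow> bool" where
  "variety_morphism X Y \<phi> \<longleftrightarrow>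
     continuous_map (subtopology zariski X) (subtopology zariski Y) \<phi> \<and>
     (\<forall>V f. openin (subtopology zariski Y) V \<and> regular_on Y V f
        \<longrightarrow> regular_on X (X \<inter> \<phi> -` V) (f \<circ> \<phi>))"

definition variety_isomorphism ::
    "('v \<Rightarrow> 'k::field) set \<Rightarrow> ('w \<Rightarrow> 'k) set \<Rightarrow> (('v \<Rightarrow> 'k) \<Rightarrow> ('w \<Rightarrow> 'k)) \<Rightarrow> bool" where
  "variety_isomorphism X Y \<phi> \<longleftrightarrow> variety_morphism X Y \<phi> \<and>
     (\<exists>\<psi>. variety_morphism Y X \<psi> \<and> (\<forall>x\<in>X. \<psi> (\<phi> x) = x) \<and> (\<forall>y\<in>Y. \<phi> (\<psi> y) = y))"

definition variety_prod ::
    "('v \<Rightarrow> 'k::field) set \<Rightarrow> ('w \<Rightarrow> 'k) set \<Rightarrow> ('v + 'w \<Rightarrow> 'k) set" where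
  "variety_prod X Y = {case_sum x y | x y. x \<in> X \<and> y \<in> Y}"


section \<open>Algebras over \<open>K\<close> and local rings\<close>

text \<open>
  A \<open>K\<close>-algebra is a record of type \<open>('k, 'a) module\<close>: a ring together with a scalar
  multiplication by the elements of the field type \<open>'k\<close>.  An affine \<open>K\<close>-scheme
  \<open>Spec A\<close> is represented by \<open>A\<close>, so that \<open>Spec A \<cong> Spec B\<close> (over \<open>K\<close>) is
  \<open>alg_isomorphic A B\<close>.
\<close>

definition alg_isomorphic :: "('k, 'a) module \<Rightarrow> ('k, 'b) module \<Rightarrow> bool" where
  "alg_isomorphic A B \<longleftrightarrow>
     (\<exists>h\<in>ring_iso A B. \<forall>c. \<forall>a\<in>carrier A. h (c \<odot>\<^bsub>A\<^esub> a) = c \<odot>\<^bsub>B\<^esub> h a)"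

text \<open>The coordinate ring \<open>K[X]\<close> of an affine variety: polynomial functions on \<open>X\<close>.\<close>

definition coord_ring :: "('v \<Rightarrow> 'k::field) set \<Rightarrow> ('k, ('v \<Rightarrow> 'k) \<Rightarrow> 'k) module" where
  "coord_ring X = \<lparr> carrier = (\<lambda>f. restrict f X) ` polyfun,
     mult = (\<lambda>f g. restrict (\<lambda>x. f x * g x) X),
     one = restrict (\<lambda>x. 1) X,
     zero = restrict (\<lambda>x. 0) X,
     add = (\<lambda>f g. restrict (\<lambda>x. f x + g x) X),
     smult = (\<lambda>c f. restrict (\<lambda>x. c * f x) X) \<rparr>"

definition germ ::
    "('v \<Rightarrow> 'k::field) set \<Rightarrow> ('v \<Rightarrow> 'k) \<Rightarrow> (('v \<Rightarrow> 'k) \<Rightarrow> 'k) \<Rightarrow> (('v \<Rightarrow> 'k) \<Rightarrow> 'k) set" where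
  "germ X P f = {g. \<exists>U. openin (subtopology zariski X) U \<and> P \<in> U \<and> (\<forall>x\<in>U. g x = f x)}"

text \<open>In the operations below all members of the unions coincide.\<close>

definition local_ring ::
    "('v \<Rightarrow> 'k::field) set \<Rightarrow> ('v \<Rightarrow> 'k) \<Rightarrow> ('k, (('v \<Rightarrow> 'k) \<Rightarrow> 'k) set) module" where
  "local_ring X P = \<lparr> carrier = germ X P ` {f. regular_at X P f},
     mult = (\<lambda>A B. \<Union>f\<in>A. \<Union>g\<in>B. germ X P (\<lambda>x. f x * g x)),
     one = germ X P (\<lambda>x. 1),
     zero = germ X P (\<lambda>x. 0),
     add = (\<lambda>A B. \<Union>f\<in>A. \<Union>g\<in>B. germ X P (\<lambda>x. f x + g x)),
     smult = (\<lambda>c A. \<Union>f\<in>A. germ X P (\<lambda>x. c * f x)) \<rparr>"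

definition local_max_ideal ::
    "('v \<Rightarrow> 'k::field) set \<Rightarrow> ('v \<Rightarrow> 'k) \<Rightarrow> (('v \<Rightarrow> 'k) \<Rightarrow> 'k) set set" where
  "local_max_ideal X P = germ X P ` {f. regular_at X P f \<and> f P = 0}"

definition krull_dim :: "('a, 'm) ring_scheme \<Rightarrow> enat" where
  "krull_dim R = Sup {enat n | n.
     \<exists>p. (\<forall>i\<le>n. primeideal (p i) R) \<and> (\<forall>i<n. p i \<subset> p (Suc i))}"

primrec ideal_pow :: "('a, 'm) ring_scheme \<Rightarrow> 'a set \<Rightarrow> nat \<Rightarrow> 'a set" where
  "ideal_pow R I 0 = carrier R"
| "ideal_pow R I (Suc n) = ideal_prod R I (ideal_pow R I n)"

text \<open>
  The associated graded algebra \<open>\<Oplus>n. I^n / I^(n+1)\<close>.  An element is a finitely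
  supported sequence whose \<open>n\<close>-th entry is a coset of \<open>I^(n+1)\<close> contained in \<open>I^n\<close>.
  In \<open>mult\<close> and \<open>smult\<close> the unions range over representatives, and all their members
  coincide.
\<close>

definition gr :: "('k, 'a) module \<Rightarrow> 'a set \<Rightarrow> ('k, nat \<Rightarrow> 'a set) module" where
  "gr R I = \<lparr>
     carrier = {f. (\<forall>n. f n \<in> (\<lambda>a. ideal_pow R I (Suc n) +>\<^bsub>R\<^esub> a) ` ideal_pow R I n)
                   \<and> finite {n. f n \<noteq> ideal_pow R I (Suc n)}},
     mult = (\<lambda>f g n. \<Union>{ideal_pow R I (Suc n) +>\<^bsub>R\<^esub> (\<Oplus>\<^bsub>R\<^esub>i\<in>{..n}. a i \<otimes>\<^bsub>R\<^esub> b (n - i)) | a b.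
                         \<forall>i. a i \<in> f i \<and> b i \<in> g i}),
     one = (\<lambda>n. if n = 0 then ideal_pow R I 1 +>\<^bsub>R\<^esub> \<one>\<^bsub>R\<^esub> else ideal_pow R I (Suc n)),
     zero = (\<lambda>n. ideal_pow R I (Suc n)),
     add = (\<lambda>f g n. f n <+>\<^bsub>R\<^esub> g n),
     smult = (\<lambda>c f n. \<Union>a\<in>f n. ideal_pow R I (Suc n) +>\<^bsub>R\<^esub> (c \<odot>\<^bsub>R\<^esub> a)) \<rparr>"

definition gr_piece :: "('k, 'a) module \<Rightarrow> 'a set \<Rightarrow> nat \<Rightarrow> (nat \<Rightarrow> 'a set) set" where
  "gr_piece R I k = {f \<in> carrier (gr R I). \<forall>n. n \<noteq> k \<longrightarrow> f n = \<zero>\<^bsub>gr R I\<^esub> n}"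

text \<open>
  Dimension of the \<open>k\<close>-th graded piece over the piece of degree 0.  For a local ring with
  maximal ideal \<open>I\<close>, the latter is the residue field and the dimension is that of
  \<open>I^k / I^(k+1)\<close> over it; for \<open>local_ring X P\<close> the residue field is \<open>K\<close>.
\<close>

definition hilbert_function :: "('k, 'a) module \<Rightarrow> 'a set \<Rightarrow> nat \<Rightarrow> nat" where
  "hilbert_function R I k = ring.dim (gr R I) (gr_piece R I 0) (gr_piece R I k)"

definition hilbert_poly :: "('k, 'a) module \<Rightarrow> 'a set \<Rightarrow> rat poly" where
  "hilbert_poly R I =
     (THE p. \<exists>k0. \<forall>k\<ge>k0. poly p (of_nat k) = of_nat (hilbert_function R I k))"

text \<open>The degree of \<open>gr R I\<close> (meaningful when \<open>gr R I\<close> has positive finite dimension).\<close>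

definition gr_degree :: "('k, 'a) module \<Rightarrow> 'a set \<Rightarrow> rat" where
  "gr_degree R I =
     (THE e. \<exists>r. krull_dim (gr R I) = enat (r + 1) \<and> lead_coeff (hilbert_poly R I) = e / fact r)"

definition regular_local :: "('k, 'a) module \<Rightarrow> 'a set \<Rightarrow> bool" where
  "regular_local R I \<longleftrightarrow> enat (hilbert_function R I 1) = krull_dim R"

definition Sing :: "('v \<Rightarrow> 'k::field) set \<Rightarrow> ('v \<Rightarrow> 'k) set" where
  "Sing X = {P \<in> X. \<not> regular_local (local_ring X P) (local_max_ideal X P)}"

text \<open>The algebra of which the tangent cone is the spectrum.\<close>

definition tangent_cone ::
    "('v \<Rightarrow> 'k::field) set \<Rightarrow> ('v \<Rightarrow> 'k) \<Rightarrow> ('k, nat \<Rightarrow> (('v \<Rightarrow> 'k) \<Rightarrow> 'k) set set) module" where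
  "tangent_cone X P = gr (local_ring X P) (local_max_ideal X P)"

definition multiplicity_at :: "('v \<Rightarrow> 'k::field) set \<Rightarrow> ('v \<Rightarrow> 'k) \<Rightarrow> rat" where
  "multiplicity_at X P = gr_degree (local_ring X P) (local_max_ideal X P)"


section \<open>Cones and affine toric varieties\<close>

text \<open>
  For a finite set \<open>J\<close>, the space \<open>N\<^sub>\<real>\<close> (and likewise \<open>M\<^sub>\<real>\<close>)
  consists of the functions \<open>'a \<Rightarrow> real\<close> vanishing outside \<open>J\<close>.
\<close>

definition pairing :: "'a set \<Rightarrow> ('a \<Rightarrow> real) \<Rightarrow> ('a \<Rightarrow> real) \<Rightarrow> real" where
  "pairing J u v = (\<Sum>z\<in>J. u z * v z)"

definition cone_gen :: "('a \<Rightarrow> real) set \<Rightarrow> ('a \<Rightarrow> real) set" where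
  "cone_gen G = {\<lambda>z. \<Sum>g\<in>G. c g * g z | c. \<forall>g\<in>G. 0 \<le> c g}"

definition is_face :: "'a set \<Rightarrow> ('a \<Rightarrow> real) set \<Rightarrow> ('a \<Rightarrow> real) set \<Rightarrow> bool" where
  "is_face J \<tau> \<sigma> \<longleftrightarrow>
     (\<exists>u. (\<forall>v\<in>\<sigma>. 0 \<le> pairing J u v) \<and> \<tau> = {v \<in> \<sigma>. pairing J u v = 0})"

text \<open>\<open>M = \<int>\<^sup>J\<close> is the group of finitely supported integer functions with support in \<open>J\<close>.\<close>

definition dual_semigroup :: "'a set \<Rightarrow> ('a \<Rightarrow> real) set \<Rightarrow> ('a \<Rightarrow>\<^sub>0 int) set" where
  "dual_semigroup J \<sigma> = {u. Poly_Mapping.keys u \<subseteq> J \<and>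
     (\<forall>v\<in>\<sigma>. 0 \<le> pairing J (\<lambda>z. of_int (Poly_Mapping.lookup u z)) v)}"

definition semigroup_algebra ::
    "('a \<Rightarrow>\<^sub>0 int) set \<Rightarrow> ('k::field, ('a \<Rightarrow>\<^sub>0 int) \<Rightarrow>\<^sub>0 'k) module" where
  "semigroup_algebra S = \<lparr> carrier = {p. Poly_Mapping.keys p \<subseteq> S},
     mult = (*), one = 1, zero = 0, add = (+),
     smult = (\<lambda>c p. Poly_Mapping.single 0 c * p) \<rparr>"

text \<open>
  \<open>Spec A\<close> is an affine toric variety: \<open>A \<cong> K[\<sigma>\<^sup>\<or> \<inter> M]\<close> for a strongly convex rational
  polyhedral cone \<open>\<sigma>\<close> in \<open>\<real>\<^sup>r\<close>.
\<close>

definition affine_toric :: "('k::field, 'a) module \<Rightarrow> bool" where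
  "affine_toric A \<longleftrightarrow>
     (\<exists>(r::nat) (G :: (nat \<Rightarrow> real) set).
        finite G \<and> (\<forall>g\<in>G. \<forall>z. g z \<in> \<int> \<and> (z \<ge> r \<longrightarrow> g z = 0)) \<and>
        (\<forall>v. v \<in> cone_gen G \<and> (\<lambda>z. - v z) \<in> cone_gen G \<longrightarrow> v = (\<lambda>z. 0)) \<and>
        alg_isomorphic A (semigroup_algebra (dual_semigroup {..<r} (cone_gen G))))"


section \<open>Hibi varieties\<close>

text \<open>
  The zero locus of the binomials \<open>X\<^sub>\<alpha> X\<^sub>\<beta> - X\<^sub>\<alpha>\<^sub>\<or>\<^sub>\<beta> X\<^sub>\<alpha>\<^sub>\<and>\<^sub>\<beta>\<close>; these generate a prime
  ideal, hence the vanishing ideal of this locus.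
\<close>

definition hibi_variety :: "'a gorder \<Rightarrow> ('a \<Rightarrow> 'k::field) set" where
  "hibi_variety L = {x \<in> affine_space (carrier L).
     \<forall>\<alpha>\<in>carrier L. \<forall>\<beta>\<in>carrier L.
       x \<alpha> * x \<beta> - x (\<alpha> \<squnion>\<^bsub>L\<^esub> \<beta>) * x (\<alpha> \<sqinter>\<^bsub>L\<^esub> \<beta>) = 0}"

definition join_irreducibles :: "'a gorder \<Rightarrow> 'a set" where
  "join_irreducibles L = {z \<in> carrier L.
     \<forall>x\<in>carrier L. \<forall>y\<in>carrier L. z = x \<squnion>\<^bsub>L\<^esub> y \<longrightarrow> z = x \<or> z = y}"

definition unit_vec :: "'a \<Rightarrow> 'a \<Rightarrow> real" where
  "unit_vec z = (\<lambda>w. if w = z then 1 else 0)"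

definition is_maximal_in :: "'a gorder \<Rightarrow> 'a set \<Rightarrow> 'a \<Rightarrow> bool" where
  "is_maximal_in L J z \<longleftrightarrow> z \<in> J \<and> \<not> (\<exists>w\<in>J. z \<sqsubset>\<^bsub>L\<^esub> w)"

definition covers_in :: "'a gorder \<Rightarrow> 'a set \<Rightarrow> 'a \<Rightarrow> 'a \<Rightarrow> bool" where
  "covers_in L J y y' \<longleftrightarrow> y \<in> J \<and> y' \<in> J \<and> y' \<sqsubset>\<^bsub>L\<^esub> y \<and>
     \<not> (\<exists>w\<in>J. y' \<sqsubset>\<^bsub>L\<^esub> w \<and> w \<sqsubset>\<^bsub>L\<^esub> y)"

definition hibi_cone :: "'a gorder \<Rightarrow> ('a \<Rightarrow> real) set" where
  "hibi_cone L = cone_gen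
     ({unit_vec z | z. is_maximal_in L (join_irreducibles L) z} \<union>
      {\<lambda>w. unit_vec y' w - unit_vec y w | y y'. covers_in L (join_irreducibles L) y y'})"

definition f_ideal :: "'a gorder \<Rightarrow> 'a \<Rightarrow> 'a \<Rightarrow> real" where
  "f_ideal L \<alpha> = (\<lambda>w. \<Sum>z\<in>{z \<in> join_irreducibles L. z \<sqsubseteq>\<^bsub>L\<^esub> \<alpha>}. unit_vec z w)"

definition P_face :: "'a gorder \<Rightarrow> ('a \<Rightarrow> real) set \<Rightarrow> ('a \<Rightarrow> 'k::field)" where
  "P_face L \<tau> = (\<lambda>\<alpha>. if \<alpha> \<in> carrier L \<and>
     (\<forall>v\<in>\<tau>. pairing (join_irreducibles L) (f_ideal L \<alpha>) v = 0) then 1 else 0)"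

definition D_face :: "'k::field itself \<Rightarrow> 'a gorder \<Rightarrow> ('a \<Rightarrow> real) set \<Rightarrow> 'a set" where
  "D_face k L \<tau> = {\<alpha> \<in> carrier L. (P_face L \<tau> :: 'a \<Rightarrow> 'k) \<alpha> \<noteq> 0}"


section \<open>The lattice \<open>I\<^sub>d\<^sub>,\<^sub>n\<close>\<close>

definition I_lat :: "nat \<Rightarrow> nat \<Rightarrow> nat list gorder" where
  "I_lat d n = \<lparr> carrier = {xs. length xs = d \<and> sorted_wrt (<) xs \<and> set xs \<subseteq> {1..n}},
     eq = (=), le = list_all2 (\<le>) \<rparr>"

definition mu :: "nat \<Rightarrow> nat \<Rightarrow> nat \<Rightarrow> nat list" where
  "mu d i j = [1..<j + 1] @ [i + j + 1..<i + d + 1]"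

definition lam :: "nat \<Rightarrow> nat \<Rightarrow> nat \<Rightarrow> nat \<Rightarrow> nat list" where
  "lam d n i j = [i + 1..<i + j + 1] @ [n + 1 + j - d..<n + 1]"

definition L_sub :: "nat \<Rightarrow> nat \<Rightarrow> nat \<Rightarrow> nat \<Rightarrow> nat list set" where
  "L_sub d n i j = carrier (I_lat d n) - \<lbrace>mu d i j..lam d n i j\<rbrace>\<^bsub>I_lat d n\<^esub>"


section \<open>The quadric cone and its singularity type\<close>

definition quadric_cone :: "(nat \<Rightarrow> 'k::field) set" where
  "quadric_cone = {x \<in> affine_space {1..4}. x 1 * x 4 - x 2 * x 3 = 0}"

text \<open>
  There is no loss in taking \<open>Y\<close> quasi-affine: it is isomorphic to the closed subset
  \<open>{0} \<times> Y\<close> of the quasi-affine variety \<open>Z \<times> Y \<cong> U\<close>.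
\<close>

definition same_type_as_vertex ::
    "('v \<Rightarrow> 'k::field) set \<Rightarrow> ('v \<Rightarrow> 'k) \<Rightarrow> (nat \<Rightarrow> 'k) set \<Rightarrow> bool" where
  "same_type_as_vertex X P Z \<longleftrightarrow>
     (\<exists>U V (Y :: (nat \<Rightarrow> 'k) set) \<phi>.
        openin (subtopology zariski X) U \<and> P \<in> U \<and>
        quasi_affine V Y \<and> Sing Y = {} \<and>
        variety_isomorphism U (variety_prod Z Y) \<phi> \<and>
        (\<exists>y\<in>Y. \<phi> P = case_sum (\<lambda>_. 0) y))"

end

theory Submission
  imports Defs
begin

text \<open>
  The join-irreducibles of \<open>I\<^sub>d\<^sub>,\<^sub>n\<close> other than the minimum form a \<open>d \<times> (n - d)\<close> grid, and
  the Hibi variety is parametrized by functions on the order ideals \<open>A\<close> of this grid. On the open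
  set where the coordinates indexed by \<open>\<L>\<^sub>i\<^sub>j\<close> do not vanish, the binomial relations show that
  adding a box to an order ideal multiplies the coordinate by a factor depending on the box alone,
  except for the four boxes of one \<open>2 \<times> 2\<close> square. The factors of the other boxes, the coordinate of
  the empty ideal and the factor of the complete square are units, and the four proper nonempty
  parts of the square give coordinates on the quadric cone; so this open set is the product of the
  quadric cone and a torus, with \<open>P\<^sub>\<tau>\<close> in the fibre over the vertex.

  The cone \<open>W\<close> obtained by replacing the torus by an affine space has a coordinate ring with a
  multiplicative basis of monomials. The monomials of degree \<open>k\<close> span \<open>\<mm>\<^sup>k\<close> modulo \<open>\<mm>\<^sup>k\<^sup>+\<^sup>1\<close>, and they
  are independent there because an element of \<open>\<mm>\<^sup>k\<^sup>+\<^sup>1\<close> vanishes to order greater than \<open>k\<close> along every line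
  through the vertex. Hence the tangent cone is the coordinate ring of \<open>W\<close>. Krull dimensions are
  bounded above by comparing the number of monomials in the elements of a chain of primes with the
  growth of the Hilbert function, and below by explicit chains of irreducible subsets.
\<close>

section \<open>Associated graded algebras with a multiplicative basis\<close>

text \<open>Regularity, tangent cone and multiplicity all come from one count of monomials, applied
  to two cones: the quadric cone times an affine space at \<open>P\<close>, and plain affine space
  at the points of \<open>Y\<close>. The obstacle is that the local ring consists of germs of
  fractions, and the powers of its maximal ideal have no explicit description. Orders along lines
  replace one, since a fraction whose denominator is nonzero at the vertex restricts to a fraction
  of the same kind on every line.

  With \<open>m = n - d\<close> there are \<open>d * m + 1\<close> join-irreducibles. The torus has
  one coordinate for the empty ideal, one for the complete square and one for each of the
  \<open>d * m - 4\<close> other boxes, so \<open>N = d * m - 2\<close>; the quadric cone adds 3.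
  The embedding dimension is \<open>N + 4\<close>, so the upper bound \<open>N + 3\<close> on the
  dimension already makes the point singular. Lower bounds are needed for the degree of the graded
  ring, which is normalized by its dimension, and for the regularity of \<open>Y\<close>. The
  multiplicity 2 is the value at 1 of the numerator of the Hilbert series
  \<open>(1 + x) / (1 - x)^(N + 3)\<close>.\<close>

lemma poly_mapping_induct_on [consumes 1, case_names zero single_add]:
  fixes p :: "'a \<Rightarrow>\<^sub>0 'b::ab_group_add"
  assumes "Poly_Mapping.keys p \<subseteq> S"
    and zero: "Q 0"
    and add: "\<And>u c p. u \<in> S \<Longrightarrow> Poly_Mapping.keys p \<subseteq> S \<Longrightarrow> Q p \<Longrightarrow> Q (Poly_Mapping.single u c + p)"
  shows "Q p"
proof -
  have "Poly_Mapping.keys p = F \<longrightarrow> Q p" if "finite F" "F \<subseteq> S" for F p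
    using that
  proof (induction F arbitrary: p)
    case empty
    then show ?case using zero by simp
  next
    case (insert u F)
    show ?case
    proof
      assume k: "Poly_Mapping.keys p = insert u F"
      define q where "q = p - Poly_Mapping.single u (Poly_Mapping.lookup p u)"
      have lq: "Poly_Mapping.lookup q v = (if v = u then 0 else Poly_Mapping.lookup p v)" for v
        by (simp add: q_def lookup_minus lookup_single when_def)
      have kq: "Poly_Mapping.keys q = F"
        using k insert(2) by (auto simp: in_keys_iff lq set_eq_iff split: if_splits)
      have "p = Poly_Mapping.single u (Poly_Mapping.lookup p u) + q"
        by (simp add: q_def)
      moreover have "Q q" using insert kq by blast
      ultimately show "Q p" using add[of u q "Poly_Mapping.lookup p u"] kq insert by force
    qed
  qed
  from this[OF finite_keys assms(1)] show ?thesis by blast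
qed

lemma cring_semigroup_algebra:
  assumes "0 \<in> S" "\<And>u v. u \<in> S \<Longrightarrow> v \<in> S \<Longrightarrow> u + v \<in> S"
  shows "cring (semigroup_algebra S :: ('k::field, ('b \<Rightarrow>\<^sub>0 int) \<Rightarrow>\<^sub>0 'k) module)"
    (is "cring ?A")
proof (rule cringI)
  show "abelian_group ?A"
  proof (rule abelian_groupI)
    fix x y assume "x \<in> carrier ?A" "y \<in> carrier ?A"
    then show "x \<oplus>\<^bsub>?A\<^esub> y \<in> carrier ?A"
      using keys_add[of x y] by (auto simp: semigroup_algebra_def)
  next
    fix x assume "x \<in> carrier ?A"
    then show "\<exists>y\<in>carrier ?A. y \<oplus>\<^bsub>?A\<^esub> x = \<zero>\<^bsub>?A\<^esub>"
      by (intro bexI[of _ "- x"]) (auto simp: semigroup_algebra_def in_keys_iff)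
  qed (auto simp: semigroup_algebra_def add.assoc intro: add.commute)
  show "comm_monoid ?A"
  proof (rule comm_monoidI)
    fix x y assume "x \<in> carrier ?A" "y \<in> carrier ?A"
    then show "x \<otimes>\<^bsub>?A\<^esub> y \<in> carrier ?A"
      using keys_mult[of x y] assms(2) by (fastforce simp: semigroup_algebra_def)
  qed (use assms(1) in \<open>auto simp: semigroup_algebra_def mult.assoc intro: mult.commute\<close>)
qed (auto simp: semigroup_algebra_def distrib_right)

text \<open>The scalars form a field type rather than a carrier, and the record imposes no law on
  \<open>smult\<close>; the laws that the local ring satisfies are collected here.\<close>

locale K_algebra = cring R for R :: "('k::field, 'a) module" (structure) +
  assumes smult_closed [simp, intro]: "a \<in> carrier R \<Longrightarrow> c \<odot> a \<in> carrier R"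
    and smult_l_distr: "a \<in> carrier R \<Longrightarrow> (c + d) \<odot> a = c \<odot> a \<oplus> d \<odot> a"
    and smult_r_distr: "a \<in> carrier R \<Longrightarrow> b \<in> carrier R \<Longrightarrow> c \<odot> (a \<oplus> b) = c \<odot> a \<oplus> c \<odot> b"
    and smult_assoc: "a \<in> carrier R \<Longrightarrow> (c * d) \<odot> a = c \<odot> (d \<odot> a)"
    and smult_one [simp]: "a \<in> carrier R \<Longrightarrow> 1 \<odot> a = a"
    and smult_mult: "a \<in> carrier R \<Longrightarrow> b \<in> carrier R \<Longrightarrow> (c \<odot> a) \<otimes> b = c \<odot> (a \<otimes> b)"
begin

text \<open>Scalars act as multiplication by multiples of \<open>\<one>\<close>, so whatever is
  closed under ring multiplication, ideals in particular, is closed under scalars.\<close>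

lemma smult_eq_mult: "a \<in> carrier R \<Longrightarrow> c \<odot> a = (c \<odot> \<one>) \<otimes> a"
  by (simp add: smult_mult)

lemma smult_zero [simp]: "a \<in> carrier R \<Longrightarrow> 0 \<odot> a = \<zero>"
proof -
  assume a: "a \<in> carrier R"
  have "0 \<odot> a \<oplus> 0 \<odot> a = 0 \<odot> a \<oplus> \<zero>"
    using smult_l_distr[OF a, of 0 0] a by simp
  then have "\<ominus> (0 \<odot> a) \<oplus> (0 \<odot> a \<oplus> 0 \<odot> a) = \<ominus> (0 \<odot> a) \<oplus> (0 \<odot> a \<oplus> \<zero>)"
    by (simp only:)
  then show ?thesis using a by (simp only: r_neg1 smult_closed zero_closed)
qed

lemma smult_zero_right [simp]: "c \<odot> \<zero> = \<zero>"
  using smult_eq_mult[of \<zero> c] by simp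

lemma smult_mult_right: "a \<in> carrier R \<Longrightarrow> b \<in> carrier R \<Longrightarrow> a \<otimes> (c \<odot> b) = c \<odot> (a \<otimes> b)"
  using smult_mult[of b a c] by (simp add: m_comm)

lemma ideal_smult_closed: "ideal H R \<Longrightarrow> a \<in> H \<Longrightarrow> c \<odot> a \<in> H"
  by (subst smult_eq_mult) (auto intro: ideal.I_l_closed ideal.Icarr)

lemma finsum_in_ideal:
  assumes "ideal H R"
  shows "finite A \<Longrightarrow> f \<in> A \<rightarrow> H \<Longrightarrow> (\<Oplus>i\<in>A. f i) \<in> H"
proof (induction rule: finite_induct)
  case empty
  show ?case using additive_subgroup.zero_closed[OF ideal.axioms(1)[OF assms]] by simp
next
  case (insert x F)
  have H: "f x \<in> H" "f \<in> F \<rightarrow> H" using insert(4) by auto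
  have "f \<in> F \<rightarrow> carrier R" "f x \<in> carrier R"
    using H ideal.Icarr[OF assms] by (blast, blast)
  then have "finsum R f (insert x F) = f x \<oplus> finsum R f F"
    using insert(1,2) by simp
  then show ?case
    using additive_subgroup.a_closed[OF ideal.axioms(1)[OF assms] H(1) insert(3)[OF H(2)]] by simp
qed

end

declare ideal_pow.simps(2) [simp del]

section \<open>Powers of an ideal and the operations of the associated graded ring\<close>

locale ideal_filtration = K_algebra R + ideal I R for R :: "('k::field, 'a) module" (structure) and I
begin

abbreviation "pw k \<equiv> ideal_pow R I k"

lemma ideal_pw: "ideal (pw k) R"
  by (induction k) (auto simp: ideal_pow.simps(2) intro: oneideal ideal_prod_is_ideal is_ideal)

lemma pw_carr [simp]: "a \<in> pw k \<Longrightarrow> a \<in> carrier R"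
  using ideal.Icarr[OF ideal_pw] .

lemma pw_add: "a \<in> pw k \<Longrightarrow> b \<in> pw k \<Longrightarrow> a \<oplus> b \<in> pw k"
  using additive_subgroup.a_closed[OF ideal.axioms(1)[OF ideal_pw]] .

lemma pw_smult: "a \<in> pw k \<Longrightarrow> c \<odot> a \<in> pw k"
  using ideal_smult_closed[OF ideal_pw] .

lemma pw_Suc_subset: "pw (Suc k) \<subseteq> pw k"
  using ideal_prod_inter[OF is_ideal ideal_pw[of k]] by (auto simp: ideal_pow.simps(2))

lemma pw_antimono: "k \<le> l \<Longrightarrow> pw l \<subseteq> pw k"
  using lift_Suc_antimono_le[of pw] pw_Suc_subset by blast

text \<open>Induction on \<open>k\<close> peels off one factor from \<open>I\<close>; the inner
  induction follows the inductive generation of the ideal product.\<close>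

lemma pw_mult: "a \<in> pw k \<Longrightarrow> b \<in> pw l \<Longrightarrow> a \<otimes> b \<in> pw (k + l)"
proof (induction k arbitrary: a)
  case 0
  then show ?case using ideal.I_l_closed[OF ideal_pw, of b l a] by simp
next
  case (Suc k)
  have "a \<in> ideal_prod R I (pw k)" using Suc.prems by (simp add: ideal_pow.simps(2))
  \<comment> \<open>The carrier condition is carried along because the sum case needs it for
    distributivity.\<close>
  then have "a \<in> carrier R \<and> a \<otimes> b \<in> pw (Suc k + l)"
  proof (induction rule: ideal_prod.induct)
    case (prod i j)
    then have "i \<otimes> (j \<otimes> b) \<in> pw (Suc k + l)"
      using Suc.IH[of j] Suc.prems(2) by (auto simp: ideal_pow.simps(2) intro!: ideal_prod.prod)
    then show ?case using prod Suc.prems(2) by (auto simp: m_assoc)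
  next
    case (sum s1 s2)
    then show ?case using Suc.prems(2) pw_add by (auto simp: l_distr)
  qed
  then show ?case by simp
qed

abbreviation "cls k a \<equiv> pw (Suc k) +> a"

lemma cls_eq_iff: "a \<in> carrier R \<Longrightarrow> b \<in> carrier R \<Longrightarrow> cls k a = cls k b \<longleftrightarrow> a \<ominus> b \<in> pw (Suc k)"
  using quotient_eq_iff_same_a_r_cos[OF ideal_pw[of "Suc k"], of a b] by blast

lemma abelian_subgroup_pw: "abelian_subgroup (pw k) R"
  using ideal_pw[of k] by (meson abelian_subgroupI3 ideal.axioms(1) is_abelian_group)

lemma cls_add:
  "a \<in> carrier R \<Longrightarrow> b \<in> carrier R \<Longrightarrow> cls k a <+>\<^bsub>R\<^esub> cls k b = cls k (a \<oplus> b)"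
  using abelian_subgroup.a_rcos_sum[OF abelian_subgroup_pw] .

lemma cls_zero: "cls k \<zero> = pw (Suc k)"
  using a_coset_add_zero[of "pw (Suc k)"] pw_carr by blast

lemma in_clsD: 
  assumes "b \<in> cls k a" "a \<in> carrier R" shows "b \<in> carrier R \<and> b \<ominus> a \<in> pw (Suc k)"
proof -
  have "b \<in> carrier R"
    using abelian_subgroup.a_elemrcos_carrier[OF abelian_subgroup_pw assms(2,1)] .
  then show ?thesis
    using assms abelian_subgroup.a_rcos_module_minus[OF abelian_subgroup_pw ring_axioms assms(2), of b] by blast
qed

lemma self_in_cls: "a \<in> carrier R \<Longrightarrow> a \<in> cls k a"
  using abelian_subgroup.a_rcos_self[OF abelian_subgroup_pw] .

lemma cls_finsum_cong:
  assumes "finite A" "f \<in> A \<rightarrow> carrier R" "g \<in> A \<rightarrow> carrier R"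
    "\<And>i. i \<in> A \<Longrightarrow> cls k (f i) = cls k (g i)"
  shows "cls k (\<Oplus>i\<in>A. f i) = cls k (\<Oplus>i\<in>A. g i)"
  using assms
proof (induction rule: finite_induct)
  case (insert x F)
  then have eq: "cls k (f x) <+>\<^bsub>R\<^esub> cls k (\<Oplus>i\<in>F. f i) = cls k (g x) <+>\<^bsub>R\<^esub> cls k (\<Oplus>i\<in>F. g i)"
    by simp
  moreover have "f \<in> F \<rightarrow> carrier R" "g \<in> F \<rightarrow> carrier R" "f x \<in> carrier R" "g x \<in> carrier R"
    using insert by auto
  ultimately have "cls k (finsum R f (insert x F)) = cls k (f x) <+>\<^bsub>R\<^esub> cls k (finsum R f F)"
    "cls k (finsum R g (insert x F)) = cls k (g x) <+>\<^bsub>R\<^esub> cls k (finsum R g F)"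
    using insert(1,2,5) by (simp_all add: cls_add)
  then show ?case
    using eq by (simp only:)
qed auto

text \<open>The difference of the products is \<open>(a' - a) b + a' (b' - b)\<close>, and each
  error term gains one power of \<open>I\<close>.\<close>

lemma cls_mult_cong:
  assumes "a \<in> pw i" "b \<in> pw j" "a' \<in> cls i a" "b' \<in> cls j b"
  shows "cls (i + j) (a' \<otimes> b') = cls (i + j) (a \<otimes> b)"
proof -
  note a' = in_clsD[OF assms(3) pw_carr[OF assms(1)]] and b' = in_clsD[OF assms(4) pw_carr[OF assms(2)]]
  have a'i: "a' \<in> pw i"
  proof -
    have "a' = (a' \<ominus> a) \<oplus> a" using a' assms(1) pw_carr[OF assms(1)] by algebra
    then show ?thesis using pw_add[of "a' \<ominus> a" i a] a' assms(1) pw_Suc_subset by auto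
  qed
  have "(a' \<ominus> a) \<otimes> b \<in> pw (Suc (i + j))"
    using pw_mult[of "a' \<ominus> a" "Suc i" b j] a' assms by simp
  moreover have "a' \<otimes> (b' \<ominus> b) \<in> pw (Suc (i + j))"
    using pw_mult[of a' i "b' \<ominus> b" "Suc j"] b' a'i by simp
  moreover have "a' \<otimes> b' \<ominus> a \<otimes> b = (a' \<ominus> a) \<otimes> b \<oplus> a' \<otimes> (b' \<ominus> b)"
    using a' b' pw_carr[OF assms(1)] pw_carr[OF assms(2)] by algebra
  ultimately have "a' \<otimes> b' \<ominus> a \<otimes> b \<in> pw (Suc (i + j))" using pw_add by simp
  then show ?thesis using cls_eq_iff a' b' pw_carr[OF assms(1)] pw_carr[OF assms(2)] by simp
qed

text \<open>The product in \<open>gr\<close> is a union over all families of representatives. All of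
  them give the same coset, so the union has a single member and can be computed from any chosen
  representatives.\<close>

lemma gr_mult_cls:
  assumes a: "\<And>i. a i \<in> pw i" and b: "\<And>i. b i \<in> pw i"
  shows "(\<lambda>k. cls k (a k)) \<otimes>\<^bsub>gr R I\<^esub> (\<lambda>k. cls k (b k)) = (\<lambda>n. cls n (\<Oplus>i\<in>{..n}. a i \<otimes> b (n - i)))"
proof
  fix n
  have carr: "a i \<in> carrier R" "b i \<in> carrier R" for i using a b pw_carr by blast+
  have "{cls n (\<Oplus>i\<in>{..n}. a' i \<otimes> b' (n - i)) | a' b'. \<forall>i. a' i \<in> cls i (a i) \<and> b' i \<in> cls i (b i)}
     = {cls n (\<Oplus>i\<in>{..n}. a i \<otimes> b (n - i))}" (is "?L = ?R")
  proof
    show "?L \<subseteq> ?R"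
    proof
      fix x assume "x \<in> ?L"
      then obtain a' b' where x: "x = cls n (\<Oplus>i\<in>{..n}. a' i \<otimes> b' (n - i))"
        and ab: "\<And>i. a' i \<in> cls i (a i)" "\<And>i. b' i \<in> cls i (b i)" by blast
      have c': "a' i \<in> carrier R" "b' i \<in> carrier R" for i
        using in_clsD ab carr by blast+
      have "cls n (\<Oplus>i\<in>{..n}. a' i \<otimes> b' (n - i)) = cls n (\<Oplus>i\<in>{..n}. a i \<otimes> b (n - i))"
      proof (rule cls_finsum_cong)
        fix i assume "i \<in> {..n}"
        then show "cls n (a' i \<otimes> b' (n - i)) = cls n (a i \<otimes> b (n - i))"
          using cls_mult_cong[of "a i" i "b (n - i)" "n - i" "a' i" "b' (n - i)"] a b ab by simp
      qed (use c' carr in auto)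
      then show "x \<in> ?R" using x by simp
    qed
    show "?R \<subseteq> ?L" using self_in_cls carr by blast
  qed
  then show "((\<lambda>k. cls k (a k)) \<otimes>\<^bsub>gr R I\<^esub> (\<lambda>k. cls k (b k))) n = cls n (\<Oplus>i\<in>{..n}. a i \<otimes> b (n - i))"
    by (simp add: gr_def)
qed

lemma gr_smult_cls:
  assumes a: "\<And>i. a i \<in> pw i"
  shows "c \<odot>\<^bsub>gr R I\<^esub> (\<lambda>k. cls k (a k)) = (\<lambda>k. cls k (c \<odot> a k))"
proof
  fix n
  have carr: "a i \<in> carrier R" for i using a pw_carr by blast
  have "cls n (c \<odot> x) = cls n (c \<odot> a n)" if "x \<in> cls n (a n)" for x
  proof -
    note x = in_clsD[OF that carr]
    have "c \<odot> (x \<ominus> a n) \<in> pw (Suc n)" using x pw_smult by blast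
    moreover have "c \<odot> (x \<ominus> a n) = c \<odot> x \<ominus> c \<odot> a n"
      using smult_eq_mult[of "x \<ominus> a n" c] smult_eq_mult[of x c] smult_eq_mult[of "a n" c] x carr
      by (simp add: r_minus r_distr minus_eq)
    ultimately show ?thesis using cls_eq_iff x carr by auto
  qed
  then have "(\<Union>x\<in>cls n (a n). cls n (c \<odot> x)) = cls n (c \<odot> a n)"
    using self_in_cls[OF carr] by blast
  then show "(c \<odot>\<^bsub>gr R I\<^esub> (\<lambda>k. cls k (a k))) n = cls n (c \<odot> a n)"
    by (simp add: gr_def)
qed

end

text \<open>That only 0 has degree 0 makes the degree-zero part of the semigroup algebra the field
  of constants, which becomes the residue field.\<close>

locale graded_semigroup =
  fixes S :: "('b \<Rightarrow>\<^sub>0 int) set" and deg :: "('b \<Rightarrow>\<^sub>0 int) \<Rightarrow> nat"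
  assumes S_zero [simp]: "0 \<in> S" and S_add: "u \<in> S \<Longrightarrow> v \<in> S \<Longrightarrow> u + v \<in> S"
    and deg_add: "u \<in> S \<Longrightarrow> v \<in> S \<Longrightarrow> deg (u + v) = deg u + deg v"
    and deg_eq_0D: "u \<in> S \<Longrightarrow> deg u = 0 \<Longrightarrow> u = 0"
begin

lemma keys_mult_S: "Poly_Mapping.keys p \<subseteq> S \<Longrightarrow> Poly_Mapping.keys q \<subseteq> S \<Longrightarrow> Poly_Mapping.keys (p * q) \<subseteq> S"
  using keys_mult[of p q] S_add by blast

lemma keys_add_S: "Poly_Mapping.keys p \<subseteq> S \<Longrightarrow> Poly_Mapping.keys q \<subseteq> S \<Longrightarrow> Poly_Mapping.keys (p + q) \<subseteq> S"
  using keys_add[of p q] by blast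

lemma deg_0 [simp]: "deg 0 = 0" using deg_add[of 0 0] by simp

end

text \<open>The monomials of degree \<open>k\<close> form a basis of \<open>I^k / I^(k+1)\<close>,
  stated with representatives so that no quotient space has to be formed. Multiplicativity of
  \<open>\<chi>\<close> then determines the whole graded ring.\<close>

locale graded_basis = ideal_filtration R I + graded_semigroup S deg
  for R :: "('k::field, 'a) module" (structure) and I
  and S :: "('b \<Rightarrow>\<^sub>0 int) set" and deg :: "('b \<Rightarrow>\<^sub>0 int) \<Rightarrow> nat" +
  fixes \<chi> :: "('b \<Rightarrow>\<^sub>0 int) \<Rightarrow> 'a"
  assumes \<chi>_pw: "u \<in> S \<Longrightarrow> \<chi> u \<in> pw (deg u)"
    and \<chi>_add: "u \<in> S \<Longrightarrow> v \<in> S \<Longrightarrow> \<chi> (u + v) = \<chi> u \<otimes> \<chi> v"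
    and \<chi>_0: "\<chi> 0 = \<one>"
    and pw_span: "a \<in> pw k \<Longrightarrow> \<exists>T c. finite T \<and> T \<subseteq> {u \<in> S. deg u = k} \<and>
        a \<ominus> (\<Oplus>u\<in>T. c u \<odot> \<chi> u) \<in> pw (Suc k)"
    and pw_indep: "finite T \<Longrightarrow> T \<subseteq> {u \<in> S. deg u = k} \<Longrightarrow> (\<Oplus>u\<in>T. c u \<odot> \<chi> u) \<in> pw (Suc k)
        \<Longrightarrow> u \<in> T \<Longrightarrow> c u = 0"
begin

lemma \<chi>_carr [simp]: "u \<in> S \<Longrightarrow> \<chi> u \<in> carrier R" using \<chi>_pw pw_carr by blast

text \<open>A representative in \<open>R\<close> of the degree-\<open>k\<close> entry of the image
  of \<open>p\<close> in \<open>gr\<close>. Sums and products are computed on these representatives,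
  and cosets are taken only at the end.\<close>

definition part :: "nat \<Rightarrow> (('b \<Rightarrow>\<^sub>0 int) \<Rightarrow>\<^sub>0 'k) \<Rightarrow> 'a" where
  "part k p = (\<Oplus>u\<in>{u \<in> Poly_Mapping.keys p. deg u = k}. Poly_Mapping.lookup p u \<odot> \<chi> u)"

lemma part_eq:
  assumes "finite T" "T \<subseteq> S" "{u \<in> Poly_Mapping.keys p. deg u = k} \<subseteq> T" "\<And>u. u \<in> T \<Longrightarrow> deg u = k"
  shows "part k p = (\<Oplus>u\<in>T. Poly_Mapping.lookup p u \<odot> \<chi> u)"
  unfolding part_def
proof (rule add.finprod_mono_neutral_cong_left)
  fix u assume "u \<in> T - {u \<in> Poly_Mapping.keys p. deg u = k}"
  then have "Poly_Mapping.lookup p u = 0" "u \<in> S" using assms by (auto simp: in_keys_iff)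
  then show "Poly_Mapping.lookup p u \<odot> \<chi> u = \<zero>" by simp
qed (use assms in auto)

lemma part_pw: "Poly_Mapping.keys p \<subseteq> S \<Longrightarrow> part k p \<in> pw k"
  unfolding part_def by (rule finsum_in_ideal[OF ideal_pw]) (use \<chi>_pw pw_smult in auto)

lemma part_carr: "Poly_Mapping.keys p \<subseteq> S \<Longrightarrow> part k p \<in> carrier R"
  using part_pw pw_carr by blast

lemma part_add:
  assumes p: "Poly_Mapping.keys p \<subseteq> S" and q: "Poly_Mapping.keys q \<subseteq> S"
  shows "part k (p + q) = part k p \<oplus> part k q"
proof -
  let ?T = "{u \<in> Poly_Mapping.keys p \<union> Poly_Mapping.keys q. deg u = k}"
  have "part k (p + q) = (\<Oplus>u\<in>?T. Poly_Mapping.lookup (p + q) u \<odot> \<chi> u)"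
    using p q keys_add[of p q] by (intro part_eq) auto
  also have "\<dots> = (\<Oplus>u\<in>?T. Poly_Mapping.lookup p u \<odot> \<chi> u \<oplus> Poly_Mapping.lookup q u \<odot> \<chi> u)"
    using p q by (intro finsum_cong') (auto simp: lookup_add smult_l_distr)
  also have "\<dots> = (\<Oplus>u\<in>?T. Poly_Mapping.lookup p u \<odot> \<chi> u) \<oplus> (\<Oplus>u\<in>?T. Poly_Mapping.lookup q u \<odot> \<chi> u)"
    using p q by (intro finsum_addf) auto
  also have "(\<Oplus>u\<in>?T. Poly_Mapping.lookup p u \<odot> \<chi> u) = part k p"
    using p q by (intro part_eq[symmetric]) auto
  also have "(\<Oplus>u\<in>?T. Poly_Mapping.lookup q u \<odot> \<chi> u) = part k q"
    using p q by (intro part_eq[symmetric]) auto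
  finally show ?thesis .
qed

lemma part_0 [simp]: "part k 0 = \<zero>"
  by (simp add: part_def)

lemma part_single: "u \<in> S \<Longrightarrow> part k (Poly_Mapping.single u c) = (if deg u = k then c \<odot> \<chi> u else \<zero>)"
proof (cases "deg u = k")
  case True
  moreover assume "u \<in> S"
  ultimately show ?thesis
    using part_eq[of "{u}" "Poly_Mapping.single u c" k] by (cases "c = 0") auto
next
  case False
  then have "{v \<in> Poly_Mapping.keys (Poly_Mapping.single u c). deg v = k} = {}" by auto
  then show ?thesis using False unfolding part_def by (simp only: finsum_empty if_False)
qed

text \<open>Both sides are additive in \<open>q\<close>, so a single term may be taken for
  \<open>q\<close>; then only the summand with \<open>i = deg u\<close> survives.\<close>

lemma part_mult_single:
  assumes u: "u \<in> S" and q: "Poly_Mapping.keys q \<subseteq> S"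
  shows "part n (Poly_Mapping.single u c * q) = (\<Oplus>i\<in>{..n}. part i (Poly_Mapping.single u c) \<otimes> part (n - i) q)"
  using q
proof (induction rule: poly_mapping_induct_on)
  case zero
  have "(\<Oplus>i\<in>{..n}. part i (Poly_Mapping.single u c) \<otimes> \<zero>) = (\<Oplus>i\<in>{..n}. \<zero>)"
    using u by (intro finsum_cong') (auto simp: part_single)
  then show ?case by simp
next
  case (single_add v d q)
  let ?p = "Poly_Mapping.single u c"
  have pc: "part i ?p \<in> carrier R" for i using u by (auto simp: part_single)
  have vc: "part i (Poly_Mapping.single v d) \<in> carrier R" for i using single_add(1) by (auto simp: part_single)
  have qc: "part i q \<in> carrier R" for i using single_add(2) part_carr by blast
  have "(\<Oplus>i\<in>{..n}. part i ?p \<otimes> part (n - i) (Poly_Mapping.single v d + q))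
    = (\<Oplus>i\<in>{..n}. part i ?p \<otimes> part (n - i) (Poly_Mapping.single v d) \<oplus> part i ?p \<otimes> part (n - i) q)"
    using single_add(1,2) pc vc qc
    by (intro finsum_cong') (auto simp: part_add r_distr)
  also have "\<dots> = (\<Oplus>i\<in>{..n}. part i ?p \<otimes> part (n - i) (Poly_Mapping.single v d)) \<oplus> (\<Oplus>i\<in>{..n}. part i ?p \<otimes> part (n - i) q)"
    using pc vc qc by (intro finsum_addf) auto
  also have "(\<Oplus>i\<in>{..n}. part i ?p \<otimes> part (n - i) (Poly_Mapping.single v d)) = part n (?p * Poly_Mapping.single v d)"
  proof (cases "deg u + deg v = n")
    case True
    have "(\<Oplus>i\<in>{..n}. part i ?p \<otimes> part (n - i) (Poly_Mapping.single v d))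
      = (\<Oplus>i\<in>{..n}. if deg u = i then (c * d) \<odot> \<chi> (u + v) else \<zero>)"
      using u single_add(1) True
      by (intro finsum_cong') (auto simp: part_single smult_mult smult_mult_right smult_assoc \<chi>_add S_add)
    also have "\<dots> = (c * d) \<odot> \<chi> (u + v)"
      using add.finprod_singleton[of "deg u" "{..n}" "\<lambda>_. (c * d) \<odot> \<chi> (u + v)"] True u single_add(1) S_add by auto
    finally show ?thesis using True u single_add(1) by (simp add: mult_single part_single S_add deg_add)
  next
    case False
    have "(\<Oplus>i\<in>{..n}. part i ?p \<otimes> part (n - i) (Poly_Mapping.single v d)) = (\<Oplus>i\<in>{..n}. \<zero>)"
      using u single_add(1) False
      by (intro finsum_cong') (auto simp: part_single)
    then show ?thesis using False u single_add(1) by (simp add: mult_single part_single S_add deg_add)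
  qed
  also have "part n (?p * Poly_Mapping.single v d) \<oplus> (\<Oplus>i\<in>{..n}. part i ?p \<otimes> part (n - i) q)
    = part n (?p * (Poly_Mapping.single v d + q))"
    using single_add u by (simp add: distrib_left part_add keys_mult_S)
  finally show ?case by simp
qed

lemma part_mult:
  assumes p: "Poly_Mapping.keys p \<subseteq> S" and q: "Poly_Mapping.keys q \<subseteq> S"
  shows "part n (p * q) = (\<Oplus>i\<in>{..n}. part i p \<otimes> part (n - i) q)"
  using p
proof (induction rule: poly_mapping_induct_on)
  case zero
  have "(\<Oplus>i\<in>{..n}. \<zero> \<otimes> part (n - i) q) = (\<Oplus>i\<in>{..n}. \<zero>)"
    using q by (intro finsum_cong') (auto simp: part_carr)
  then show ?case by simp
next
  case (single_add v d p)
  have pc: "part i p \<in> carrier R" "part i q \<in> carrier R" for i using single_add q part_carr by auto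
  have vc: "part i (Poly_Mapping.single v d) \<in> carrier R" for i using single_add(1) by (auto simp: part_single)
  have "(\<Oplus>i\<in>{..n}. part i (Poly_Mapping.single v d + p) \<otimes> part (n - i) q)
    = (\<Oplus>i\<in>{..n}. part i (Poly_Mapping.single v d) \<otimes> part (n - i) q \<oplus> part i p \<otimes> part (n - i) q)"
    using single_add(1,2) pc vc
    by (intro finsum_cong') (auto simp: part_add l_distr)
  also have "\<dots> = (\<Oplus>i\<in>{..n}. part i (Poly_Mapping.single v d) \<otimes> part (n - i) q) \<oplus> (\<Oplus>i\<in>{..n}. part i p \<otimes> part (n - i) q)"
    using pc vc by (intro finsum_addf) auto
  also have "\<dots> = part n ((Poly_Mapping.single v d + p) * q)"
    using single_add q
    by (simp add: distrib_right part_add keys_mult_S part_mult_single)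
  finally show ?case by simp
qed

definition gr_map :: "(('b \<Rightarrow>\<^sub>0 int) \<Rightarrow>\<^sub>0 'k) \<Rightarrow> nat \<Rightarrow> 'a set" where
  "gr_map p = (\<lambda>k. cls k (part k p))"

lemma gr_map_carrier:
  assumes p: "Poly_Mapping.keys p \<subseteq> S" shows "gr_map p \<in> carrier (gr R I)"
proof -
  have "part k p = \<zero>" if "k \<notin> deg ` Poly_Mapping.keys p" for k
  proof -
    have "{u \<in> Poly_Mapping.keys p. deg u = k} = {}" using that by auto
    then show ?thesis unfolding part_def by (simp only: finsum_empty)
  qed
  then have "{k. cls k (part k p) \<noteq> pw (Suc k)} \<subseteq> deg ` Poly_Mapping.keys p"
    using cls_zero by force
  then have "finite {k. cls k (part k p) \<noteq> pw (Suc k)}"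
    by (rule finite_subset) (intro finite_imageI finite_keys)
  then show ?thesis using part_pw[OF p] unfolding gr_def gr_map_def by simp
qed

text \<open>A nonzero coefficient of \<open>p - q\<close> would give, in its own degree, a linear
  dependence modulo the next power of \<open>I\<close>.\<close>

lemma gr_map_inj:
  assumes p: "Poly_Mapping.keys p \<subseteq> S" and q: "Poly_Mapping.keys q \<subseteq> S" and eq: "gr_map p = gr_map q"
  shows "p = q"
proof (rule poly_mapping_eqI)
  fix u
  let ?r = "p - q"
  have r: "Poly_Mapping.keys ?r \<subseteq> S"
    using p q keys_diff[of p q] by auto
  show "Poly_Mapping.lookup p u = Poly_Mapping.lookup q u"
  proof (rule ccontr)
    assume "\<not> ?thesis"
    then have u: "u \<in> Poly_Mapping.keys ?r" by (simp add: in_keys_iff lookup_minus)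
    let ?k = "deg u"
    have "cls ?k (part ?k p) = cls ?k (part ?k q)" using fun_cong[OF eq, of ?k] by (simp only: gr_map_def)
    then have "part ?k p \<ominus> part ?k q \<in> pw (Suc ?k)"
      using cls_eq_iff[OF part_carr[OF p] part_carr[OF q]] by simp
    moreover have "part ?k p = part ?k ?r \<oplus> part ?k q" using part_add[OF r q, of ?k] by simp
    moreover have "part ?k ?r \<oplus> part ?k q \<ominus> part ?k q = part ?k ?r"
      using part_carr[OF r, of ?k] part_carr[OF q, of ?k] by algebra
    ultimately have "part ?k ?r \<in> pw (Suc ?k)" by simp
    then have "(\<Oplus>v\<in>{v \<in> Poly_Mapping.keys ?r. deg v = ?k}. Poly_Mapping.lookup ?r v \<odot> \<chi> v) \<in> pw (Suc ?k)"
      by (simp only: part_def)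
    from pw_indep[OF _ _ this, of u] have "Poly_Mapping.lookup ?r u = 0"
      using u r by auto
    then show False using u by (simp add: in_keys_iff)
  qed
qed

lemma ex_part:
  assumes "a \<in> pw k"
  shows "\<exists>p. Poly_Mapping.keys p \<subseteq> {u \<in> S. deg u = k} \<and> cls k (part k p) = cls k a"
proof -
  obtain T c where T: "finite T" "T \<subseteq> {u \<in> S. deg u = k}" "a \<ominus> (\<Oplus>u\<in>T. c u \<odot> \<chi> u) \<in> pw (Suc k)"
    using pw_span[OF assms] by blast
  define p where "p = (\<Sum>u\<in>T. Poly_Mapping.single u (c u))"
  have lp: "Poly_Mapping.lookup p u = (if u \<in> T then c u else 0)" for u
    using T(1) by (simp add: p_def lookup_sum lookup_single when_def)
  have kp: "Poly_Mapping.keys p \<subseteq> T" by (auto simp: in_keys_iff lp split: if_splits)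
  have "part k p = (\<Oplus>u\<in>T. Poly_Mapping.lookup p u \<odot> \<chi> u)"
    using T kp by (intro part_eq) auto
  also have "\<dots> = (\<Oplus>u\<in>T. c u \<odot> \<chi> u)"
    using T by (intro finsum_cong') (auto simp: lp)
  finally have "a \<ominus> part k p \<in> pw (Suc k)" using T(3) by (simp only:)
  moreover have "part k p \<in> carrier R" using part_carr[of p k] kp T by blast
  ultimately have "cls k a = cls k (part k p)" using cls_eq_iff[OF pw_carr[OF assms]] by simp
  note eq = this[symmetric]
  have "Poly_Mapping.keys p \<subseteq> {u \<in> S. deg u = k}" using kp T(2) by (rule subset_trans)
  then show ?thesis by (intro exI conjI) (assumption, rule eq)
qed

lemma part_other:
  assumes "Poly_Mapping.keys p \<subseteq> {u \<in> S. deg u = k}" "l \<noteq> k" shows "part l p = \<zero>"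
proof -
  have "{u \<in> Poly_Mapping.keys p. deg u = l} = {}" using assms by auto
  then show ?thesis unfolding part_def by (simp only: finsum_empty)
qed

lemma part_sum:
  "finite A \<Longrightarrow> (\<And>j. j \<in> A \<Longrightarrow> Poly_Mapping.keys (p j) \<subseteq> S) \<Longrightarrow> part k (\<Sum>j\<in>A. p j) = (\<Oplus>j\<in>A. part k (p j))"
proof (induction rule: finite_induct)
  case (insert x F)
  have "Poly_Mapping.keys (\<Sum>j\<in>F. p j) \<subseteq> S"
    using insert keys_sum[of p F] by blast
  moreover have "Poly_Mapping.keys (p x) \<subseteq> S" using insert(4) by simp
  ultimately have "part k (p x + (\<Sum>j\<in>F. p j)) = part k (p x) \<oplus> part k (\<Sum>j\<in>F. p j)"
    by (intro part_add)
  also have "part k (\<Sum>j\<in>F. p j) = (\<Oplus>j\<in>F. part k (p j))"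
    using insert(3,4) by simp
  also have "part k (p x) \<oplus> (\<Oplus>j\<in>F. part k (p j)) = (\<Oplus>j\<in>insert x F. part k (p j))"
    using insert(1,2,4) part_carr by (intro finsum_insert[symmetric]) auto
  finally show ?case using insert(1,2) by simp
qed simp

lemma gr_map_surj:
  assumes f: "f \<in> carrier (gr R I)"
  shows "\<exists>p. Poly_Mapping.keys p \<subseteq> S \<and> gr_map p = f"
proof -
  let ?F = "{k. f k \<noteq> pw (Suc k)}"
  have fin: "finite ?F" and "\<And>k. \<exists>a \<in> pw k. f k = cls k a"
    using f by (auto simp: gr_def)
  then obtain a where a: "\<And>k. a k \<in> pw k" "\<And>k. f k = cls k (a k)" by metis
  have "\<forall>k. \<exists>q. Poly_Mapping.keys q \<subseteq> {u \<in> S. deg u = k} \<and> cls k (part k q) = cls k (a k)"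
    using ex_part[OF a(1)] by (rule allI)
  from choice[OF this] obtain q where "\<forall>k. Poly_Mapping.keys (q k) \<subseteq> {u \<in> S. deg u = k} \<and> cls k (part k (q k)) = cls k (a k)" ..
  then have q: "\<And>k. Poly_Mapping.keys (q k) \<subseteq> {u \<in> S. deg u = k}" "\<And>k. cls k (part k (q k)) = cls k (a k)"
    by (simp_all only: simp_thms)
  define p where "p = (\<Sum>k\<in>?F. q k)"
  have qS: "Poly_Mapping.keys (q k) \<subseteq> S" for k using q(1) by blast
  have kp: "Poly_Mapping.keys p \<subseteq> S" using qS keys_sum[of q ?F] unfolding p_def by blast
  have "cls k (part k p) = f k" for k
  proof -
    have "part k p = (\<Oplus>j\<in>?F. part k (q j))" unfolding p_def using fin qS by (intro part_sum) auto
    also have "\<dots> = (\<Oplus>j\<in>?F. if k = j then part k (q j) else \<zero>)"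
    proof (rule finsum_cong')
      fix j assume "j \<in> ?F"
      show "part k (q j) = (if k = j then part k (q j) else \<zero>)"
        using part_other[OF q(1), of k j] by simp
    qed (use part_carr[OF qS] in auto)
    also have "\<dots> = (if k \<in> ?F then part k (q k) else \<zero>)"
    proof (cases "k \<in> ?F")
      case True
      then show ?thesis
        using add.finprod_singleton[of k ?F "\<lambda>j. part k (q j)"] fin qS part_carr by auto
    next
      case False
      then have "(\<Oplus>j\<in>?F. if k = j then part k (q j) else \<zero>) = (\<Oplus>j\<in>?F. \<zero>)"
        by (intro finsum_cong') auto
      then show ?thesis using False by simp
    qed
    finally show ?thesis using q(2)[of k] a(2)[of k] cls_zero[of k] by auto
  qed
  then show ?thesis using kp unfolding gr_map_def by blast
qed

abbreviation "A \<equiv> (semigroup_algebra S :: ('k, ('b \<Rightarrow>\<^sub>0 int) \<Rightarrow>\<^sub>0 'k) module)"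

lemma cring_A: "cring A" by (rule cring_semigroup_algebra) (auto intro: S_add)

lemma part_one: "part k 1 = (if k = 0 then \<one> else \<zero>)"
  using part_single[of 0 k 1] by (simp add: \<chi>_0)

lemma gr_map_iso: "gr_map \<in> ring_iso A (gr R I)"
proof (rule ring_iso_memI)
  fix p q assume "p \<in> carrier A" "q \<in> carrier A"
  then have k: "Poly_Mapping.keys p \<subseteq> S" "Poly_Mapping.keys q \<subseteq> S" by (auto simp: semigroup_algebra_def)
  then show "gr_map p \<in> carrier (gr R I)" using gr_map_carrier by blast
  have "gr_map (p * q) = gr_map p \<otimes>\<^bsub>gr R I\<^esub> gr_map q"
    unfolding gr_map_def using k gr_mult_cls[of "\<lambda>i. part i p" "\<lambda>i. part i q"] by (simp add: part_pw part_mult)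
  then show "gr_map (p \<otimes>\<^bsub>A\<^esub> q) = gr_map p \<otimes>\<^bsub>gr R I\<^esub> gr_map q" by (simp add: semigroup_algebra_def)
  have "gr_map (p + q) = gr_map p \<oplus>\<^bsub>gr R I\<^esub> gr_map q"
    unfolding gr_map_def gr_def using k by (simp add: part_add cls_add part_carr)
  then show "gr_map (p \<oplus>\<^bsub>A\<^esub> q) = gr_map p \<oplus>\<^bsub>gr R I\<^esub> gr_map q" by (simp add: semigroup_algebra_def)
next
  show "gr_map \<one>\<^bsub>A\<^esub> = \<one>\<^bsub>gr R I\<^esub>"
    unfolding gr_map_def using cls_zero by (intro ext) (simp add: semigroup_algebra_def part_one gr_def)
next
  show "bij_betw gr_map (carrier A) (carrier (gr R I))"
    unfolding bij_betw_def inj_on_def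
    using gr_map_carrier gr_map_surj gr_map_inj by (auto simp: semigroup_algebra_def image_iff)
qed

lemma gr_map_smult:
  assumes k: "Poly_Mapping.keys p \<subseteq> S" shows "gr_map (Poly_Mapping.single 0 c * p) = c \<odot>\<^bsub>gr R I\<^esub> gr_map p"
proof -
  have "part k (Poly_Mapping.single 0 c * p) = c \<odot> part k p" for k
  proof -
    have "part k (Poly_Mapping.single 0 c * p) = (\<Oplus>i\<in>{..k}. part i (Poly_Mapping.single 0 c) \<otimes> part (k - i) p)"
      using k by (intro part_mult_single) auto
    also have "\<dots> = (\<Oplus>i\<in>{..k}. if 0 = i then c \<odot> part k p else \<zero>)"
      using part_carr[OF k] by (intro finsum_cong') (auto simp: part_single \<chi>_0 smult_mult)
    also have "\<dots> = c \<odot> part k p"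
      using add.finprod_singleton[of 0 "{..k}" "\<lambda>j. c \<odot> part k p"] part_carr[OF k] by auto
    finally show ?thesis .
  qed
  then show ?thesis unfolding gr_map_def using k gr_smult_cls[of "\<lambda>i. part i p" c] by (simp add: part_pw)
qed

lemma gr_iso_semigroup_algebra: "alg_isomorphic A (gr R I)"
  unfolding alg_isomorphic_def using gr_map_iso gr_map_smult
  by (intro bexI[OF _ gr_map_iso]) (auto simp: semigroup_algebra_def)

text \<open>The ring axioms are transported along \<open>gr_map\<close> instead of being verified on
  cosets.\<close>

lemma cring_gr: "cring (gr R I)"
proof -
  \<comment> \<open>Transport yields the structure whose zero is the image of the zero; the next
    fact identifies it with the zero of \<open>gr\<close>.\<close>
  have "cring ((gr R I) \<lparr> zero := gr_map \<zero>\<^bsub>A\<^esub> \<rparr>)"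
    using cring.ring_iso_imp_img_cring[OF cring_A gr_map_iso] by simp
  moreover have "gr_map \<zero>\<^bsub>A\<^esub> = \<zero>\<^bsub>gr R I\<^esub>"
    unfolding gr_map_def using cls_zero by (simp add: semigroup_algebra_def gr_def)
  ultimately show ?thesis by simp
qed

lemma gr_piece_eq: "gr_piece R I k = gr_map ` {p. Poly_Mapping.keys p \<subseteq> {u \<in> S. deg u = k}}"
proof
  show "gr_map ` {p. Poly_Mapping.keys p \<subseteq> {u \<in> S. deg u = k}} \<subseteq> gr_piece R I k"
  proof
    fix f assume "f \<in> gr_map ` {p. Poly_Mapping.keys p \<subseteq> {u \<in> S. deg u = k}}"
    then obtain p where p: "Poly_Mapping.keys p \<subseteq> {u \<in> S. deg u = k}" "f = gr_map p" by blast
    then have "f \<in> carrier (gr R I)" using gr_map_carrier[of p] by blast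
    moreover have "f n = \<zero>\<^bsub>gr R I\<^esub> n" if "n \<noteq> k" for n
      using part_other[OF p(1) that] cls_zero[of n] p(2) by (simp add: gr_map_def gr_def)
    ultimately show "f \<in> gr_piece R I k" unfolding gr_piece_def by blast
  qed
  show "gr_piece R I k \<subseteq> gr_map ` {p. Poly_Mapping.keys p \<subseteq> {u \<in> S. deg u = k}}"
  proof
    fix f assume f: "f \<in> gr_piece R I k"
    then obtain p where p: "Poly_Mapping.keys p \<subseteq> S" "gr_map p = f"
      using gr_map_surj unfolding gr_piece_def by blast
    have "deg u = k" if u: "u \<in> Poly_Mapping.keys p" for u
    proof (rule ccontr)
      assume "deg u \<noteq> k"
      then have "cls (deg u) (part (deg u) p) = pw (Suc (deg u))"
        using f p(2) unfolding gr_piece_def gr_map_def by (auto simp: gr_def)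
      then have "part (deg u) p \<in> pw (Suc (deg u))"
        using self_in_cls part_carr[OF p(1)] by blast
      then have "(\<Oplus>v\<in>{v \<in> Poly_Mapping.keys p. deg v = deg u}. Poly_Mapping.lookup p v \<odot> \<chi> v) \<in> pw (Suc (deg u))"
        by (simp only: part_def)
      from pw_indep[OF _ _ this, of u] have "Poly_Mapping.lookup p u = 0"
        using u p(1) by auto
      then show False using u by (simp add: in_keys_iff)
    qed
    then show "f \<in> gr_map ` {p. Poly_Mapping.keys p \<subseteq> {u \<in> S. deg u = k}}" using p by blast
  qed
qed

text \<open>Dimensions are taken over a subfield contained in the ring, so the constants must be
  exhibited as one.\<close>

lemma constants_subfield: "subfield (range (Poly_Mapping.single 0)) A"
proof -
  interpret AA: cring A by (rule cring_A)
  have one: "\<one>\<^bsub>A\<^esub> = Poly_Mapping.single 0 1" "\<zero>\<^bsub>A\<^esub> = Poly_Mapping.single 0 0"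
    by (auto simp: semigroup_algebra_def)
  have sub: "subcring (range (Poly_Mapping.single 0)) A"
  proof (rule AA.subcringI')
    show "subring (range (Poly_Mapping.single 0)) A"
    proof (rule AA.subringI)
      fix h assume "h \<in> range (Poly_Mapping.single 0 :: 'k \<Rightarrow> ('b \<Rightarrow>\<^sub>0 int) \<Rightarrow>\<^sub>0 'k)"
      then obtain c where h: "h = Poly_Mapping.single 0 c" by blast
      have "\<ominus>\<^bsub>A\<^esub> h = Poly_Mapping.single 0 (- c)"
        by (rule AA.minus_equality) (auto simp: h semigroup_algebra_def simp flip: single_add)
      then show "\<ominus>\<^bsub>A\<^esub> h \<in> range (Poly_Mapping.single 0)" by blast
    next
      fix h1 h2 :: "('b \<Rightarrow>\<^sub>0 int) \<Rightarrow>\<^sub>0 'k" assume "h1 \<in> range (Poly_Mapping.single 0)" "h2 \<in> range (Poly_Mapping.single 0)"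
      then obtain c1 c2 where h: "h1 = Poly_Mapping.single 0 c1" "h2 = Poly_Mapping.single 0 c2" by blast
      have "h1 * h2 = Poly_Mapping.single 0 (c1 * c2)" by (simp add: h mult_single)
      then show "h1 \<otimes>\<^bsub>A\<^esub> h2 \<in> range (Poly_Mapping.single 0)" by (auto simp: semigroup_algebra_def)
      have "h1 + h2 = Poly_Mapping.single 0 (c1 + c2)" by (simp add: h single_add)
      then show "h1 \<oplus>\<^bsub>A\<^esub> h2 \<in> range (Poly_Mapping.single 0)" by (auto simp: semigroup_algebra_def)
    qed (use one in \<open>auto simp: semigroup_algebra_def simp del: single_one split: if_splits\<close>)
  qed
  show ?thesis
  proof (rule AA.subfieldI[OF sub])
    show "Units (A\<lparr>carrier := range (Poly_Mapping.single 0)\<rparr>) = range (Poly_Mapping.single 0) - {\<zero>\<^bsub>A\<^esub>}"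
    proof (intro equalityI subsetI)
      fix x assume "x \<in> Units (A\<lparr>carrier := range (Poly_Mapping.single 0)\<rparr>)"
      then show "x \<in> range (Poly_Mapping.single 0) - {\<zero>\<^bsub>A\<^esub>}"
        by (auto simp: Units_def semigroup_algebra_def)
    next
      fix x :: "('b \<Rightarrow>\<^sub>0 int) \<Rightarrow>\<^sub>0 'k" assume "x \<in> range (Poly_Mapping.single 0) - {\<zero>\<^bsub>A\<^esub>}"
      then obtain c where x: "x = Poly_Mapping.single 0 c" "x \<noteq> 0"
        unfolding semigroup_algebra_def by auto
      then have c: "x = Poly_Mapping.single 0 c" "c \<noteq> 0"
        by (simp, metis single_zero)
      have "Poly_Mapping.single 0 (inverse c) * x = 1" "x * Poly_Mapping.single 0 (inverse c) = 1"
        using c by (auto simp: mult_single)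
      then show "x \<in> Units (A\<lparr>carrier := range (Poly_Mapping.single 0)\<rparr>)"
        unfolding Units_def using c by (auto simp: semigroup_algebra_def intro!: bexI[of _ "Poly_Mapping.single 0 (inverse c)"])
    qed
  qed
qed

text \<open>Dimension is generated by line extensions: each new monomial lies outside the span of
  the previous ones and raises it by one.\<close>

lemma dimension_monomials:
  assumes "finite B" "B \<subseteq> S"
  shows "ring.dimension A (card B) (range (Poly_Mapping.single 0)) {p. Poly_Mapping.keys p \<subseteq> B}"
  using assms
proof (induction rule: finite_induct)
  case empty
  interpret AA: cring A by (rule cring_A)
  show ?case using AA.zero_dim by (simp add: semigroup_algebra_def)
next
  case (insert b B)
  interpret AA: cring A by (rule cring_A)
  let ?K = "range (Poly_Mapping.single 0)"
  have "AA.dimension (Suc (card B)) ?K (AA.line_extension ?K (Poly_Mapping.single b 1) {p. Poly_Mapping.keys p \<subseteq> B})"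
    using insert by (intro AA.Suc_dim) (auto simp: semigroup_algebra_def)
  also have "AA.line_extension ?K (Poly_Mapping.single b 1) {p. Poly_Mapping.keys p \<subseteq> B}
    = {p. Poly_Mapping.keys p \<subseteq> insert b B}" (is "?L = ?R")
  proof (intro equalityI subsetI)
    fix p assume "p \<in> ?L"
    then obtain c q where "p = Poly_Mapping.single 0 c * Poly_Mapping.single b 1 + q" "Poly_Mapping.keys q \<subseteq> B"
      unfolding AA.line_extension_mem_iff by (auto simp: semigroup_algebra_def)
    then show "p \<in> ?R" using keys_add[of "Poly_Mapping.single b c" q] by (auto simp: mult_single split: if_splits)
  next
    fix p assume p: "p \<in> ?R"
    define q where "q = p - Poly_Mapping.single b (Poly_Mapping.lookup p b)"
    have "Poly_Mapping.keys q \<subseteq> B" using p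
      by (auto simp: q_def in_keys_iff lookup_minus lookup_single when_def split: if_splits)
    moreover have "p = Poly_Mapping.single 0 (Poly_Mapping.lookup p b) * Poly_Mapping.single b 1 + q"
      by (simp add: q_def mult_single)
    ultimately show "p \<in> ?L" unfolding AA.line_extension_mem_iff
      by (auto simp: semigroup_algebra_def)
  qed
  finally show ?case using insert by simp
qed

text \<open>The dimension is computed in the semigroup algebra, where it is a count, and carried
  along the injective \<open>gr_map\<close>, which sends the constants onto the piece of degree
  0.\<close>

lemma hilbert_function_eq:
  assumes fin: "finite {u \<in> S. deg u = k}"
  shows "hilbert_function R I k = card {u \<in> S. deg u = k}"
proof -
  interpret AA: cring A by (rule cring_A)
  interpret G: cring "gr R I" by (rule cring_gr)
  interpret h: ring_hom_ring A "gr R I" gr_map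
    using gr_map_iso unfolding ring_iso_def by (intro ring_hom_ringI2) (auto simp: AA.ring_axioms G.ring_axioms)
  let ?K = "range (Poly_Mapping.single 0)"
  have "gr_map \<one>\<^bsub>A\<^esub> \<noteq> gr_map \<zero>\<^bsub>A\<^esub>"
  proof
    assume "gr_map \<one>\<^bsub>A\<^esub> = gr_map \<zero>\<^bsub>A\<^esub>"
    then have "(1 :: ('b \<Rightarrow>\<^sub>0 int) \<Rightarrow>\<^sub>0 'k) = 0"
      by (intro gr_map_inj) (auto simp: semigroup_algebra_def)
    then show False by simp
  qed
  then have ne: "\<one>\<^bsub>gr R I\<^esub> \<noteq> \<zero>\<^bsub>gr R I\<^esub>" by simp
  have K: "gr_piece R I 0 = gr_map ` ?K"
  proof -
    have "{u \<in> S. deg u = 0} = {0}" using deg_eq_0D by auto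
    moreover have "{p. Poly_Mapping.keys p \<subseteq> {0}} = (?K :: (('b \<Rightarrow>\<^sub>0 int) \<Rightarrow>\<^sub>0 'k) set)"
    proof (intro equalityI subsetI)
      fix p :: "('b \<Rightarrow>\<^sub>0 int) \<Rightarrow>\<^sub>0 'k" assume "p \<in> {p. Poly_Mapping.keys p \<subseteq> {0}}"
      then have "p = Poly_Mapping.single 0 (Poly_Mapping.lookup p 0)"
        by (intro poly_mapping_eqI) (auto simp: lookup_single when_def in_keys_iff)
      then show "p \<in> ?K" by blast
    qed (auto split: if_splits)
    ultimately show ?thesis unfolding gr_piece_eq by simp
  qed
  have "G.dimension (card {u \<in> S. deg u = k}) (gr_map ` ?K) (gr_map ` {p. Poly_Mapping.keys p \<subseteq> {u \<in> S. deg u = k}})"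
  proof (rule h.inj_hom_dimension[OF constants_subfield ne])
    show "inj_on gr_map {p. Poly_Mapping.keys p \<subseteq> {u \<in> S. deg u = k}}"
      by (rule inj_onI) (auto intro!: gr_map_inj)
    show "AA.dimension (card {u \<in> S. deg u = k}) ?K {p. Poly_Mapping.keys p \<subseteq> {u \<in> S. deg u = k}}"
      using fin by (intro dimension_monomials) auto
  qed
  moreover have "subfield (gr_map ` ?K) (gr R I)"
    using h.img_is_subfield(2)[OF constants_subfield ne] .
  ultimately show ?thesis
    unfolding hilbert_function_def K gr_piece_eq[of k] using G.dimI by (simp add: over_def)
qed

end

section \<open>Polynomial functions and germs\<close>

lemma polyfun_uminus: "f \<in> polyfun \<Longrightarrow> (\<lambda>x. - f x) \<in> polyfun"
  using polyfun.mult[OF polyfun.const[of "-1"], of f] by simp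

lemma polyfun_diff: "f \<in> polyfun \<Longrightarrow> g \<in> polyfun \<Longrightarrow> (\<lambda>x. f x - g x) \<in> polyfun"
  using polyfun.add[of f "\<lambda>x. - g x"] polyfun_uminus[of g] by simp

lemma polyfun_power: "f \<in> polyfun \<Longrightarrow> (\<lambda>x. f x ^ k) \<in> polyfun"
  by (induction k) (auto intro: polyfun.intros)

lemma polyfun_sum: "(\<And>i. i \<in> A \<Longrightarrow> f i \<in> polyfun) \<Longrightarrow> (\<lambda>x. \<Sum>i\<in>A. f i x) \<in> polyfun"
  by (induction A rule: infinite_finite_induct) (auto intro: polyfun.intros)

lemma polyfun_prod: "(\<And>i. i \<in> A \<Longrightarrow> f i \<in> polyfun) \<Longrightarrow> (\<lambda>x. \<Prod>i\<in>A. f i x) \<in> polyfun"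
  by (induction A rule: infinite_finite_induct) (auto intro: polyfun.intros)

lemma polyfun_compose:
  assumes "f \<in> polyfun" "\<And>v. (\<lambda>x. g x v) \<in> polyfun"
  shows "(\<lambda>x. f (g x)) \<in> polyfun"
  using assms(1)
proof induction
  case (coord v)
  then show ?case by (rule assms(2))
qed (simp_all add: polyfun.intros)

text \<open>On a line a polynomial function is a polynomial in one variable. Vanishing orders and
  the absence of zero divisors are both reduced to this.\<close>

lemma polyfun_line:
  assumes "f \<in> polyfun" shows "\<exists>p. \<forall>t. f (\<lambda>v. a v + t * b v) = poly p t"
  using assms
proof induction
  case (const c)
  then show ?case by (intro exI[of _ "[:c:]"]) simp
next
  case (coord v)
  then show ?case by (intro exI[of _ "[:a v, b v:]"]) (simp add: algebra_simps)
next
  case (add f g)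
  then obtain p q where "\<forall>t. f (\<lambda>v. a v + t * b v) = poly p t" "\<forall>t. g (\<lambda>v. a v + t * b v) = poly q t" by blast
  then show ?case by (intro exI[of _ "p + q"]) simp
next
  case (mult f g)
  then obtain p q where "\<forall>t. f (\<lambda>v. a v + t * b v) = poly p t" "\<forall>t. g (\<lambda>v. a v + t * b v) = poly q t" by blast
  then show ?case by (intro exI[of _ "p * q"]) simp
qed

text \<open>The neighbourhood filter of \<open>P\<close> in \<open>X\<close>, generated by principal
  open sets. Shrinking a neighbourhood finitely often becomes conjunction under
  \<open>eventually\<close>.\<close>

definition znhds :: "('v \<Rightarrow> 'k::field) set \<Rightarrow> ('v \<Rightarrow> 'k) \<Rightarrow> ('v \<Rightarrow> 'k) filter" where
  "znhds X P = Abs_filter (\<lambda>Q. \<exists>u\<in>polyfun. u P \<noteq> 0 \<and> (\<forall>x\<in>X. u x \<noteq> 0 \<longrightarrow> Q x))"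

lemma eventually_znhds:
  "eventually Q (znhds X P) \<longleftrightarrow> (\<exists>u\<in>polyfun. u P \<noteq> 0 \<and> (\<forall>x\<in>X. u x \<noteq> 0 \<longrightarrow> Q x))"
  unfolding znhds_def
proof (rule eventually_Abs_filter, rule is_filter.intro)
  show "\<exists>u\<in>polyfun. u P \<noteq> 0 \<and> (\<forall>x\<in>X. u x \<noteq> 0 \<longrightarrow> True)"
    by (intro bexI[of _ "\<lambda>_. 1"]) (auto intro: polyfun.intros)
next
  fix Q Q' :: "('a \<Rightarrow> 'b) \<Rightarrow> bool"
  assume "\<exists>u\<in>polyfun. u P \<noteq> 0 \<and> (\<forall>x\<in>X. u x \<noteq> 0 \<longrightarrow> Q x)" "\<exists>u\<in>polyfun. u P \<noteq> 0 \<and> (\<forall>x\<in>X. u x \<noteq> 0 \<longrightarrow> Q' x)"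
  then obtain u u' where "u \<in> polyfun" "u P \<noteq> 0" "\<forall>x\<in>X. u x \<noteq> 0 \<longrightarrow> Q x"
     "u' \<in> polyfun" "u' P \<noteq> 0" "\<forall>x\<in>X. u' x \<noteq> 0 \<longrightarrow> Q' x" by blast
  then show "\<exists>u\<in>polyfun. u P \<noteq> 0 \<and> (\<forall>x\<in>X. u x \<noteq> 0 \<longrightarrow> Q x \<and> Q' x)"
    by (intro bexI[of _ "\<lambda>x. u x * u' x"]) (auto intro: polyfun.intros)
qed blast

lemma openin_zariski_nonzero:
  assumes "u \<in> polyfun" shows "openin (subtopology zariski X) {x \<in> X. u x \<noteq> 0}"
proof -
  have "zariski_open {x. u x \<noteq> 0}"
    unfolding zariski_open_def using assms by (intro exI[of _ "{u}"]) auto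
  then show ?thesis unfolding openin_subtopology openin_zariski by blast
qed

lemma ex_open_iff_eventually:
  assumes "P \<in> X"
  shows "(\<exists>U. openin (subtopology zariski X) U \<and> P \<in> U \<and> (\<forall>x\<in>U. Q x)) \<longleftrightarrow> eventually Q (znhds X P)"
proof
  assume "\<exists>U. openin (subtopology zariski X) U \<and> P \<in> U \<and> (\<forall>x\<in>U. Q x)"
  then obtain U where U: "openin (subtopology zariski X) U" "P \<in> U" "\<forall>x\<in>U. Q x" by blast
  then obtain T where T: "zariski_open T" "U = T \<inter> X" unfolding openin_subtopology openin_zariski by blast
  then obtain A where A: "A \<subseteq> polyfun" "T = {x. \<exists>f\<in>A. f x \<noteq> 0}" unfolding zariski_open_def by blast
  with T U obtain u where "u \<in> A" "u P \<noteq> 0" by blast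
  then show "eventually Q (znhds X P)"
    unfolding eventually_znhds using A T U by (intro bexI[of _ u]) auto
next
  assume "eventually Q (znhds X P)"
  then obtain u where "u \<in> polyfun" "u P \<noteq> 0" "\<forall>x\<in>X. u x \<noteq> 0 \<longrightarrow> Q x" unfolding eventually_znhds by blast
  then show "\<exists>U. openin (subtopology zariski X) U \<and> P \<in> U \<and> (\<forall>x\<in>U. Q x)"
    using assms openin_zariski_nonzero[of u X] by (intro exI[of _ "{x \<in> X. u x \<noteq> 0}"]) auto
qed

lemma regular_at_memD: "regular_at X P f \<Longrightarrow> P \<in> X"
  unfolding regular_at_def using openin_subset by (fastforce simp: topspace_subtopology)

lemma regular_at_iff:
  "regular_at X P f \<longleftrightarrow> P \<in> X \<and> (\<exists>g\<in>polyfun. \<exists>h\<in>polyfun. h P \<noteq> 0 \<and> eventually (\<lambda>x. f x = g x / h x) (znhds X P))"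
proof (cases "P \<in> X")
  case True
  have "regular_at X P f \<longleftrightarrow> (\<exists>g\<in>polyfun. \<exists>h\<in>polyfun. \<exists>U. openin (subtopology zariski X) U \<and> P \<in> U \<and>
      (\<forall>x\<in>U. h x \<noteq> 0 \<and> f x = g x / h x))"
    unfolding regular_at_def by blast
  also have "\<dots> \<longleftrightarrow> (\<exists>g\<in>polyfun. \<exists>h\<in>polyfun. eventually (\<lambda>x. h x \<noteq> 0 \<and> f x = g x / h x) (znhds X P))"
    by (simp only: ex_open_iff_eventually[OF True])
  also have "\<dots> \<longleftrightarrow> (\<exists>g\<in>polyfun. \<exists>h\<in>polyfun. h P \<noteq> 0 \<and> eventually (\<lambda>x. f x = g x / h x) (znhds X P))"
  proof -
    have "eventually (\<lambda>x. h x \<noteq> 0 \<and> f x = g x / h x) (znhds X P) \<longleftrightarrow> h P \<noteq> 0 \<and> eventually (\<lambda>x. f x = g x / h x) (znhds X P)"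
      if "h \<in> polyfun" for g h
    proof -
      have "eventually (\<lambda>x. h x \<noteq> 0) (znhds X P) \<longleftrightarrow> h P \<noteq> 0"
        unfolding eventually_znhds using that True by auto
      then show ?thesis by (simp add: eventually_conj_iff)
    qed
    then show ?thesis by (intro bex_cong refl)
  qed
  finally show ?thesis using True by simp
next
  case False
  then show ?thesis using regular_at_memD by blast
qed

lemma eventually_znhds_at: "P \<in> X \<Longrightarrow> eventually Q (znhds X P) \<Longrightarrow> Q P"
  unfolding eventually_znhds by blast

lemma eventually_znhds_in: "eventually (\<lambda>x. x \<in> X) (znhds X P)"
  unfolding eventually_znhds by (intro bexI[of _ "\<lambda>_. 1"]) (auto intro: polyfun.intros)

lemma eventually_nonzero: "u \<in> polyfun \<Longrightarrow> u P \<noteq> 0 \<Longrightarrow> eventually (\<lambda>x. u x \<noteq> 0) (znhds X P)"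
  unfolding eventually_znhds by blast

lemma regular_atE:
  assumes "regular_at X P f"
  obtains g h where "g \<in> polyfun" "h \<in> polyfun" "h P \<noteq> 0" "f P = g P / h P"
    "eventually (\<lambda>x. h x \<noteq> 0 \<and> f x = g x / h x) (znhds X P)"
proof -
  from assms obtain g h where gh: "P \<in> X" "g \<in> polyfun" "h \<in> polyfun" "h P \<noteq> 0" "eventually (\<lambda>x. f x = g x / h x) (znhds X P)"
    unfolding regular_at_iff by blast
  have "eventually (\<lambda>x. h x \<noteq> 0 \<and> f x = g x / h x) (znhds X P)"
    using eventually_conj[OF eventually_nonzero[OF gh(3,4)] gh(5)] .
  moreover have "f P = g P / h P" using eventually_znhds_at[OF gh(1,5)] .
  ultimately show thesis using that gh by blast
qed

lemma regular_at_cong: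
  assumes "regular_at X P f" "eventually (\<lambda>x. f x = f' x) (znhds X P)" shows "regular_at X P f'"
proof -
  from assms(1) obtain g h where gh: "P \<in> X" "g \<in> polyfun" "h \<in> polyfun" "h P \<noteq> 0" "eventually (\<lambda>x. f x = g x / h x) (znhds X P)"
    unfolding regular_at_iff by blast
  have "eventually (\<lambda>x. f' x = g x / h x) (znhds X P)"
    using gh(5) assms(2) by eventually_elim auto
  then show ?thesis unfolding regular_at_iff using gh by blast
qed

lemma regular_at_fraction:
  "P \<in> X \<Longrightarrow> g \<in> polyfun \<Longrightarrow> h \<in> polyfun \<Longrightarrow> h P \<noteq> 0 \<Longrightarrow> regular_at X P (\<lambda>x. g x / h x)"
  unfolding regular_at_iff by (auto intro!: bexI)

lemma regular_at_polyfun: "P \<in> X \<Longrightarrow> g \<in> polyfun \<Longrightarrow> regular_at X P g"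
  using regular_at_fraction[of P X g "\<lambda>_. 1"] by (auto intro: polyfun.intros)

lemma regular_at_add:
  assumes "regular_at X P f" "regular_at X P f'" shows "regular_at X P (\<lambda>x. f x + f' x)"
proof -
  obtain g h where gh: "g \<in> polyfun" "h \<in> polyfun" "h P \<noteq> 0" "eventually (\<lambda>x. h x \<noteq> 0 \<and> f x = g x / h x) (znhds X P)"
    using regular_atE[OF assms(1)] by blast
  obtain g' h' where gh': "g' \<in> polyfun" "h' \<in> polyfun" "h' P \<noteq> 0" "eventually (\<lambda>x. h' x \<noteq> 0 \<and> f' x = g' x / h' x) (znhds X P)"
    using regular_atE[OF assms(2)] by blast
  have "eventually (\<lambda>x. f x + f' x = (g x * h' x + g' x * h x) / (h x * h' x)) (znhds X P)"
    using gh(4) gh'(4) by eventually_elim (simp add: add_frac_eq)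
  moreover have "(\<lambda>x. g x * h' x + g' x * h x) \<in> polyfun" "(\<lambda>x. h x * h' x) \<in> polyfun"
    using gh gh' by (auto intro!: polyfun.intros)
  ultimately show ?thesis unfolding regular_at_iff using gh(3) gh'(3) regular_at_memD[OF assms(1)]
    by (intro conjI bexI[of _ "\<lambda>x. g x * h' x + g' x * h x"] bexI[of _ "\<lambda>x. h x * h' x"]) auto
qed

lemma regular_at_mult:
  assumes "regular_at X P f" "regular_at X P f'" shows "regular_at X P (\<lambda>x. f x * f' x)"
proof -
  obtain g h where gh: "g \<in> polyfun" "h \<in> polyfun" "h P \<noteq> 0" "eventually (\<lambda>x. h x \<noteq> 0 \<and> f x = g x / h x) (znhds X P)"
    using regular_atE[OF assms(1)] by blast
  obtain g' h' where gh': "g' \<in> polyfun" "h' \<in> polyfun" "h' P \<noteq> 0" "eventually (\<lambda>x. h' x \<noteq> 0 \<and> f' x = g' x / h' x) (znhds X P)"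
    using regular_atE[OF assms(2)] by blast
  have "eventually (\<lambda>x. f x * f' x = (g x * g' x) / (h x * h' x)) (znhds X P)"
    using gh(4) gh'(4) by eventually_elim simp
  moreover have "(\<lambda>x. g x * g' x) \<in> polyfun" "(\<lambda>x. h x * h' x) \<in> polyfun"
    using gh gh' by (auto intro!: polyfun.intros)
  ultimately show ?thesis unfolding regular_at_iff using gh(3) gh'(3) regular_at_memD[OF assms(1)]
    by (intro conjI bexI[of _ "\<lambda>x. g x * g' x"] bexI[of _ "\<lambda>x. h x * h' x"]) auto
qed

lemma regular_at_inverse:
  assumes "regular_at X P f" "f P \<noteq> 0" shows "regular_at X P (\<lambda>x. inverse (f x))"
proof -
  obtain g h where gh: "g \<in> polyfun" "h \<in> polyfun" "h P \<noteq> 0" "f P = g P / h P" "eventually (\<lambda>x. h x \<noteq> 0 \<and> f x = g x / h x) (znhds X P)"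
    using regular_atE[OF assms(1)] by blast
  have "eventually (\<lambda>x. inverse (f x) = h x / g x) (znhds X P)"
    using gh(5) by eventually_elim simp
  moreover have "g P \<noteq> 0" using gh(4) assms(2) by auto
  ultimately show ?thesis unfolding regular_at_iff using gh regular_at_memD[OF assms(1)] by blast
qed

lemma regular_at_const: "P \<in> X \<Longrightarrow> regular_at X P (\<lambda>x. c)"
  by (intro regular_at_polyfun polyfun.intros)

lemma regular_at_uminus: "regular_at X P f \<Longrightarrow> regular_at X P (\<lambda>x. - f x)"
  using regular_at_mult[OF regular_at_const[of P X "-1"], of f] regular_at_memD[of X P f] by simp

lemma regular_at_diff: "regular_at X P f \<Longrightarrow> regular_at X P f' \<Longrightarrow> regular_at X P (\<lambda>x. f x - f' x)"
  using regular_at_add[of X P f "\<lambda>x. - f' x"] regular_at_uminus[of X P f'] by simp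

lemma regular_at_sum: "P \<in> X \<Longrightarrow> (\<And>i. i \<in> A \<Longrightarrow> regular_at X P (f i)) \<Longrightarrow> regular_at X P (\<lambda>x. \<Sum>i\<in>A. f i x)"
  by (induction A rule: infinite_finite_induct) (auto intro: regular_at_const regular_at_add)

lemma regular_at_polyfun_compose:
  assumes "f \<in> polyfun" "P \<in> X" "\<And>v. regular_at X P (\<lambda>x. g x v)"
  shows "regular_at X P (\<lambda>x. f (g x))"
  using assms(1)
proof induction
  case (coord v)
  then show ?case by (rule assms(3))
qed (simp_all add: regular_at_const[OF assms(2)] regular_at_add regular_at_mult)

lemma eventually_nonzero_regular:
  assumes "regular_at X P f" "f P \<noteq> 0" shows "eventually (\<lambda>x. f x \<noteq> 0) (znhds X P)"
proof -
  obtain g h where gh: "g \<in> polyfun" "h \<in> polyfun" "h P \<noteq> 0" "f P = g P / h P" "eventually (\<lambda>x. h x \<noteq> 0 \<and> f x = g x / h x) (znhds X P)"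
    using regular_atE[OF assms(1)] by blast
  have "g P \<noteq> 0" using gh(4) assms(2) by auto
  from eventually_nonzero[OF gh(1) this] gh(5) show ?thesis by eventually_elim simp
qed

text \<open>Composing the function \<open>u\<close> that cuts out a neighbourhood with
  \<open>g\<close> gives a regular function, which stays nonzero near \<open>P\<close>. The
  condition on \<open>W\<close> is only local, because a chart may leave its target away from the
  base point.\<close>

lemma eventually_znhds_compose:
  assumes P: "P \<in> X" and g: "\<And>v. regular_at X P (\<lambda>x. g x v)"
    and W: "eventually (\<lambda>x. g x \<in> W) (znhds X P)" and Q: "eventually Q (znhds W (g P))"
  shows "eventually (\<lambda>x. Q (g x)) (znhds X P)"
proof -
  obtain u where u: "u \<in> polyfun" "u (g P) \<noteq> 0" "\<forall>x\<in>W. u x \<noteq> 0 \<longrightarrow> Q x" using Q unfolding eventually_znhds by blast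
  have "eventually (\<lambda>x. u (g x) \<noteq> 0) (znhds X P)"
    using eventually_nonzero_regular[OF regular_at_polyfun_compose[OF u(1) P g]] u(2) by simp
  with W show ?thesis by eventually_elim (use u(3) in blast)
qed

lemma regular_at_compose:
  assumes P: "P \<in> X" and g: "\<And>v. regular_at X P (\<lambda>x. g x v)"
    and W: "eventually (\<lambda>x. g x \<in> W) (znhds X P)" and f: "regular_at W (g P) f"
  shows "regular_at X P (\<lambda>x. f (g x))"
proof -
  obtain a b where ab: "a \<in> polyfun" "b \<in> polyfun" "b (g P) \<noteq> 0" "eventually (\<lambda>x. b x \<noteq> 0 \<and> f x = a x / b x) (znhds W (g P))"
    using regular_atE[OF f] by blast
  have "regular_at X P (\<lambda>x. a (g x) * inverse (b (g x)))"
    using regular_at_mult[OF regular_at_polyfun_compose[OF ab(1) P g]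
       regular_at_inverse[OF regular_at_polyfun_compose[OF ab(2) P g] ab(3)]] .
  moreover have "eventually (\<lambda>x. a (g x) * inverse (b (g x)) = f (g x)) (znhds X P)"
    using eventually_znhds_compose[OF P g W ab(4)] by eventually_elim (simp add: divide_inverse)
  ultimately show ?thesis by (rule regular_at_cong)
qed

lemma regular_at_subset:
  assumes "regular_at X P f" "Y \<subseteq> X" "P \<in> Y" shows "regular_at Y P f"
  using assms unfolding regular_at_iff eventually_znhds by blast

section \<open>The local ring of germs at a point\<close>

locale variety_point =
  fixes X :: "('v \<Rightarrow> 'k::field) set" and P :: "'v \<Rightarrow> 'k"
  assumes P_in: "P \<in> X"
begin

abbreviation "reg f \<equiv> regular_at X P f"
abbreviation "ger f \<equiv> germ X P f"
abbreviation "\<O> \<equiv> local_ring X P"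
abbreviation "\<mm> \<equiv> local_max_ideal X P"
abbreviation "near Q \<equiv> eventually Q (znhds X P)"

lemma in_germ: "g \<in> ger f \<longleftrightarrow> near (\<lambda>x. g x = f x)"
  unfolding germ_def using ex_open_iff_eventually[OF P_in, of "\<lambda>x. g x = f x"] by simp

lemma germ_eq_iff: "ger f = ger g \<longleftrightarrow> near (\<lambda>x. f x = g x)"
proof
  assume "ger f = ger g"
  then have "f \<in> ger g" using in_germ[of f f] by simp
  then show "near (\<lambda>x. f x = g x)" by (simp add: in_germ)
next
  assume *: "near (\<lambda>x. f x = g x)"
  show "ger f = ger g"
  proof (intro equalityI subsetI)
    fix h assume "h \<in> ger f"
    then show "h \<in> ger g" unfolding in_germ using * by eventually_elim simp
  next
    fix h assume "h \<in> ger g"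
    then show "h \<in> ger f" unfolding in_germ using * by eventually_elim simp
  qed
qed

text \<open>The operations on germs are unions over representatives; a congruence for the operation
  collapses the union to one germ.\<close>

lemma germ_UN:
  assumes "\<And>f'. near (\<lambda>x. f' x = f x) \<Longrightarrow> near (\<lambda>x. F f' x = F f x)"
  shows "(\<Union>f'\<in>ger f. ger (F f')) = ger (F f)"
proof -
  have "ger (F f') = ger (F f)" if "f' \<in> ger f" for f'
    using that assms unfolding germ_eq_iff in_germ by blast
  moreover have "f \<in> ger f" by (simp add: in_germ)
  ultimately show ?thesis by blast
qed

lemma germ_UN2:
  assumes "\<And>f' g'. near (\<lambda>x. f' x = f x) \<Longrightarrow> near (\<lambda>x. g' x = g x) \<Longrightarrow> near (\<lambda>x. F f' g' x = F f g x)"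
  shows "(\<Union>f'\<in>ger f. \<Union>g'\<in>ger g. ger (F f' g')) = ger (F f g)"
proof -
  have "ger (F f' g') = ger (F f g)" if "f' \<in> ger f" "g' \<in> ger g" for f' g'
    using that assms unfolding germ_eq_iff in_germ by blast
  moreover have "f \<in> ger f" "g \<in> ger g" by (simp_all add: in_germ)
  ultimately show ?thesis by blast
qed

lemma O_mult: "ger f \<otimes>\<^bsub>\<O>\<^esub> ger g = ger (\<lambda>x. f x * g x)"
  unfolding local_ring_def by simp (rule germ_UN2, erule (1) eventually_elim2, simp)

lemma O_add: "ger f \<oplus>\<^bsub>\<O>\<^esub> ger g = ger (\<lambda>x. f x + g x)"
  unfolding local_ring_def by simp (rule germ_UN2, erule (1) eventually_elim2, simp)

lemma O_smult: "c \<odot>\<^bsub>\<O>\<^esub> ger f = ger (\<lambda>x. c * f x)"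
  unfolding local_ring_def by simp (rule germ_UN, erule eventually_mono, simp)

lemma O_zero: "\<zero>\<^bsub>\<O>\<^esub> = ger (\<lambda>x. 0)" and O_one: "\<one>\<^bsub>\<O>\<^esub> = ger (\<lambda>x. 1)"
  unfolding local_ring_def by simp_all

lemma O_carrier: "carrier \<O> = ger ` {f. reg f}"
  unfolding local_ring_def by simp

lemma O_carrierE: assumes "a \<in> carrier \<O>" obtains f where "reg f" "a = ger f"
  using assms unfolding O_carrier by blast

lemma germ_carrier [simp]: "reg f \<Longrightarrow> ger f \<in> carrier \<O>"
  unfolding O_carrier by blast

lemmas reg_intros = regular_at_const[OF P_in] regular_at_add regular_at_mult regular_at_uminus regular_at_diff
  regular_at_polyfun[OF P_in] regular_at_sum[OF P_in]

lemma cring_O: "cring \<O>"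
proof (rule cringI)
  show "abelian_group \<O>"
  proof (rule abelian_groupI)
    fix x assume "x \<in> carrier \<O>"
    then obtain f where f: "reg f" "x = ger f" by (rule O_carrierE)
    show "\<exists>y\<in>carrier \<O>. y \<oplus>\<^bsub>\<O>\<^esub> x = \<zero>\<^bsub>\<O>\<^esub>"
      using f by (intro bexI[of _ "ger (\<lambda>x. - f x)"]) (auto simp: O_add O_zero intro!: germ_carrier intro: reg_intros)
  qed (auto simp: O_add O_zero ac_simps elim!: O_carrierE intro!: germ_carrier intro: reg_intros)
  show "comm_monoid \<O>"
    by (rule comm_monoidI) (auto simp: O_mult O_one ac_simps elim!: O_carrierE intro!: germ_carrier intro: reg_intros)
qed (auto simp: O_add O_mult distrib_right elim!: O_carrierE)

end

sublocale variety_point \<subseteq> O: cring "local_ring X P"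
  by (rule cring_O)

context variety_point
begin

lemma O_uminus: "reg f \<Longrightarrow> \<ominus>\<^bsub>\<O>\<^esub> ger f = ger (\<lambda>x. - f x)"
  by (rule O.minus_equality) (auto simp: O_add O_zero intro!: germ_carrier intro: reg_intros)

lemma O_minus: "reg f \<Longrightarrow> reg g \<Longrightarrow> ger f \<ominus>\<^bsub>\<O>\<^esub> ger g = ger (\<lambda>x. f x - g x)"
  by (simp add: a_minus_def O_uminus O_add)

lemma O_finsum:
  assumes "finite A" "\<And>i. i \<in> A \<Longrightarrow> reg (f i)"
  shows "(\<Oplus>\<^bsub>\<O>\<^esub>i\<in>A. ger (f i)) = ger (\<lambda>x. \<Sum>i\<in>A. f i x)"
  using assms
proof (induction rule: finite_induct)
  case (insert x F)
  then have "(\<Oplus>\<^bsub>\<O>\<^esub>i\<in>insert x F. ger (f i)) = ger (f x) \<oplus>\<^bsub>\<O>\<^esub> (\<Oplus>\<^bsub>\<O>\<^esub>i\<in>F. ger (f i))"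
    by (intro O.finsum_insert) auto
  then show ?case using insert by (simp add: O_add)
qed (simp add: O_zero)

lemma in_\<mm>: "reg f \<Longrightarrow> ger f \<in> \<mm> \<longleftrightarrow> f P = 0"
proof -
  assume f: "reg f"
  have "f P = 0" if "ger f = ger g" "g P = 0" for g
    using that eventually_znhds_at[OF P_in, of "\<lambda>x. f x = g x"] unfolding germ_eq_iff by simp
  then show ?thesis using f unfolding local_max_ideal_def by auto
qed

lemma \<mm>_subset: "\<mm> \<subseteq> carrier \<O>"
  unfolding local_max_ideal_def O_carrier by blast

lemma \<mm>E: assumes "a \<in> \<mm>" obtains f where "reg f" "f P = 0" "a = ger f"
  using assms unfolding local_max_ideal_def by blast

lemma ideal_\<mm>: "ideal \<mm> \<O>"
proof (rule idealI)
  show "ring \<O>" by (rule O.ring_axioms)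
  show "subgroup \<mm> (add_monoid \<O>)"
  proof (rule O.add.subgroupI)
    show "\<mm> \<subseteq> carrier \<O>" by (rule \<mm>_subset)
    have "\<zero>\<^bsub>\<O>\<^esub> \<in> \<mm>" by (simp add: O_zero in_\<mm> reg_intros)
    then show "\<mm> \<noteq> {}" by blast
    fix a assume "a \<in> \<mm>"
    then show "\<ominus>\<^bsub>\<O>\<^esub> a \<in> \<mm>"
      by (auto elim!: \<mm>E simp: O_uminus in_\<mm> reg_intros)
    fix b assume "b \<in> \<mm>"
    with \<open>a \<in> \<mm>\<close> show "a \<oplus>\<^bsub>\<O>\<^esub> b \<in> \<mm>"
      by (auto elim!: \<mm>E simp: O_add in_\<mm> reg_intros)
  qed
  fix a x assume "a \<in> \<mm>" "x \<in> carrier \<O>"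
  then show "x \<otimes>\<^bsub>\<O>\<^esub> a \<in> \<mm>" "a \<otimes>\<^bsub>\<O>\<^esub> x \<in> \<mm>"
    by (auto elim!: \<mm>E O_carrierE simp: O_mult in_\<mm> reg_intros)
qed

text \<open>The function \<open>f\<close> stays nonzero near \<open>P\<close>, so its pointwise
  inverse has a germ; this later turns denominators into units.\<close>

lemma unit_germ: "reg f \<Longrightarrow> f P \<noteq> 0 \<Longrightarrow> ger f \<in> Units \<O>"
proof -
  assume f: "reg f" "f P \<noteq> 0"
  have "near (\<lambda>x. f x * inverse (f x) = 1)"
    using eventually_nonzero_regular[OF f] by eventually_elim simp
  then have "ger f \<otimes>\<^bsub>\<O>\<^esub> ger (\<lambda>x. inverse (f x)) = \<one>\<^bsub>\<O>\<^esub>" unfolding O_mult O_one germ_eq_iff .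
  then show ?thesis
    using f regular_at_inverse[OF f] O.m_comm[of "ger f" "ger (\<lambda>x. inverse (f x))"]
    unfolding Units_def by (auto intro!: bexI[of _ "ger (\<lambda>x. inverse (f x))"])
qed

end

section \<open>Krull dimension\<close>

text \<open>Gaussian elimination, one equation at a time. It supplies the linear relation among
  products that bounds the length of prime chains.\<close>

lemma nontrivial_solution:
  fixes M :: "'a \<Rightarrow> 'b \<Rightarrow> 'k::field"
  assumes "finite B" "finite A" "card B < card A"
  shows "\<exists>c. (\<exists>a\<in>A. c a \<noteq> 0) \<and> (\<forall>b\<in>B. (\<Sum>a\<in>A. c a * M a b) = 0)"
  using assms
proof (induction arbitrary: A M rule: finite_induct)
  case empty
  then obtain a where "a \<in> A" by fastforce
  then show ?case by (intro exI[of _ "\<lambda>_. 1"]) auto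
next
  case (insert b B)
  show ?case
  proof (cases "\<forall>a\<in>A. M a b = 0")
    case True
    obtain c where "\<exists>a\<in>A. c a \<noteq> 0" "\<forall>b\<in>B. (\<Sum>a\<in>A. c a * M a b) = 0"
      using insert.IH[of A M] insert.prems insert.hyps by auto
    then show ?thesis using True by (intro exI[of _ c]) simp
  next
    case False
    then obtain a0 where a0: "a0 \<in> A" "M a0 b \<noteq> 0" by blast
    let ?A = "A - {a0}"
    \<comment> \<open>\<open>M'\<close> is the system after equation \<open>b\<close> has been used,
      with pivot \<open>M a0 b\<close>, to eliminate the unknown \<open>a0\<close>.\<close>
    define M' where "M' a b' = M a b' - M a b / M a0 b * M a0 b'" for a b'
    have "card B < card ?A" using insert a0 by simp
    then obtain c where c: "\<exists>a\<in>?A. c a \<noteq> 0" "\<forall>b\<in>B. (\<Sum>a\<in>?A. c a * M' a b) = 0"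
      using insert.IH[of ?A M'] insert.prems by auto
    \<comment> \<open>The eliminated unknown is recovered from equation \<open>b\<close>.\<close>
    define d where "d a = (if a = a0 then - (\<Sum>a\<in>?A. c a * M a b) / M a0 b else c a)" for a
    have sum_d: "(\<Sum>a\<in>A. d a * M a b') = - (\<Sum>a\<in>?A. c a * M a b) / M a0 b * M a0 b' + (\<Sum>a\<in>?A. c a * M a b')" for b'
    proof -
      have "(\<Sum>a\<in>A. d a * M a b') = d a0 * M a0 b' + (\<Sum>a\<in>?A. d a * M a b')"
        using insert.prems(1) a0(1) by (rule sum.remove)
      also have "(\<Sum>a\<in>?A. d a * M a b') = (\<Sum>a\<in>?A. c a * M a b')"
        by (rule sum.cong) (auto simp: d_def)
      finally show ?thesis by (simp add: d_def)
    qed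
    have "(\<Sum>a\<in>A. d a * M a b') = 0" if "b' \<in> B" for b'
    proof -
      have "(\<Sum>a\<in>?A. c a * M' a b') = (\<Sum>a\<in>?A. c a * M a b') - (\<Sum>a\<in>?A. c a * M a b) / M a0 b * M a0 b'"
        unfolding M'_def right_diff_distrib sum_subtractf sum_divide_distrib sum_distrib_right by (simp add: field_simps)
      then show ?thesis using sum_d[of b'] c(2) that by simp
    qed
    moreover have "(\<Sum>a\<in>A. d a * M a b) = 0" using sum_d[of b] a0 by simp
    moreover have "\<exists>a\<in>A. d a \<noteq> 0" using c(1) unfolding d_def by auto
    ultimately show ?thesis by blast
  qed
qed

text \<open>A polynomial relation whose successive lowest terms are divided out survives from one step of the
  chain to the next, until a nonzero constant lies in the last prime.\<close>

lemma no_relation_along_prime_chain: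
  fixes Q :: "nat \<Rightarrow> 'r::comm_ring_1 set" and x :: "nat \<Rightarrow> 'r" and \<kappa> :: "'k::field \<Rightarrow> 'r"
  assumes A1: "1 \<in> A" and A_add: "\<And>a b. a \<in> A \<Longrightarrow> b \<in> A \<Longrightarrow> a + b \<in> A"
    and A_mult: "\<And>a b. a \<in> A \<Longrightarrow> b \<in> A \<Longrightarrow> a * b \<in> A" and A_const: "\<And>c. \<kappa> c \<in> A" and A0: "0 \<in> A"
    and Q_sub: "\<And>i. i \<le> n \<Longrightarrow> Q i \<subseteq> A"
    and Q_diff: "\<And>i a b. i \<le> n \<Longrightarrow> a \<in> Q i \<Longrightarrow> b \<in> Q i \<Longrightarrow> a - b \<in> Q i"
    and Q_mult: "\<And>i a b. i \<le> n \<Longrightarrow> a \<in> Q i \<Longrightarrow> b \<in> A \<Longrightarrow> a * b \<in> Q i"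
    and Q_prime: "\<And>i a b. i \<le> n \<Longrightarrow> a \<in> A \<Longrightarrow> b \<in> A \<Longrightarrow> a * b \<in> Q i \<Longrightarrow> a \<in> Q i \<or> b \<in> Q i"
    and Q_const: "\<And>c. c \<noteq> 0 \<Longrightarrow> \<kappa> c \<notin> Q n"
    and Q_one: "\<And>i. i \<le> n \<Longrightarrow> 1 \<notin> Q i"
    and Q_mono: "\<And>i. i < n \<Longrightarrow> Q i \<subseteq> Q (Suc i)"
    and x: "\<And>i. i < n \<Longrightarrow> x i \<in> Q (Suc i)" "\<And>i. i < n \<Longrightarrow> x i \<notin> Q i"
    and E: "k \<le> n" "finite E" "E \<noteq> {}" "\<And>e. e \<in> E \<Longrightarrow> c e \<noteq> 0"
      "\<And>e e'. e \<in> E \<Longrightarrow> e' \<in> E \<Longrightarrow> (\<And>i. k \<le> i \<Longrightarrow> i < n \<Longrightarrow> e i = e' i) \<Longrightarrow> e = e'"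
  shows "(\<Sum>e\<in>E. \<kappa> (c e) * (\<Prod>i\<in>{k..<n}. x i ^ e i)) \<notin> Q k"
  using E
proof (induction "n - k" arbitrary: k E)
  case 0
  then have "k = n" by simp
  moreover obtain e0 where "e0 \<in> E" using 0 by blast
  moreover have "E = {e0}" using 0 \<open>k = n\<close> \<open>e0 \<in> E\<close> by (metis leD is_singletonI' is_singleton_def singletonD)
  ultimately show ?case using Q_const 0 by simp
next
  case (Suc m)
  then have k: "k < n" by simp
  have xA: "x i \<in> A" if "i < n" for i using x(1)[OF that] Q_sub[of "Suc i"] that by auto
  have powA: "y ^ l \<in> A" if "y \<in> A" for y l using that by (induction l) (auto intro: A1 A_mult)
  have prodA: "(\<Prod>i\<in>I. x i ^ f i) \<in> A" if "\<And>i. i \<in> I \<Longrightarrow> i < n" for I f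
    using that by (induction I rule: infinite_finite_induct) (auto intro: A1 A_mult powA xA)
  have sumA: "(\<Sum>e\<in>F. h e) \<in> A" if "\<And>e. e \<in> F \<Longrightarrow> h e \<in> A" for F and h :: "(nat \<Rightarrow> nat) \<Rightarrow> 'r"
    using that by (induction F rule: infinite_finite_induct) (auto intro: A0 A_add)
  \<comment> \<open>The least exponent of \<open>x k\<close>. The power \<open>x k ^ a\<close> can
    be divided out because \<open>x k\<close> lies outside the prime \<open>Q k\<close>.\<close>
  define a where "a = Min ((\<lambda>e. e k) ` E)"
  have a_le: "a \<le> e k" if "e \<in> E" for e using Suc.prems(2) that unfolding a_def by simp
  have "a \<in> (\<lambda>e. e k) ` E" unfolding a_def using Suc.prems by (intro Min_in) auto
  define E0 where "E0 = {e \<in> E. e k = a}"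
  have E0: "E0 \<noteq> {}" "E0 \<subseteq> E" "finite E0" using \<open>a \<in> _\<close> Suc.prems(2) unfolding E0_def by auto
  let ?p = "\<lambda>e. \<Prod>i\<in>{Suc k..<n}. x i ^ e i"
  define G where "G = (\<Sum>e\<in>E. \<kappa> (c e) * x k ^ (e k - a) * ?p e)"
  define H where "H = (\<Sum>e\<in>E - E0. \<kappa> (c e) * x k ^ (e k - a - 1) * ?p e)"
  have split: "(\<Prod>i\<in>{k..<n}. x i ^ e i) = x k ^ e k * ?p e" for e
    using k by (simp add: prod.atLeast_Suc_lessThan)
  have eq1: "(\<Sum>e\<in>E. \<kappa> (c e) * (\<Prod>i\<in>{k..<n}. x i ^ e i)) = x k ^ a * G"
    unfolding G_def sum_distrib_left
  proof (rule sum.cong)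
    fix e assume "e \<in> E"
    then have "x k ^ e k = x k ^ a * x k ^ (e k - a)" using a_le by (simp flip: power_add)
    then show "\<kappa> (c e) * (\<Prod>i\<in>{k..<n}. x i ^ e i) = x k ^ a * (\<kappa> (c e) * x k ^ (e k - a) * ?p e)"
      unfolding split by (simp add: mult_ac)
  qed simp
  have eq2: "G = (\<Sum>e\<in>E0. \<kappa> (c e) * ?p e) + x k * H"
  proof -
    have "G = (\<Sum>e\<in>E - E0. \<kappa> (c e) * x k ^ (e k - a) * ?p e) + (\<Sum>e\<in>E0. \<kappa> (c e) * x k ^ (e k - a) * ?p e)"
      unfolding G_def by (rule sum.subset_diff[OF E0(2) Suc.prems(2)])
    also have "(\<Sum>e\<in>E0. \<kappa> (c e) * x k ^ (e k - a) * ?p e) = (\<Sum>e\<in>E0. \<kappa> (c e) * ?p e)"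
      by (rule sum.cong) (auto simp: E0_def)
    also have "(\<Sum>e\<in>E - E0. \<kappa> (c e) * x k ^ (e k - a) * ?p e) = x k * H"
      unfolding H_def sum_distrib_left
    proof (rule sum.cong)
      fix e assume e: "e \<in> E - E0"
      then have "a < e k" using a_le[of e] unfolding E0_def by force
      then have "x k ^ (e k - a) = x k * x k ^ (e k - a - 1)" by (metis Suc_diff_1 power_Suc zero_less_diff)
      then show "\<kappa> (c e) * x k ^ (e k - a) * ?p e = x k * (\<kappa> (c e) * x k ^ (e k - a - 1) * ?p e)"
        by (simp add: mult_ac)
    qed simp
    finally show ?thesis by simp
  qed
  have HA: "H \<in> A" unfolding H_def using k by (intro sumA A_mult A_const powA xA prodA) auto
  have GA: "G \<in> A" unfolding G_def using k by (intro sumA A_mult A_const powA xA prodA) auto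
  show ?case
  proof
    assume "(\<Sum>e\<in>E. \<kappa> (c e) * (\<Prod>i\<in>{k..<n}. x i ^ e i)) \<in> Q k"
    then have "x k ^ a * G \<in> Q k" using eq1 by simp
    moreover have "x k ^ l \<notin> Q k" for l
      by (induction l) (use k Q_one Q_prime[of k "x k"] x(2) xA powA in auto)
    ultimately have "G \<in> Q k" using Q_prime[of k "x k ^ a" G] k xA powA GA by auto
    then have "G \<in> Q (Suc k)" using Q_mono[OF k] by blast
    \<comment> \<open>Modulo \<open>Q (Suc k)\<close> the element \<open>x k\<close> vanishes, so
      only the terms with least exponent remain, and what is left of them no longer involves
      \<open>x k\<close>.\<close>
    moreover have "x k * H \<in> Q (Suc k)" using Q_mult[of "Suc k" "x k" H] x(1)[OF k] HA k by simp
    ultimately have "G - x k * H \<in> Q (Suc k)" using Q_diff[of "Suc k"] k by simp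
    then have "(\<Sum>e\<in>E0. \<kappa> (c e) * ?p e) \<in> Q (Suc k)" using eq2 by simp
    moreover have "(\<Sum>e\<in>E0. \<kappa> (c e) * ?p e) \<notin> Q (Suc k)"
    proof (rule Suc.hyps(1))
      fix e e' assume e: "e \<in> E0" "e' \<in> E0" "\<And>i. Suc k \<le> i \<Longrightarrow> i < n \<Longrightarrow> e i = e' i"
      have "e i = e' i" if "k \<le> i" "i < n" for i
        using that e unfolding E0_def by (cases "i = k") auto
      then show "e = e'" using Suc.prems(5)[of e e'] e E0(2) by blast
    qed (use Suc.hyps(2) k E0 Suc.prems(4) in auto)
    ultimately show False by blast
  qed
qed

text \<open>In the application the left side bounds the number of available monomials, and the right
  side counts products along a chain of \<open>Suc D\<close> steps.\<close>

lemma power_growth: "\<exists>T::nat. (m * T + 1) ^ D < (T + 1) ^ Suc D"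
proof
  \<comment> \<open>The constant \<open>(m + 1) ^ D\<close>, which comes from
    \<open>m T + 1 \<le> (m + 1) (T + 1)\<close>, must stay below the extra factor
    \<open>T + 1\<close>.\<close>
  let ?T = "(m + 1) ^ D"
  have "(m * ?T + 1) ^ D \<le> ((m + 1) * (?T + 1)) ^ D" by (intro power_mono) (simp_all add: algebra_simps)
  also have "\<dots> = ?T * (?T + 1) ^ D" by (simp only: power_mult_distrib)
  also have "\<dots> < (?T + 1) * (?T + 1) ^ D" by (intro mult_strict_right_mono) simp_all
  finally show "(m * ?T + 1) ^ D < (?T + 1) ^ Suc D" by simp
qed

text \<open>A unit factor can be cancelled, so primes of the local ring are told apart by
  numerators.\<close>

lemma primeideal_contraction:
  assumes "primeideal p R" "a \<in> carrier R" "s \<in> Units R"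
  shows "s \<otimes>\<^bsub>R\<^esub> a \<in> p \<longleftrightarrow> a \<in> p"
proof -
  interpret primeideal p R by (rule assms(1))
  have "a = inv\<^bsub>R\<^esub> s \<otimes>\<^bsub>R\<^esub> (s \<otimes>\<^bsub>R\<^esub> a)"
    using assms by (simp add: m_assoc[symmetric] Units_closed)
  then show ?thesis
    using I_l_closed[of a s] I_l_closed[of "s \<otimes>\<^bsub>R\<^esub> a" "inv\<^bsub>R\<^esub> s"] assms(2,3) Units_closed Units_inv_closed by auto
qed

text \<open>Suppose that a chain has length \<open>n > D\<close>, with separating elements
  \<open>x i\<close> of degree at most \<open>\<delta>\<close>. There are \<open>(T + 1) ^ n\<close>
  products with exponents at most \<open>T\<close>, but they lie in the span of at most
  \<open>(n \<delta> T + 1) ^ D\<close> monomials. For suitable \<open>T\<close> they are linearly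
  dependent, against \<open>no_relation_along_prime_chain\<close>. Asking for \<open>cover\<close>
  only up to units lets one statement serve both the local ring and its graded ring.\<close>

theorem krull_dim_le:
  fixes S :: "('b \<Rightarrow>\<^sub>0 int) set" and deg :: "('b \<Rightarrow>\<^sub>0 int) \<Rightarrow> nat"
    and \<pi> :: "(('b \<Rightarrow>\<^sub>0 int) \<Rightarrow>\<^sub>0 'k::field) \<Rightarrow> 'a"
  assumes S0: "0 \<in> S" and S_add: "\<And>u v. u \<in> S \<Longrightarrow> v \<in> S \<Longrightarrow> u + v \<in> S"
    and deg_add: "\<And>u v. u \<in> S \<Longrightarrow> v \<in> S \<Longrightarrow> deg (u + v) = deg u + deg v"
    and fin: "\<And>T. finite {u \<in> S. deg u \<le> T}" and bound: "\<And>T. card {u \<in> S. deg u \<le> T} \<le> (T + 1) ^ D"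
    and R: "cring R" and hom: "\<pi> \<in> ring_hom (semigroup_algebra S) R"
    and cover: "\<And>a. a \<in> carrier R \<Longrightarrow> \<exists>s\<in>Units R. \<exists>p. Poly_Mapping.keys p \<subseteq> S \<and> a = s \<otimes>\<^bsub>R\<^esub> \<pi> p"
  shows "krull_dim R \<le> enat D"
  unfolding krull_dim_def
proof (rule Sup_least, clarify)
  fix n :: nat and P assume prime: "\<forall>i\<le>n. primeideal (P i) R" and chain: "\<forall>i<n. P i \<subset> P (Suc i)"
  let ?A = "{p :: ('b \<Rightarrow>\<^sub>0 int) \<Rightarrow>\<^sub>0 'k. Poly_Mapping.keys p \<subseteq> S}"
  have h_closed: "\<pi> p \<in> carrier R" if "p \<in> ?A" for p
    using ring_hom_closed[OF hom] that by (simp add: semigroup_algebra_def)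
  have h_mult: "\<pi> (p * q) = \<pi> p \<otimes>\<^bsub>R\<^esub> \<pi> q" if "p \<in> ?A" "q \<in> ?A" for p q
    using ring_hom_mult[OF hom] that by (simp add: semigroup_algebra_def)
  have h_add: "\<pi> (p + q) = \<pi> p \<oplus>\<^bsub>R\<^esub> \<pi> q" if "p \<in> ?A" "q \<in> ?A" for p q
    using ring_hom_add[OF hom] that by (simp add: semigroup_algebra_def)
  have h_one: "\<pi> 1 = \<one>\<^bsub>R\<^esub>" using ring_hom_one[OF hom] by (simp add: semigroup_algebra_def)
  have A1: "1 \<in> ?A" "0 \<in> ?A" using S0 by auto
  have A_add: "p + q \<in> ?A" if "p \<in> ?A" "q \<in> ?A" for p q using keys_add[of p q] that by auto
  have A_mult: "p * q \<in> ?A" if "p \<in> ?A" "q \<in> ?A" for p q using keys_mult[of p q] S_add that by fastforce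
  have A_const: "Poly_Mapping.single 0 c \<in> ?A" for c using S0 by (cases "c = 0") auto
  interpret R: cring R by (rule R)
  have h_zero: "\<pi> 0 = \<zero>\<^bsub>R\<^esub>"
  proof -
    have c: "\<pi> 0 \<in> carrier R" using h_closed[of 0] A1 by simp
    have "\<pi> 0 \<oplus>\<^bsub>R\<^esub> \<pi> 0 = \<pi> 0 \<oplus>\<^bsub>R\<^esub> \<zero>\<^bsub>R\<^esub>" using h_add[of 0 0] c A1 by simp
    then have "\<ominus>\<^bsub>R\<^esub> \<pi> 0 \<oplus>\<^bsub>R\<^esub> (\<pi> 0 \<oplus>\<^bsub>R\<^esub> \<pi> 0) = \<ominus>\<^bsub>R\<^esub> \<pi> 0 \<oplus>\<^bsub>R\<^esub> (\<pi> 0 \<oplus>\<^bsub>R\<^esub> \<zero>\<^bsub>R\<^esub>)" by (simp only:)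
    then show ?thesis using c by (simp only: R.r_neg1 R.zero_closed)
  qed
  \<comment> \<open>The chain is contracted to the semigroup algebra, where degrees are
    available.\<close>
  define Q where "Q i = {p \<in> ?A. \<pi> p \<in> P i}" for i
  have ex_x: "\<exists>p. p \<in> Q (Suc i) \<and> p \<notin> Q i" if i: "i < n" for i
  proof -
    obtain a where a: "a \<in> P (Suc i)" "a \<notin> P i" using chain i by blast
    have pi: "primeideal (P (Suc i)) R" "primeideal (P i) R" using prime i by auto
    have "a \<in> carrier R" using a(1) pi(1) by (meson ideal.Icarr primeideal.axioms(1))
    then obtain s p where sp: "s \<in> Units R" "Poly_Mapping.keys p \<subseteq> S" "a = s \<otimes>\<^bsub>R\<^esub> \<pi> p" using cover by blast
    have "\<pi> p \<in> P (Suc i)" "\<pi> p \<notin> P i"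
      using a sp primeideal_contraction[OF pi(1)] primeideal_contraction[OF pi(2)] h_closed[of p] by auto
    then show ?thesis using sp(2) unfolding Q_def by blast
  qed
  then obtain x where x: "\<And>i. i < n \<Longrightarrow> x i \<in> Q (Suc i)" "\<And>i. i < n \<Longrightarrow> x i \<notin> Q i" by metis
  have xS: "Poly_Mapping.keys (x i) \<subseteq> S" if "i < n" for i using x(1)[OF that] unfolding Q_def by simp
  show "enat n \<le> enat D"
  proof (rule ccontr)
    assume "\<not> enat n \<le> enat D"
    then have nD: "Suc D \<le> n" by simp
    have "finite (\<Union>i<n. deg ` Poly_Mapping.keys (x i))" by simp
    then obtain \<delta> where \<delta>: "\<And>i u. i < n \<Longrightarrow> u \<in> Poly_Mapping.keys (x i) \<Longrightarrow> deg u \<le> \<delta>"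
      using finite_nat_set_iff_bounded_le[of "\<Union>i<n. deg ` Poly_Mapping.keys (x i)"] by blast
    \<comment> \<open>\<open>B d\<close> is the span of the monomials of degree at most
      \<open>d\<close>, a multiplicative filtration.\<close>
    define B where "B d p \<longleftrightarrow> Poly_Mapping.keys p \<subseteq> {u \<in> S. deg u \<le> d}" for d and p :: "('b \<Rightarrow>\<^sub>0 int) \<Rightarrow>\<^sub>0 'k"
    have B1: "B 0 1"
    proof -
      have "deg 0 = 0" using deg_add[OF S0 S0] by simp
      then show ?thesis using S0 unfolding B_def by simp
    qed
    have B_mult: "B (d + d') (p * q)" if "B d p" "B d' q" for d d' p q
      using keys_mult[of p q] S_add deg_add that unfolding B_def by fastforce
    have Bx: "B \<delta> (x i)" if "i < n" for i using \<delta> xS that unfolding B_def by blast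
    have B_pow: "B (l * \<delta>) (x i ^ l)" if "i < n" for i l
      by (induction l) (use B1 B_mult Bx[OF that] in auto)
    have B_mono: "B d p \<Longrightarrow> d \<le> d' \<Longrightarrow> B d' p" for d d' p unfolding B_def by fastforce
    have B_prod: "B (m * (T * \<delta>)) (\<Prod>i\<in>{0..<m}. x i ^ f i)" if "m \<le> n" "\<And>i. i < m \<Longrightarrow> f i \<le> T" for m f T
      using that
    proof (induction m)
      case (Suc m)
      have "B (T * \<delta>) (x m ^ f m)" using B_mono[OF B_pow[of m "f m"]] Suc.prems by simp
      then have "B (m * (T * \<delta>) + T * \<delta>) ((\<Prod>i\<in>{0..<m}. x i ^ f i) * x m ^ f m)" using Suc by (intro B_mult) auto
      then show ?case by (simp add: add.commute)
    qed (use B1 in simp)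
    obtain T where T: "(n * \<delta> * T + 1) ^ D < (T + 1) ^ Suc D" using power_growth by blast
    let ?E = "PiE {0..<n} (\<lambda>_. {0..T})" and ?U = "{u \<in> S. deg u \<le> n * (T * \<delta>)}"
    have "card ?U \<le> (n * \<delta> * T + 1) ^ D" using bound[of "n * (T * \<delta>)"] by (simp add: mult_ac)
    also have "\<dots> < (T + 1) ^ Suc D" by (rule T)
    also have "\<dots> \<le> (T + 1) ^ n" using nD by (intro power_increasing) simp_all
    also have "\<dots> = card ?E" by (simp add: card_PiE)
    finally have "card ?U < card ?E" .
    \<comment> \<open>The unknowns are indexed by the exponent vectors in \<open>?E\<close>, the
      equations by the monomials in \<open>?U\<close>.\<close>
    then obtain c where c: "\<exists>e\<in>?E. c e \<noteq> 0"
      "\<forall>u\<in>?U. (\<Sum>e\<in>?E. c e * Poly_Mapping.lookup (\<Prod>i\<in>{0..<n}. x i ^ e i) u) = 0"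
      using nontrivial_solution[of ?U ?E "\<lambda>e u. Poly_Mapping.lookup (\<Prod>i\<in>{0..<n}. x i ^ e i) u"] fin
      by (auto simp: finite_PiE)
    define E where "E = {e \<in> ?E. c e \<noteq> 0}"
    have finE: "finite ?E" by (simp add: finite_PiE)
    have look_const: "Poly_Mapping.lookup (Poly_Mapping.single 0 d * p) u = d * Poly_Mapping.lookup p u" for d p u
    proof -
      have "Poly_Mapping.single 0 d * p = Poly_Mapping.map ((*) d) p" by (simp add: mult_map_scale_conv_mult)
      then show ?thesis by (simp add: Poly_Mapping.map.rep_eq when_def)
    qed
    have "(\<Sum>e\<in>E. Poly_Mapping.single 0 (c e) * (\<Prod>i\<in>{0..<n}. x i ^ e i)) = 0" (is "?s = 0")
    proof (rule poly_mapping_eqI)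
      fix u
      have "Poly_Mapping.lookup ?s u = (\<Sum>e\<in>E. c e * Poly_Mapping.lookup (\<Prod>i\<in>{0..<n}. x i ^ e i) u)"
        by (simp add: lookup_sum look_const)
      also have "\<dots> = (\<Sum>e\<in>?E. c e * Poly_Mapping.lookup (\<Prod>i\<in>{0..<n}. x i ^ e i) u)"
        unfolding E_def using finE by (intro sum.mono_neutral_left) auto
      also have "\<dots> = 0"
      proof (cases "u \<in> ?U")
        case False
        have "Poly_Mapping.lookup (\<Prod>i\<in>{0..<n}. x i ^ e i) u = 0" if "e \<in> ?E" for e
        proof -
          have "e i \<le> T" if "i < n" for i using \<open>e \<in> ?E\<close> that by (auto simp: PiE_iff)
          then have "B (n * (T * \<delta>)) (\<Prod>i\<in>{0..<n}. x i ^ e i)" by (intro B_prod) auto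
          then show ?thesis using False unfolding B_def by (auto simp: in_keys_iff)
        qed
        then show ?thesis by simp
      qed (use c(2) in blast)
      finally show "Poly_Mapping.lookup ?s u = Poly_Mapping.lookup 0 u" by simp
    qed
    moreover have "?s \<notin> Q 0"
    proof (rule no_relation_along_prime_chain[where A = ?A and n = n])
      fix i assume i: "i \<le> n"
      interpret p: primeideal "P i" R using prime i by blast
      show "Q i \<subseteq> ?A" unfolding Q_def by blast
      show "1 \<notin> Q i" unfolding Q_def using h_one p.I_notcarr p.one_imp_carrier by auto
      fix a b
      show m: "a * b \<in> Q i" if "a \<in> Q i" "b \<in> ?A"
        using that A_mult[of a b] h_mult[of a b] p.I_r_closed[of "\<pi> a" "\<pi> b"] h_closed[of b] unfolding Q_def by simp
      show "a \<in> Q i \<or> b \<in> Q i" if "a \<in> ?A" "b \<in> ?A" "a * b \<in> Q i"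
        using that h_mult[of a b] p.I_prime[of "\<pi> a" "\<pi> b"] h_closed[of a] h_closed[of b] unfolding Q_def by auto
      show "a - b \<in> Q i" if "a \<in> Q i" "b \<in> Q i"
      proof -
        have mb: "- 1 \<in> ?A" "a \<in> ?A" "b \<in> ?A" "\<pi> a \<in> P i" "\<pi> b \<in> P i" using that S0 unfolding Q_def by auto
        have "\<pi> (- 1 * b) \<in> P i" using h_mult[OF mb(1,3)] p.I_l_closed[OF mb(5) h_closed[OF mb(1)]] by simp
        then have "\<pi> (a + - 1 * b) \<in> P i" using h_add[OF mb(2) A_mult[OF mb(1,3)]] mb(4) by simp
        moreover have "a + - 1 * b \<in> ?A" using mb A_add A_mult by blast
        ultimately show ?thesis unfolding Q_def by simp
      qed
    next
      fix i assume "i < n" then show "Q i \<subseteq> Q (Suc i)" using chain unfolding Q_def by blast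
    next
      fix d :: 'k assume d: "d \<noteq> 0"
      interpret p: primeideal "P n" R using prime by blast
      have "Poly_Mapping.single 0 d * Poly_Mapping.single 0 (inverse d) = (1 :: ('b \<Rightarrow>\<^sub>0 int) \<Rightarrow>\<^sub>0 'k)"
        using d by (simp add: mult_single)
      then have "\<pi> (Poly_Mapping.single 0 d) \<otimes>\<^bsub>R\<^esub> \<pi> (Poly_Mapping.single 0 (inverse d)) = \<one>\<^bsub>R\<^esub>"
        using h_mult[OF A_const A_const, of d "inverse d"] h_one by simp
      then show "Poly_Mapping.single 0 d \<notin> Q n"
        using p.I_r_closed[of "\<pi> (Poly_Mapping.single 0 d)" "\<pi> (Poly_Mapping.single 0 (inverse d))"]
          h_closed[OF A_const] p.I_notcarr p.one_imp_carrier unfolding Q_def by auto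
    next
      show "finite E" "E \<noteq> {}" "\<And>e. e \<in> E \<Longrightarrow> c e \<noteq> 0" using finE c(1) unfolding E_def by auto
      fix e e' assume "e \<in> E" "e' \<in> E" "\<And>i. 0 \<le> i \<Longrightarrow> i < n \<Longrightarrow> e i = e' i"
      then show "e = e'" unfolding E_def by (intro PiE_ext[of e "{0..<n}" "\<lambda>_. {0..T}" e']) auto
    qed (use x A1 A_add A_mult A_const in auto)
    moreover have "0 \<in> Q 0"
    proof -
      interpret p: primeideal "P 0" R using prime by blast
      show ?thesis unfolding Q_def using h_zero by simp
    qed
    ultimately show False by simp
  qed
qed

section \<open>Lower bounds and comparison of Krull dimensions\<close>

lemma krull_dim_geI:
  assumes "\<And>i. i \<le> n \<Longrightarrow> primeideal (p i) R" "\<And>i. i < n \<Longrightarrow> p i \<subset> p (Suc i)"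
  shows "enat n \<le> krull_dim R"
  unfolding krull_dim_def by (rule Sup_upper) (use assms in blast)

text \<open>Preimages of primes are prime, and surjectivity keeps the inclusions strict.\<close>

lemma krull_dim_surj_le:
  assumes A: "cring A" and B: "cring B" and h: "h \<in> ring_hom A B" "h ` carrier A = carrier B"
  shows "krull_dim B \<le> krull_dim A"
  unfolding krull_dim_def[of B]
proof (rule Sup_least, clarify)
  fix n and p assume p: "\<forall>i\<le>n. primeideal (p i) B" "\<forall>i<n. p i \<subset> p (Suc i)"
  interpret h: ring_hom_ring A B h
    using h(1) cring.axioms(1)[OF A] cring.axioms(1)[OF B] by (intro ring_hom_ringI2)
  let ?q = "\<lambda>i. {a \<in> carrier A. h a \<in> p i}"
  show "enat n \<le> krull_dim A"
  proof (rule krull_dim_geI)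
    show "primeideal (?q i) A" if "i \<le> n" for i using h.primeideal_vimage[OF A] p(1) that by blast
    fix i assume i: "i < n"
    then obtain b where b: "b \<in> p (Suc i)" "b \<notin> p i" using p(2) by blast
    then have "b \<in> carrier B" using p(1) i by (meson Suc_leI ideal.Icarr primeideal.axioms(1))
    then have "b \<in> h ` carrier A" using h(2) by simp
    then obtain a where "b = h a" "a \<in> carrier A" by (rule imageE)
    then have "a \<in> ?q (Suc i)" "a \<notin> ?q i" using b by auto
    moreover have "p i \<subseteq> p (Suc i)" using p(2) i by auto
    ultimately show "?q i \<subset> ?q (Suc i)" by blast
  qed
qed

section \<open>Orders of vanishing along lines\<close>

text \<open>Vanishing of order at least \<open>k\<close> at 0, for functions that are rational only
  near 0: at the zeros of the denominator nothing is said about \<open>F\<close>.\<close>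

definition line_order :: "nat \<Rightarrow> ('k::field \<Rightarrow> 'k) \<Rightarrow> bool" where
  "line_order k F \<longleftrightarrow> (\<exists>a b. poly b 0 \<noteq> 0 \<and> (\<forall>t. poly b t * F t = t ^ k * poly a t))"

lemma line_order_add:
  assumes "line_order k F" "line_order k G" shows "line_order k (\<lambda>t. F t + G t)"
proof -
  obtain a b a' b' where *: "poly b 0 \<noteq> 0" "\<And>t. poly b t * F t = t ^ k * poly a t"
    "poly b' 0 \<noteq> 0" "\<And>t. poly b' t * G t = t ^ k * poly a' t"
    using assms unfolding line_order_def by blast
  have "poly (b * b') t * (F t + G t) = t ^ k * poly (a * b' + a' * b) t" for t
  proof -
    have "poly (b * b') t * (F t + G t) = poly b' t * (poly b t * F t) + poly b t * (poly b' t * G t)"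
      by (simp add: algebra_simps)
    also have "\<dots> = t ^ k * poly (a * b' + a' * b) t" unfolding * by (simp add: algebra_simps)
    finally show ?thesis .
  qed
  then show ?thesis unfolding line_order_def using *(1,3)
    by (intro exI[of _ "a * b' + a' * b"] exI[of _ "b * b'"]) simp
qed

lemma line_order_mult:
  assumes "line_order k F" "line_order l G" shows "line_order (k + l) (\<lambda>t. F t * G t)"
proof -
  obtain a b a' b' where *: "poly b 0 \<noteq> 0" "\<And>t. poly b t * F t = t ^ k * poly a t"
    "poly b' 0 \<noteq> 0" "\<And>t. poly b' t * G t = t ^ l * poly a' t"
    using assms unfolding line_order_def by blast
  have "poly (b * b') t * (F t * G t) = t ^ (k + l) * poly (a * a') t" for t
  proof -
    have "poly (b * b') t * (F t * G t) = (poly b t * F t) * (poly b' t * G t)"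
      by (simp add: algebra_simps)
    also have "\<dots> = t ^ (k + l) * poly (a * a') t" unfolding * by (simp add: algebra_simps power_add)
    finally show ?thesis .
  qed
  then show ?thesis unfolding line_order_def using *(1,3)
    by (intro exI[of _ "a * a'"] exI[of _ "b * b'"]) simp
qed

text \<open>Multiplying numerator and denominator by \<open>c\<close> hides the points where
  \<open>F\<close> and \<open>G\<close> may differ.\<close>

lemma line_order_cong:
  assumes "line_order k F" "poly c 0 \<noteq> 0" "\<And>t. poly c t \<noteq> 0 \<Longrightarrow> F t = G t"
  shows "line_order k G"
proof -
  obtain a b where *: "poly b 0 \<noteq> 0" "\<And>t. poly b t * F t = t ^ k * poly a t"
    using assms(1) unfolding line_order_def by blast
  have "poly (c * b) t * G t = t ^ k * poly (c * a) t" for t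
  proof (cases "poly c t = 0")
    case False
    then have "poly (c * b) t * G t = poly c t * (poly b t * F t)" using assms(3) by simp
    then show ?thesis unfolding * by simp
  qed simp
  then show ?thesis unfolding line_order_def using * assms(2) by (metis mult_eq_0_iff poly_mult)
qed

text \<open>Over a finite field the product of all \<open>x - a\<close>, plus 1, would have no
  root.\<close>

lemma infinite_UNIV_alg_closed: "infinite (UNIV :: 'k::alg_closed_field set)"
proof
  assume fin: "finite (UNIV :: 'k set)"
  let ?p = "(\<Prod>a\<in>UNIV. [:- a, 1:]) + 1 :: 'k poly"
  have "degree (\<Prod>a\<in>(UNIV :: 'k set). [:- a, 1:]) = (\<Sum>a\<in>(UNIV :: 'k set). degree [:- a, 1:])"
    by (rule degree_prod_eq_sum_degree) simp
  then have "degree (\<Prod>a\<in>(UNIV :: 'k set). [:- a, 1:]) > 0" using fin by (simp add: card_gt_0_iff)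
  then have "degree ?p > 0" by (simp add: degree_add_eq_left)
  then obtain x where "poly ?p x = 0" using alg_closed_imp_poly_has_root by blast
  moreover have "poly (\<Prod>a\<in>UNIV. [:- a, 1:]) x = 0"
    using fin by (simp add: poly_prod)
  ultimately show False by simp
qed

lemma poly_eqI_infinite:
  fixes p q :: "'k::alg_closed_field poly"
  assumes "\<And>t. t \<noteq> 0 \<Longrightarrow> poly p t = poly q t" shows "p = q"
proof (rule ccontr)
  assume "p \<noteq> q"
  then have "finite {t. poly (p - q) t = 0}" by (intro poly_roots_finite) simp
  moreover have "UNIV - {0} \<subseteq> {t. poly (p - q) t = 0}" using assms by auto
  ultimately show False
    using infinite_UNIV_alg_closed by (metis finite_Diff2 finite.emptyI finite.insertI finite_subset)
qed

text \<open>The denominator has nonzero constant term, so it acts like an invertible power series,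
  and divisibility of \<open>b * p\<close> by \<open>t ^ k\<close> passes to \<open>p\<close> one
  coefficient at a time.\<close>

lemma line_order_poly_coeff:
  fixes p :: "'k::alg_closed_field poly"
  assumes "line_order k (poly p)" "l < k" shows "Polynomial.coeff p l = 0"
proof -
  obtain a b where *: "poly b 0 \<noteq> 0" "\<And>t. poly b t * poly p t = t ^ k * poly a t"
    using assms unfolding line_order_def by blast
  have eq: "b * p = [:0, 1:] ^ k * a"
    by (rule poly_eqI_infinite) (use *(2) in simp)
  show ?thesis using assms(2)
  proof (induction l rule: less_induct)
    case (less l)
    have "Polynomial.coeff (b * p) l = (\<Sum>i\<le>l. Polynomial.coeff b i * Polynomial.coeff p (l - i))"
      by (rule coeff_mult)
    also have "\<dots> = (\<Sum>i\<in>{0}. Polynomial.coeff b i * Polynomial.coeff p (l - i))"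
      using less by (intro sum.mono_neutral_right) auto
    finally have "Polynomial.coeff (b * p) l = poly b 0 * Polynomial.coeff p l" by (simp add: poly_0_coeff_0)
    moreover have "Polynomial.coeff (b * p) l = 0"
      using eq less.prems by (simp add: monom_altdef[of 1 k, simplified, symmetric] coeff_monom_mult)
    ultimately show ?case using *(1) by simp
  qed
qed

abbreviation (input) scale :: "'k::field \<Rightarrow> ('v \<Rightarrow> 'k) \<Rightarrow> 'v \<Rightarrow> 'k" where
  "scale t w \<equiv> (\<lambda>v. t * w v)"

lemma polyfun_scale:
  assumes "f \<in> polyfun" obtains p where "\<And>t. f (scale t w) = poly p t"
  using polyfun_line[OF assms, of "\<lambda>_. 0" w] by auto

text \<open>The exceptional parameters are zeros of a polynomial that does not vanish at 0, the form
  in which \<open>line_order_cong\<close> tolerates exceptions.\<close>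

lemma eventually_znhds_line:
  assumes "eventually Q (znhds W (\<lambda>_. 0))" "\<And>t. scale t w \<in> W"
  obtains c where "poly c 0 \<noteq> 0" "\<And>t. poly c t \<noteq> 0 \<Longrightarrow> Q (scale t w)"
proof -
  obtain u where u: "u \<in> polyfun" "u (\<lambda>_. 0) \<noteq> 0" "\<forall>x\<in>W. u x \<noteq> 0 \<longrightarrow> Q x"
    using assms(1) unfolding eventually_znhds by blast
  obtain c where c: "\<And>t. u (scale t w) = poly c t" using polyfun_scale[OF u(1)] by blast
  have "poly c 0 \<noteq> 0" using c[of 0] u(2) by simp
  moreover have "Q (scale t w)" if "poly c t \<noteq> 0" for t using u(3) assms(2)[of t] c[of t] that by simp
  ultimately show thesis by (rule that)
qed

lemma line_order_regular:
  assumes "regular_at W (\<lambda>_. 0) f" "\<And>t. scale t w \<in> W"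
  shows "line_order 0 (\<lambda>t. f (scale t w))" "f (\<lambda>_. 0) = 0 \<Longrightarrow> line_order 1 (\<lambda>t. f (scale t w))"
proof -
  obtain g h where gh: "g \<in> polyfun" "h \<in> polyfun" "h (\<lambda>_. 0) \<noteq> 0" "f (\<lambda>_. 0) = g (\<lambda>_. 0) / h (\<lambda>_. 0)"
    "eventually (\<lambda>x. h x \<noteq> 0 \<and> f x = g x / h x) (znhds W (\<lambda>_. 0))"
    using regular_atE[OF assms(1)] by blast
  obtain c where c: "poly c 0 \<noteq> 0" "\<And>t. poly c t \<noteq> 0 \<Longrightarrow> h (scale t w) \<noteq> 0 \<and> f (scale t w) = g (scale t w) / h (scale t w)"
    by (rule eventually_znhds_line[OF gh(5) assms(2)]) (rule that)
  obtain pg where pg: "\<And>t. g (scale t w) = poly pg t" using polyfun_scale[OF gh(1)] by blast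
  obtain ph where ph: "\<And>t. h (scale t w) = poly ph t" using polyfun_scale[OF gh(2)] by blast
  have b: "poly (c * ph) 0 \<noteq> 0" using c(1) ph[of 0] gh(3) by simp
  have eq: "poly (c * ph) t * f (scale t w) = poly (c * pg) t" for t
    using c(2)[of t] pg[of t] ph[of t] by (cases "poly c t = 0") auto
  then show "line_order 0 (\<lambda>t. f (scale t w))"
    unfolding line_order_def using b by (intro exI[of _ "c * pg"] exI[of _ "c * ph"]) simp
  assume "f (\<lambda>_. 0) = 0"
  then have "poly pg 0 = 0" using pg[of 0] gh(3,4) by simp
  then obtain q where "pg = [:0, 1:] * q" using poly_eq_0_iff_dvd[of pg 0] by auto
  then have "poly (c * ph) t * f (scale t w) = t ^ 1 * poly (c * q) t" for t using eq[of t] by simp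
  then show "line_order 1 (\<lambda>t. f (scale t w))" unfolding line_order_def using b by blast
qed

section \<open>Cones with a monomial basis\<close>

text \<open>An affine cone whose functions have the basis \<open>\<chi> u\<close>, with
  \<open>deg\<close> recording the scaling weight. The \<open>e j\<close> are the exponents of the
  coordinates; \<open>S_decompose\<close> says that they generate \<open>S\<close>, which places the
  monomials of degree \<open>k\<close> in the \<open>k\<close>-th power of the maximal
  ideal.\<close>

locale monomial_cone = graded_semigroup S deg
  for S :: "('b \<Rightarrow>\<^sub>0 int) set" and deg +
  fixes V :: "'w set" and W :: "('w \<Rightarrow> 'k::alg_closed_field) set"
    and \<chi> :: "('b \<Rightarrow>\<^sub>0 int) \<Rightarrow> ('w \<Rightarrow> 'k) \<Rightarrow> 'k" and e :: "'w \<Rightarrow> ('b \<Rightarrow>\<^sub>0 int)"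
  assumes W_affine: "W \<subseteq> affine_space V"
    and W_scale: "w \<in> W \<Longrightarrow> scale t w \<in> W" and W_origin: "(\<lambda>_. 0) \<in> W"
    and \<chi>_polyfun: "u \<in> S \<Longrightarrow> \<chi> u \<in> polyfun"
    and \<chi>_scale: "u \<in> S \<Longrightarrow> w \<in> W \<Longrightarrow> \<chi> u (scale t w) = t ^ deg u * \<chi> u w"
    and \<chi>_add: "u \<in> S \<Longrightarrow> v \<in> S \<Longrightarrow> w \<in> W \<Longrightarrow> \<chi> (u + v) w = \<chi> u w * \<chi> v w"
    and \<chi>_0: "w \<in> W \<Longrightarrow> \<chi> 0 w = 1"
    and e_S: "j \<in> V \<Longrightarrow> e j \<in> S" and deg_e: "j \<in> V \<Longrightarrow> deg (e j) = 1"
    and \<chi>_e: "j \<in> V \<Longrightarrow> w \<in> W \<Longrightarrow> \<chi> (e j) w = w j"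
    and S_decompose: "u \<in> S \<Longrightarrow> deg u = Suc k \<Longrightarrow> \<exists>j\<in>V. \<exists>u'\<in>S. deg u' = k \<and> u = e j + u'"
    and \<chi>_indep: "finite T \<Longrightarrow> T \<subseteq> S \<Longrightarrow> (\<And>w. w \<in> W \<Longrightarrow> (\<Sum>u\<in>T. c u * \<chi> u w) = 0) \<Longrightarrow> u \<in> T \<Longrightarrow> c u = 0"
begin

definition ev :: "(('b \<Rightarrow>\<^sub>0 int) \<Rightarrow>\<^sub>0 'k) \<Rightarrow> ('w \<Rightarrow> 'k) \<Rightarrow> 'k" where
  "ev p w = (\<Sum>u\<in>Poly_Mapping.keys p. Poly_Mapping.lookup p u * \<chi> u w)"

lemma ev_superset: "finite T \<Longrightarrow> Poly_Mapping.keys p \<subseteq> T \<Longrightarrow> ev p w = (\<Sum>u\<in>T. Poly_Mapping.lookup p u * \<chi> u w)"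
  unfolding ev_def by (rule sum.mono_neutral_left) (auto simp: in_keys_iff)

lemma ev_0 [simp]: "ev 0 w = 0" by (simp add: ev_def)

lemma ev_single: "ev (Poly_Mapping.single u c) w = c * \<chi> u w"
  using ev_superset[of "{u}" "Poly_Mapping.single u c" w] by (cases "c = 0") auto

lemma ev_add: "ev (p + q) w = ev p w + ev q w"
proof -
  let ?T = "Poly_Mapping.keys p \<union> Poly_Mapping.keys q"
  have "ev (p + q) w = (\<Sum>u\<in>?T. Poly_Mapping.lookup (p + q) u * \<chi> u w)"
    using keys_add[of p q] by (intro ev_superset) auto
  also have "\<dots> = (\<Sum>u\<in>?T. Poly_Mapping.lookup p u * \<chi> u w) + (\<Sum>u\<in>?T. Poly_Mapping.lookup q u * \<chi> u w)"
    by (simp add: lookup_add distrib_right sum.distrib)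
  also have "\<dots> = ev p w + ev q w" using ev_superset[of ?T p w] ev_superset[of ?T q w] by simp
  finally show ?thesis .
qed

lemma ev_mult:
  assumes "Poly_Mapping.keys p \<subseteq> S" "Poly_Mapping.keys q \<subseteq> S" "w \<in> W"
  shows "ev (p * q) w = ev p w * ev q w"
proof -
  have 1: "ev (Poly_Mapping.single u c * q) w = c * \<chi> u w * ev q w" if "u \<in> S" for u c
    using assms(2)
  proof (induction rule: poly_mapping_induct_on)
    case (single_add v d q)
    then show ?case using that assms(3)
      by (simp add: distrib_left ev_add mult_single ev_single \<chi>_add)
  qed simp
  show ?thesis using assms(1)
    by (induction rule: poly_mapping_induct_on) (simp_all add: distrib_right ev_add 1 ev_single)
qed

lemma ev_1: "w \<in> W \<Longrightarrow> ev 1 w = 1"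
  using ev_single[of 0 1 w] by (simp add: \<chi>_0)

lemma ev_polyfun: "Poly_Mapping.keys p \<subseteq> S \<Longrightarrow> ev p \<in> polyfun"
  unfolding ev_def by (auto intro!: polyfun_sum polyfun.mult polyfun.const \<chi>_polyfun)

text \<open>The coordinates are themselves monomials, and those outside \<open>V\<close> vanish on
  \<open>W\<close>.\<close>

lemma polyfun_eq_ev:
  assumes "f \<in> polyfun"
  shows "\<exists>p. Poly_Mapping.keys p \<subseteq> S \<and> (\<forall>w\<in>W. f w = ev p w)"
  using assms
proof induction
  case (const c)
  show ?case by (intro exI[of _ "Poly_Mapping.single 0 c"]) (simp add: ev_single \<chi>_0)
next
  case (coord v)
  show ?case
  proof (cases "v \<in> V")
    case True
    then show ?thesis
      by (intro exI[of _ "Poly_Mapping.single (e v) 1"]) (simp add: ev_single \<chi>_e e_S)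
  next
    case False
    then have "w v = 0" if "w \<in> W" for w using W_affine that unfolding affine_space_def by blast
    then show ?thesis by (intro exI[of _ 0]) simp
  qed
next
  case (add f g)
  then obtain p q where "Poly_Mapping.keys p \<subseteq> S" "\<forall>w\<in>W. f w = ev p w" "Poly_Mapping.keys q \<subseteq> S" "\<forall>w\<in>W. g w = ev q w" by blast
  then show ?case by (intro exI[of _ "p + q"]) (simp add: ev_add keys_add_S)
next
  case (mult f g)
  then obtain p q where "Poly_Mapping.keys p \<subseteq> S" "\<forall>w\<in>W. f w = ev p w" "Poly_Mapping.keys q \<subseteq> S" "\<forall>w\<in>W. g w = ev q w" by blast
  then show ?case by (intro exI[of _ "p * q"]) (simp add: ev_mult keys_mult_S)
qed

lemma ev_inj:
  assumes p: "Poly_Mapping.keys p \<subseteq> S" and q: "Poly_Mapping.keys q \<subseteq> S" and eq: "\<And>w. w \<in> W \<Longrightarrow> ev p w = ev q w"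
  shows "p = q"
proof (rule poly_mapping_eqI)
  fix u
  let ?T = "Poly_Mapping.keys p \<union> Poly_Mapping.keys q"
  have 0: "(\<Sum>u\<in>?T. (Poly_Mapping.lookup p u - Poly_Mapping.lookup q u) * \<chi> u w) = 0" if "w \<in> W" for w
    using eq[OF that] ev_superset[of ?T p w] ev_superset[of ?T q w] by (simp add: left_diff_distrib sum_subtractf)
  have "Poly_Mapping.lookup p u - Poly_Mapping.lookup q u = 0" if "u \<in> ?T"
    using \<chi>_indep[OF _ _ 0 that] p q by auto
  then show "Poly_Mapping.lookup p u = Poly_Mapping.lookup q u" by (cases "u \<in> ?T") (auto simp: in_keys_iff)
qed

lemma coord_ring_iso: "alg_isomorphic (semigroup_algebra S :: ('k, _) module) (coord_ring W)"
proof -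
  let ?h = "\<lambda>p. restrict (ev p) W"
  let ?A = "semigroup_algebra S :: ('k, ('b \<Rightarrow>\<^sub>0 int) \<Rightarrow>\<^sub>0 'k) module"
  have iso: "?h \<in> ring_iso ?A (coord_ring W)"
  proof (rule ring_iso_memI)
    fix p q assume "p \<in> carrier ?A" "q \<in> carrier ?A"
    then have k: "Poly_Mapping.keys p \<subseteq> S" "Poly_Mapping.keys q \<subseteq> S" by (auto simp: semigroup_algebra_def)
    show "?h p \<in> carrier (coord_ring W)" using ev_polyfun[OF k(1)] by (simp add: coord_ring_def)
    show "?h (p \<otimes>\<^bsub>?A\<^esub> q) = ?h p \<otimes>\<^bsub>coord_ring W\<^esub> ?h q"
      using k by (auto simp: semigroup_algebra_def coord_ring_def ev_mult restrict_def)
    show "?h (p \<oplus>\<^bsub>?A\<^esub> q) = ?h p \<oplus>\<^bsub>coord_ring W\<^esub> ?h q"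
      by (auto simp: semigroup_algebra_def coord_ring_def ev_add restrict_def)
  next
    show "?h \<one>\<^bsub>?A\<^esub> = \<one>\<^bsub>coord_ring W\<^esub>"
      by (auto simp: semigroup_algebra_def coord_ring_def ev_1 restrict_def)
    show "bij_betw ?h (carrier ?A) (carrier (coord_ring W))"
      unfolding bij_betw_def
    proof
      show "inj_on ?h (carrier ?A)"
      proof (rule inj_onI)
        fix p q assume "p \<in> carrier ?A" "q \<in> carrier ?A" and h: "?h p = ?h q"
        then have "Poly_Mapping.keys p \<subseteq> S" "Poly_Mapping.keys q \<subseteq> S" by (auto simp: semigroup_algebra_def)
        moreover have "ev p w = ev q w" if "w \<in> W" for w using fun_cong[OF h, of w] that by simp
        ultimately show "p = q" by (rule ev_inj)
      qed
      show "?h ` carrier ?A = carrier (coord_ring W)"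
      proof (intro equalityI subsetI)
        fix f assume "f \<in> ?h ` carrier ?A"
        then show "f \<in> carrier (coord_ring W)" using ev_polyfun by (auto simp: semigroup_algebra_def coord_ring_def)
      next
        fix f assume "f \<in> carrier (coord_ring W)"
        then obtain f' where f': "f' \<in> polyfun" "f = restrict f' W" by (auto simp: coord_ring_def)
        then obtain p where p: "Poly_Mapping.keys p \<subseteq> S" "\<forall>w\<in>W. f' w = ev p w" using polyfun_eq_ev by blast
        have "f = ?h p" using f' p by (auto simp: restrict_def)
        then show "f \<in> ?h ` carrier ?A" using p by (auto simp: semigroup_algebra_def)
      qed
    qed
  qed
  have smult: "?h (c \<odot>\<^bsub>?A\<^esub> p) = c \<odot>\<^bsub>coord_ring W\<^esub> ?h p" if "p \<in> carrier ?A" for c p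
    using that by (auto simp: semigroup_algebra_def coord_ring_def ev_mult ev_single \<chi>_0 restrict_def)
  show ?thesis unfolding alg_isomorphic_def
    by (rule bexI[OF _ iso]) (intro allI ballI smult)
qed

end

section \<open>Local charts onto a cone\<close>

text \<open>A germ of an isomorphism from \<open>X\<close> at \<open>P\<close> to \<open>W\<close>
  at the origin. The maps are total functions, but regularity is required only at the base points
  and the inverse laws only near them, so no neighbourhoods have to be named.\<close>

locale local_chart = variety_point X P for X :: "('v \<Rightarrow> 'k::field) set" and P +
  fixes W :: "('w \<Rightarrow> 'k) set" and g :: "('v \<Rightarrow> 'k) \<Rightarrow> 'w \<Rightarrow> 'k" and \<phi> :: "('w \<Rightarrow> 'k) \<Rightarrow> 'v \<Rightarrow> 'k"
  assumes origin_in: "(\<lambda>_. 0) \<in> W" and g_P: "g P = (\<lambda>_. 0)" and \<phi>_0: "\<phi> (\<lambda>_. 0) = P"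
    and g_regular: "reg (\<lambda>x. g x v)" and \<phi>_regular: "regular_at W (\<lambda>_. 0) (\<lambda>w. \<phi> w a)"
    and near_g: "near (\<lambda>x. g x \<in> W \<and> \<phi> (g x) = x)"
    and near_\<phi>: "eventually (\<lambda>w. \<phi> w \<in> X \<and> g (\<phi> w) = w) (znhds W (\<lambda>_. 0))"
begin

lemma near_g_W: "near (\<lambda>x. g x \<in> W)"
  using near_g by eventually_elim simp

lemma reg_compose_g: "regular_at W (\<lambda>_. 0) f \<Longrightarrow> reg (\<lambda>x. f (g x))"
  using regular_at_compose[OF P_in g_regular near_g_W, of f] g_P by simp

lemma near_compose_g: "eventually Q (znhds W (\<lambda>_. 0)) \<Longrightarrow> near (\<lambda>x. Q (g x))"
  using eventually_znhds_compose[OF P_in g_regular near_g_W, of Q] g_P by simp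

lemma near_\<phi>_X: "eventually (\<lambda>w. \<phi> w \<in> X) (znhds W (\<lambda>_. 0))"
  using near_\<phi> by eventually_elim simp

lemma reg_compose_\<phi>: "reg f \<Longrightarrow> regular_at W (\<lambda>_. 0) (\<lambda>w. f (\<phi> w))"
  using regular_at_compose[OF origin_in \<phi>_regular near_\<phi>_X, of f] \<phi>_0 by simp

lemma near_compose_\<phi>: "near Q \<Longrightarrow> eventually (\<lambda>w. Q (\<phi> w)) (znhds W (\<lambda>_. 0))"
  using eventually_znhds_compose[OF origin_in \<phi>_regular near_\<phi>_X, of Q] \<phi>_0 by simp

lemma reg_polyfun_g: "f \<in> polyfun \<Longrightarrow> reg (\<lambda>x. f (g x))"
  by (intro reg_compose_g regular_at_polyfun origin_in)

text \<open>The function \<open>f \<circ> \<phi>\<close> is a fraction near the origin; composing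
  back with \<open>g\<close> writes every germ at \<open>P\<close> as a fraction in the chart
  coordinates.\<close>

lemma reg_fraction:
  assumes "reg f"
  obtains a b where "a \<in> polyfun" "b \<in> polyfun" "b (\<lambda>_. 0) \<noteq> 0"
    "near (\<lambda>x. b (g x) \<noteq> 0 \<and> f x = a (g x) / b (g x))"
proof -
  obtain a b where ab: "a \<in> polyfun" "b \<in> polyfun" "b (\<lambda>_. 0) \<noteq> 0"
    "eventually (\<lambda>w. b w \<noteq> 0 \<and> f (\<phi> w) = a w / b w) (znhds W (\<lambda>_. 0))"
    using regular_atE[OF reg_compose_\<phi>[OF assms]] by blast
  have "near (\<lambda>x. b (g x) \<noteq> 0 \<and> f x = a (g x) / b (g x))"
    using near_compose_g[OF ab(4)] near_g by eventually_elim simp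
  with ab show thesis using that by blast
qed

end

locale chart_on_cone = local_chart X P W g \<phi> + monomial_cone S deg V W \<chi> e
  for X :: "('v \<Rightarrow> 'k::alg_closed_field) set" and P and W :: "('w \<Rightarrow> 'k) set" and g \<phi>
  and S :: "('b \<Rightarrow>\<^sub>0 int) set" and deg V \<chi> e

sublocale chart_on_cone \<subseteq> F: ideal_filtration "local_ring X P" "local_max_ideal X P"
proof (intro ideal_filtration.intro K_algebra.intro K_algebra_axioms.intro ideal_\<mm> cring_O)
  fix a assume "a \<in> carrier \<O>"
  then obtain f where f: "reg f" "a = ger f" by (rule O_carrierE)
  fix c d :: 'k
  show "c \<odot>\<^bsub>\<O>\<^esub> a \<in> carrier \<O>" using f by (auto simp: O_smult intro!: germ_carrier regular_at_mult regular_at_const P_in)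
  show "(c + d) \<odot>\<^bsub>\<O>\<^esub> a = c \<odot>\<^bsub>\<O>\<^esub> a \<oplus>\<^bsub>\<O>\<^esub> d \<odot>\<^bsub>\<O>\<^esub> a"
    using f by (simp add: O_smult O_add distrib_right)
  show "(c * d) \<odot>\<^bsub>\<O>\<^esub> a = c \<odot>\<^bsub>\<O>\<^esub> (d \<odot>\<^bsub>\<O>\<^esub> a)" using f by (simp add: O_smult mult.assoc)
  show "1 \<odot>\<^bsub>\<O>\<^esub> a = a" using f by (simp add: O_smult)
  fix b assume "b \<in> carrier \<O>"
  then obtain h where h: "reg h" "b = ger h" by (rule O_carrierE)
  show "c \<odot>\<^bsub>\<O>\<^esub> (a \<oplus>\<^bsub>\<O>\<^esub> b) = c \<odot>\<^bsub>\<O>\<^esub> a \<oplus>\<^bsub>\<O>\<^esub> c \<odot>\<^bsub>\<O>\<^esub> b"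
    using f h by (simp add: O_smult O_add distrib_left)
  show "c \<odot>\<^bsub>\<O>\<^esub> a \<otimes>\<^bsub>\<O>\<^esub> b = c \<odot>\<^bsub>\<O>\<^esub> (a \<otimes>\<^bsub>\<O>\<^esub> b)"
    using f h by (simp add: O_smult O_mult mult.assoc)
qed

section \<open>Monomials in the powers of the maximal ideal\<close>

context chart_on_cone
begin

lemma reg_\<chi>: "u \<in> S \<Longrightarrow> reg (\<lambda>x. \<chi> u (g x))"
  by (intro reg_polyfun_g \<chi>_polyfun)

definition mon :: "('b \<Rightarrow>\<^sub>0 int) \<Rightarrow> (('v \<Rightarrow> 'k) \<Rightarrow> 'k) set" where
  "mon u = ger (\<lambda>x. \<chi> u (g x))"

lemma mon_add: "u \<in> S \<Longrightarrow> v \<in> S \<Longrightarrow> mon (u + v) = mon u \<otimes>\<^bsub>\<O>\<^esub> mon v"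
  unfolding mon_def O_mult germ_eq_iff using near_g_W by (rule eventually_mono) (simp add: \<chi>_add)

lemma mon_0: "mon 0 = \<one>\<^bsub>\<O>\<^esub>"
  unfolding mon_def O_one germ_eq_iff using near_g_W by (rule eventually_mono) (simp add: \<chi>_0)

lemma mon_carrier: "u \<in> S \<Longrightarrow> mon u \<in> carrier \<O>"
  unfolding mon_def by (intro germ_carrier reg_\<chi>)

text \<open>Each use of \<open>S_decompose\<close> splits off one coordinate, whose germ vanishes at
  \<open>P\<close>.\<close>

lemma mon_pw: "u \<in> S \<Longrightarrow> mon u \<in> F.pw (deg u)"
proof (induction "deg u" arbitrary: u)
  case 0
  then show ?case using mon_carrier by simp
next
  case (Suc k)
  then obtain v u' where v: "v \<in> V" "u' \<in> S" "deg u' = k" "u = e v + u'" using S_decompose by metis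
  have "\<chi> (e v) (g P) = 0" using \<chi>_e[OF v(1) W_origin] g_P by simp
  then have "mon (e v) \<in> \<mm>" unfolding mon_def using in_\<mm> reg_\<chi> e_S v(1) by blast
  moreover have "mon u' \<in> F.pw k" using Suc(1)[of u'] v by simp
  ultimately show ?case
    using v e_S deg_e deg_add[of "e v" u'] by (simp add: mon_add ideal_pow.simps(2) ideal_prod.prod)
qed

lemma line_cong:
  assumes "ger f = ger f'" "w \<in> W" "line_order k (\<lambda>t. f (\<phi> (scale t w)))"
  shows "line_order k (\<lambda>t. f' (\<phi> (scale t w)))"
proof -
  have "near (\<lambda>x. f x = f' x)" using assms(1) by (simp add: germ_eq_iff)
  then obtain c where "poly c 0 \<noteq> 0" "\<And>t. poly c t \<noteq> 0 \<Longrightarrow> f (\<phi> (scale t w)) = f' (\<phi> (scale t w))"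
    by (rule eventually_znhds_line[OF near_compose_\<phi> W_scale[OF assms(2)]]) (rule that)
  then show ?thesis by (rule line_order_cong[OF assms(3)])
qed

text \<open>A germ in the maximal ideal vanishes at the origin of every line in the cone, so each
  factor from it raises the order by one; sums keep the order.\<close>

lemma line_order_pw:
  assumes "ger f \<in> F.pw k" "reg f" "w \<in> W"
  shows "line_order k (\<lambda>t. f (\<phi> (scale t w)))"
proof -
  \<comment> \<open>All representatives of a germ are treated at once, since the inductive
    generation of the ideal product provides only germs.\<close>
  have "A \<in> carrier \<O> \<and> (\<forall>f. reg f \<longrightarrow> A = ger f \<longrightarrow> line_order k (\<lambda>t. f (\<phi> (scale t w))))" if "A \<in> F.pw k" for A
    using that
  proof (induction k arbitrary: A)
    case 0
    then show ?case using line_order_regular(1)[OF reg_compose_\<phi> W_scale[OF assms(3)]] by auto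
  next
    case (Suc k)
    from Suc.prems have "A \<in> ideal_prod \<O> \<mm> (F.pw k)" by (simp add: ideal_pow.simps(2))
    then show ?case
    proof induction
      case (prod i j)
      obtain f1 where f1: "reg f1" "f1 P = 0" "i = ger f1" using prod(1) by (rule \<mm>E)
      obtain f2 where f2: "reg f2" "j = ger f2" using Suc.IH[OF prod(2)] O_carrierE by blast
      have "line_order 1 (\<lambda>t. f1 (\<phi> (scale t w)))"
        using line_order_regular(2)[OF reg_compose_\<phi>[OF f1(1)] W_scale[OF assms(3)]] \<phi>_0 f1(2) by simp
      moreover have "line_order k (\<lambda>t. f2 (\<phi> (scale t w)))" using Suc.IH[OF prod(2)] f2 by blast
      ultimately have lo: "line_order (Suc k) (\<lambda>t. f1 (\<phi> (scale t w)) * f2 (\<phi> (scale t w)))"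
        using line_order_mult[of 1 _ k] by simp
      have eq: "i \<otimes>\<^bsub>\<O>\<^esub> j = ger (\<lambda>x. f1 x * f2 x)" unfolding f1(3) f2(2) O_mult ..
      have "line_order (Suc k) (\<lambda>t. f (\<phi> (scale t w)))" if "i \<otimes>\<^bsub>\<O>\<^esub> j = ger f" for f
        using line_cong[of "\<lambda>x. f1 x * f2 x" f w] that eq lo assms(3) by simp
      moreover have "ger (\<lambda>x. f1 x * f2 x) \<in> carrier \<O>"
        using f1 f2 by (intro germ_carrier regular_at_mult)
      ultimately show ?case using eq by auto
    next
      case (sum i j)
      obtain f1 where f1: "reg f1" "i = ger f1" using sum O_carrierE by blast
      obtain f2 where f2: "reg f2" "j = ger f2" using sum O_carrierE by blast
      have lo: "line_order (Suc k) (\<lambda>t. f1 (\<phi> (scale t w)) + f2 (\<phi> (scale t w)))"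
        using sum f1 f2 by (intro line_order_add) blast+
      have eq: "i \<oplus>\<^bsub>\<O>\<^esub> j = ger (\<lambda>x. f1 x + f2 x)" unfolding f1(2) f2(2) O_add ..
      have "line_order (Suc k) (\<lambda>t. f (\<phi> (scale t w)))" if "i \<oplus>\<^bsub>\<O>\<^esub> j = ger f" for f
        using line_cong[of "\<lambda>x. f1 x + f2 x" f w] that eq lo assms(3) by simp
      moreover have "ger (\<lambda>x. f1 x + f2 x) \<in> carrier \<O>"
        using f1 f2 by (intro germ_carrier regular_at_add)
      ultimately show ?case using eq by auto
    qed
  qed
  then show ?thesis using assms by blast
qed

lemma smult_mon_sum:
  assumes "finite T" "T \<subseteq> S"
  shows "(\<Oplus>\<^bsub>\<O>\<^esub>u\<in>T. c u \<odot>\<^bsub>\<O>\<^esub> mon u) = ger (\<lambda>x. \<Sum>u\<in>T. c u * \<chi> u (g x))"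
proof -
  have "(\<Oplus>\<^bsub>\<O>\<^esub>u\<in>T. c u \<odot>\<^bsub>\<O>\<^esub> mon u) = (\<Oplus>\<^bsub>\<O>\<^esub>u\<in>T. ger (\<lambda>x. c u * \<chi> u (g x)))"
    by (simp add: mon_def O_smult)
  also have "\<dots> = ger (\<lambda>x. \<Sum>u\<in>T. c u * \<chi> u (g x))"
    using assms by (intro O_finsum regular_at_mult regular_at_const P_in reg_\<chi>) auto
  finally show ?thesis .
qed

lemma line_order_polyfun:
  assumes "ger (\<lambda>x. f (g x)) \<in> F.pw k" "f \<in> polyfun" "w \<in> W"
  shows "line_order k (\<lambda>t. f (scale t w))"
proof -
  have lo: "line_order k (\<lambda>t. f (g (\<phi> (scale t w))))"
    using line_order_pw[OF assms(1) reg_polyfun_g[OF assms(2)] assms(3)] .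
  obtain c where "poly c 0 \<noteq> 0" "\<And>t. poly c t \<noteq> 0 \<Longrightarrow> \<phi> (scale t w) \<in> X \<and> g (\<phi> (scale t w)) = scale t w"
    by (rule eventually_znhds_line[OF near_\<phi> W_scale[OF assms(3)]]) (rule that)
  then show ?thesis by (intro line_order_cong[OF lo]) auto
qed

text \<open>Along the line through \<open>w\<close>, the sum is a polynomial in \<open>t\<close>
  whose coefficients are its homogeneous parts evaluated at \<open>w\<close>. Those below degree
  \<open>k\<close> vanish for every \<open>w\<close>, and then independence on the cone
  applies.\<close>

lemma mon_sum_low_degree:
  assumes T: "finite T" "T \<subseteq> S" and pw: "ger (\<lambda>x. \<Sum>u\<in>T. c u * \<chi> u (g x)) \<in> F.pw k"
    and u: "u \<in> T" "deg u < k"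
  shows "c u = 0"
proof (rule \<chi>_indep[of "{v \<in> T. deg v = deg u}"])
  fix w assume w: "w \<in> W"
  let ?f = "\<lambda>w. \<Sum>u\<in>T. c u * \<chi> u w"
  let ?p = "\<Sum>v\<in>T. Polynomial.monom (c v * \<chi> v w) (deg v)"
  have "?f \<in> polyfun" using T by (auto intro!: polyfun_sum polyfun.mult polyfun.const \<chi>_polyfun)
  from line_order_polyfun[OF pw this w] have "line_order k (\<lambda>t. ?f (scale t w))" .
  moreover have "(\<lambda>t. ?f (scale t w)) = poly ?p"
    using T w by (intro ext) (auto simp: poly_sum poly_monom \<chi>_scale subset_eq intro!: sum.cong)
  ultimately have "Polynomial.coeff ?p (deg u) = 0" using line_order_poly_coeff[of k ?p] u(2) by simp
  moreover have "Polynomial.coeff ?p (deg u) = (\<Sum>v\<in>T. if deg v = deg u then c v * \<chi> v w else 0)"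
    by (simp add: coeff_sum)
  ultimately show "(\<Sum>v\<in>{v \<in> T. deg v = deg u}. c v * \<chi> v w) = 0"
    using T(1) by (simp add: sum.If_cases Int_def)
qed (use T u in auto)

lemma mon_sum_pw:
  assumes "finite T" "T \<subseteq> S" "\<And>u. u \<in> T \<Longrightarrow> k \<le> deg u"
  shows "ger (\<lambda>x. \<Sum>u\<in>T. c u * \<chi> u (g x)) \<in> F.pw k"
proof -
  have "(\<Oplus>\<^bsub>\<O>\<^esub>u\<in>T. c u \<odot>\<^bsub>\<O>\<^esub> mon u) \<in> F.pw k"
  proof (rule F.finsum_in_ideal[OF F.ideal_pw assms(1)])
    have "mon u \<in> F.pw k" if "u \<in> T" for u
      using mon_pw[of u] F.pw_antimono[OF assms(3)[OF that]] assms(2) that by blast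
    then show "(\<lambda>u. c u \<odot>\<^bsub>\<O>\<^esub> mon u) \<in> T \<rightarrow> F.pw k" using F.pw_smult by blast
  qed
  then show ?thesis using smult_mon_sum[OF assms(1,2)] by simp
qed

text \<open>Write \<open>f = a / b\<close> in chart coordinates. The expansion of \<open>a\<close>
  starts in degree \<open>k\<close> or later, and its part of degree \<open>k\<close>, divided by
  the value of \<open>b\<close> at the origin, is the required combination.\<close>

lemma mon_span:
  assumes A: "A \<in> F.pw k"
  shows "\<exists>T c. finite T \<and> T \<subseteq> {u \<in> S. deg u = k} \<and> A \<ominus>\<^bsub>\<O>\<^esub> (\<Oplus>\<^bsub>\<O>\<^esub>u\<in>T. c u \<odot>\<^bsub>\<O>\<^esub> mon u) \<in> F.pw (Suc k)"
proof -
  obtain f where f: "reg f" "A = ger f" using F.pw_carr[OF A] by (rule O_carrierE)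
  obtain a b where ab: "a \<in> polyfun" "b \<in> polyfun" "b (\<lambda>_. 0) \<noteq> 0" "near (\<lambda>x. b (g x) \<noteq> 0 \<and> f x = a (g x) / b (g x))"
    using reg_fraction[OF f(1)] by blast
  obtain p where p: "Poly_Mapping.keys p \<subseteq> S" "\<forall>w\<in>W. a w = ev p w" using polyfun_eq_ev[OF ab(1)] by blast
  let ?K = "Poly_Mapping.keys p" and ?l = "Poly_Mapping.lookup p"
  let ?b = "\<lambda>x. b (g x)" and ?\<beta> = "b (\<lambda>_. 0)"
  have rb: "reg ?b" using reg_polyfun_g[OF ab(2)] .
  have "ger (\<lambda>x. ?b x * f x) \<in> F.pw k"
    using ideal.I_l_closed[OF F.ideal_pw A, of "ger ?b"] rb f by (simp add: O_mult)
  moreover have n1: "near (\<lambda>x. ?b x * f x = (\<Sum>u\<in>?K. ?l u * \<chi> u (g x)))"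
    using ab(4) near_g_W by eventually_elim (use p in \<open>simp add: ev_def\<close>)
  ultimately have "ger (\<lambda>x. \<Sum>u\<in>?K. ?l u * \<chi> u (g x)) \<in> F.pw k" unfolding germ_eq_iff[symmetric] by simp
  then have low: "deg u \<ge> k" if "u \<in> ?K" for u
    using mon_sum_low_degree[of ?K ?l k u] that p(1) by (force simp: in_keys_iff not_less[symmetric])
  define T where "T = {u \<in> ?K. deg u = k}"
  define c where "c u = ?l u / ?\<beta>" for u
  have T: "finite T" "T \<subseteq> {u \<in> S. deg u = k}" "T \<subseteq> S" using p(1) unfolding T_def by auto
  have r1: "reg (\<lambda>x. \<Sum>u\<in>T. c u * \<chi> u (g x))"
    using T by (intro regular_at_sum[OF P_in] regular_at_mult regular_at_const[OF P_in] reg_\<chi>) auto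
  \<comment> \<open>\<open>h1\<close> collects the terms of higher degree. \<open>h2\<close> is the
    cost of replacing the denominator by its value at the origin: an element of the maximal ideal
    times \<open>f\<close>.\<close>
  define h1 where "h1 x = (\<Sum>u\<in>?K - T. ?l u * \<chi> u (g x))" for x
  define h2 where "h2 x = (?\<beta> - ?b x) * f x" for x
  have "ger h1 \<in> F.pw (Suc k)"
    unfolding h1_def
  proof (rule mon_sum_pw)
    fix u assume "u \<in> ?K - T"
    then have "u \<in> ?K" "deg u \<noteq> k" unfolding T_def by auto
    then show "Suc k \<le> deg u" using low[of u] by simp
  qed (use p(1) in auto)
  moreover have "ger h2 \<in> F.pw (Suc k)"
  proof -
    have rr: "reg (\<lambda>x. ?\<beta> - ?b x)" using rb by (intro regular_at_diff regular_at_const P_in)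
    then have "ger (\<lambda>x. ?\<beta> - ?b x) \<in> \<mm>" using in_\<mm> g_P by simp
    then have "ger (\<lambda>x. ?\<beta> - ?b x) \<otimes>\<^bsub>\<O>\<^esub> A \<in> F.pw (Suc k)"
      using A by (simp add: ideal_pow.simps(2) ideal_prod.prod)
    then show ?thesis unfolding f(2) O_mult h2_def .
  qed
  ultimately have "inverse ?\<beta> \<odot>\<^bsub>\<O>\<^esub> (ger h1 \<oplus>\<^bsub>\<O>\<^esub> ger h2) \<in> F.pw (Suc k)" by (intro F.pw_smult F.pw_add)
  then have "ger (\<lambda>x. inverse ?\<beta> * (h1 x + h2 x)) \<in> F.pw (Suc k)" by (simp add: O_add O_smult)
  moreover have "near (\<lambda>x. inverse ?\<beta> * (h1 x + h2 x) = f x - (\<Sum>u\<in>T. c u * \<chi> u (g x)))"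
    using n1
  proof eventually_elim
    case (elim x)
    have "(\<Sum>u\<in>?K. ?l u * \<chi> u (g x)) = h1 x + (\<Sum>u\<in>T. ?l u * \<chi> u (g x))"
      unfolding h1_def by (subst sum.subset_diff[of T]) (auto simp: T_def)
    also have "(\<Sum>u\<in>T. ?l u * \<chi> u (g x)) = ?\<beta> * (\<Sum>u\<in>T. c u * \<chi> u (g x))"
      unfolding c_def using ab(3) by (simp add: sum_distrib_left)
    finally have "h1 x + h2 x = ?\<beta> * (f x - (\<Sum>u\<in>T. c u * \<chi> u (g x)))"
      using elim unfolding h2_def by (simp add: algebra_simps)
    then show ?case using ab(3) by simp
  qed
  ultimately have "ger (\<lambda>x. f x - (\<Sum>u\<in>T. c u * \<chi> u (g x))) \<in> F.pw (Suc k)" unfolding germ_eq_iff[symmetric] by simp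
  then have "A \<ominus>\<^bsub>\<O>\<^esub> (\<Oplus>\<^bsub>\<O>\<^esub>u\<in>T. c u \<odot>\<^bsub>\<O>\<^esub> mon u) \<in> F.pw (Suc k)"
    using f r1 smult_mon_sum[OF T(1,3)] by (simp add: O_minus)
  then show ?thesis using T(1,2) by blast
qed

end

sublocale chart_on_cone \<subseteq> G: graded_basis "local_ring X P" "local_max_ideal X P" S deg mon
proof unfold_locales
  fix T k c u
  assume T: "finite T" "T \<subseteq> {u \<in> S. deg u = k}" and pw: "(\<Oplus>\<^bsub>\<O>\<^esub>u\<in>T. c u \<odot>\<^bsub>\<O>\<^esub> mon u) \<in> F.pw (Suc k)" and u: "u \<in> T"
  have "T \<subseteq> S" using T by blast
  then show "c u = 0"
    using mon_sum_low_degree[of T c "Suc k" u] pw smult_mon_sum[of T c] T u by auto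
qed (use S_zero S_add deg_add deg_eq_0D mon_pw mon_add mon_0 mon_span in auto)

context chart_on_cone
begin

lemma germ_ev_hom:
  "(\<lambda>p. ger (\<lambda>x. ev p (g x))) \<in> ring_hom (semigroup_algebra S :: ('k, _) module) \<O>"
proof (rule ring_hom_memI)
  let ?A = "semigroup_algebra S :: ('k, ('b \<Rightarrow>\<^sub>0 int) \<Rightarrow>\<^sub>0 'k) module"
  fix p q assume "p \<in> carrier ?A" "q \<in> carrier ?A"
  then have k: "Poly_Mapping.keys p \<subseteq> S" "Poly_Mapping.keys q \<subseteq> S" by (auto simp: semigroup_algebra_def)
  show "ger (\<lambda>x. ev p (g x)) \<in> carrier \<O>" using k by (intro germ_carrier reg_polyfun_g ev_polyfun)
  show "ger (\<lambda>x. ev (p \<otimes>\<^bsub>?A\<^esub> q) (g x)) = ger (\<lambda>x. ev p (g x)) \<otimes>\<^bsub>\<O>\<^esub> ger (\<lambda>x. ev q (g x))"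
    unfolding O_mult germ_eq_iff using near_g_W k
    by (auto simp: semigroup_algebra_def ev_mult elim: eventually_mono)
  show "ger (\<lambda>x. ev (p \<oplus>\<^bsub>?A\<^esub> q) (g x)) = ger (\<lambda>x. ev p (g x)) \<oplus>\<^bsub>\<O>\<^esub> ger (\<lambda>x. ev q (g x))"
    unfolding O_add by (simp add: semigroup_algebra_def ev_add)
next
  let ?A = "semigroup_algebra S :: ('k, ('b \<Rightarrow>\<^sub>0 int) \<Rightarrow>\<^sub>0 'k) module"
  show "ger (\<lambda>x. ev \<one>\<^bsub>?A\<^esub> (g x)) = \<one>\<^bsub>\<O>\<^esub>"
    unfolding O_one germ_eq_iff using near_g_W
    by (auto simp: semigroup_algebra_def ev_1 elim: eventually_mono)
qed

text \<open>Denominators are units at \<open>P\<close>; this is the covering hypothesis of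
  \<open>krull_dim_le\<close>.\<close>

lemma germ_ev_cover:
  assumes "a \<in> carrier \<O>"
  shows "\<exists>s\<in>Units \<O>. \<exists>p :: ('b \<Rightarrow>\<^sub>0 int) \<Rightarrow>\<^sub>0 'k. Poly_Mapping.keys p \<subseteq> S \<and> a = s \<otimes>\<^bsub>\<O>\<^esub> ger (\<lambda>x. ev p (g x))"
proof -
  obtain f where f: "reg f" "a = ger f" using assms by (rule O_carrierE)
  obtain c b where cb: "c \<in> polyfun" "b \<in> polyfun" "b (\<lambda>_. 0) \<noteq> 0" "near (\<lambda>x. b (g x) \<noteq> 0 \<and> f x = c (g x) / b (g x))"
    using reg_fraction[OF f(1)] by blast
  obtain p where p: "Poly_Mapping.keys p \<subseteq> S" "\<forall>w\<in>W. c w = ev p w" using polyfun_eq_ev[OF cb(1)] by blast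
  have "b (g P) \<noteq> 0" using cb(3) g_P by simp
  note rb = regular_at_inverse[OF reg_polyfun_g[OF cb(2)] this]
  have "near (\<lambda>x. f x = inverse (b (g x)) * ev p (g x))"
    using cb(4) near_g_W by eventually_elim (use p in \<open>simp add: field_simps\<close>)
  then have "a = ger (\<lambda>x. inverse (b (g x))) \<otimes>\<^bsub>\<O>\<^esub> ger (\<lambda>x. ev p (g x))"
    unfolding f(2) O_mult germ_eq_iff .
  moreover have "ger (\<lambda>x. inverse (b (g x))) \<in> Units \<O>"
    using unit_germ[OF rb] \<open>b (g P) \<noteq> 0\<close> by simp
  ultimately show ?thesis using p(1) by blast
qed

end

section \<open>Isomorphisms of algebras\<close>

lemma alg_isomorphic_trans: "alg_isomorphic A B \<Longrightarrow> alg_isomorphic B C \<Longrightarrow> alg_isomorphic A C"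
proof -
  assume "alg_isomorphic A B" "alg_isomorphic B C"
  then obtain f g where f: "f \<in> ring_iso A B" "\<forall>c. \<forall>a\<in>carrier A. f (c \<odot>\<^bsub>A\<^esub> a) = c \<odot>\<^bsub>B\<^esub> f a"
    and g: "g \<in> ring_iso B C" "\<forall>c. \<forall>b\<in>carrier B. g (c \<odot>\<^bsub>B\<^esub> b) = c \<odot>\<^bsub>C\<^esub> g b"
    unfolding alg_isomorphic_def by blast
  have "g \<circ> f \<in> ring_iso A C" using f(1) g(1) by (rule ring_iso_set_trans)
  moreover have "(g \<circ> f) (c \<odot>\<^bsub>A\<^esub> a) = c \<odot>\<^bsub>C\<^esub> (g \<circ> f) a" if "a \<in> carrier A" for c a
    using f g that ring_iso_memE(1)[OF f(1) that] by simp
  ultimately show ?thesis unfolding alg_isomorphic_def by blast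
qed

lemma alg_isomorphic_sym:
  assumes A: "ring A" and smult: "\<And>c a. a \<in> carrier A \<Longrightarrow> c \<odot>\<^bsub>A\<^esub> a \<in> carrier A" and iso: "alg_isomorphic A B"
  shows "alg_isomorphic B A"
proof -
  obtain f where f: "f \<in> ring_iso A B" "\<And>c a. a \<in> carrier A \<Longrightarrow> f (c \<odot>\<^bsub>A\<^esub> a) = c \<odot>\<^bsub>B\<^esub> f a"
    using iso unfolding alg_isomorphic_def by blast
  let ?g = "inv_into (carrier A) f"
  have bij: "bij_betw f (carrier A) (carrier B)" using f(1) unfolding ring_iso_def by blast
  have g: "?g \<in> ring_iso B A" using ring_iso_set_sym[OF A f(1)] .
  have "?g (c \<odot>\<^bsub>B\<^esub> b) = c \<odot>\<^bsub>A\<^esub> ?g b" if b: "b \<in> carrier B" for c b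
  proof -
    have a: "?g b \<in> carrier A" "f (?g b) = b"
      using b bij by (auto simp: bij_betw_def inv_into_into f_inv_into_f)
    then have "?g (f (c \<odot>\<^bsub>A\<^esub> ?g b)) = c \<odot>\<^bsub>A\<^esub> ?g b"
      using smult bij by (intro inv_into_f_f) (auto simp: bij_betw_def)
    then show ?thesis using f(2)[OF a(1)] a(2) by simp
  qed
  then show ?thesis unfolding alg_isomorphic_def using g by blast
qed

lemma semigroup_algebra_smult_closed:
  assumes "0 \<in> S" "\<And>u v. u \<in> S \<Longrightarrow> v \<in> S \<Longrightarrow> u + v \<in> S" "a \<in> carrier (semigroup_algebra S)"
  shows "c \<odot>\<^bsub>semigroup_algebra S\<^esub> a \<in> carrier (semigroup_algebra S)"
proof -
  have "Poly_Mapping.keys (Poly_Mapping.single 0 c * a) \<subseteq> S"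
    using keys_mult[of "Poly_Mapping.single 0 c" a] assms by (fastforce simp: semigroup_algebra_def split: if_splits)
  then show ?thesis by (simp add: semigroup_algebra_def)
qed

section \<open>Independence of monomials\<close>

text \<open>Dedekind's argument for the independence of characters.\<close>

lemma multiplicative_functions_independent:
  fixes h :: "'u \<Rightarrow> 'x \<Rightarrow> 'k::field" and m :: "'x \<Rightarrow> 'x \<Rightarrow> 'x"
  assumes "finite T" "\<And>u x y. u \<in> T \<Longrightarrow> h u (m x y) = h u x * h u y" "\<And>u. u \<in> T \<Longrightarrow> \<exists>x. h u x \<noteq> 0"
    "\<And>u v. u \<in> T \<Longrightarrow> v \<in> T \<Longrightarrow> u \<noteq> v \<Longrightarrow> \<exists>x. h u x \<noteq> h v x"
    "\<And>x. (\<Sum>u\<in>T. c u * h u x) = 0" "u \<in> T"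
  shows "c u = 0"
  using assms
proof (induction T arbitrary: c u rule: finite_induct)
  case (insert v T)
  have rel: "c v * h v x + (\<Sum>u\<in>T. c u * h u x) = 0" for x using insert.prems(4)[of x] insert.hyps by simp
  \<comment> \<open>Subtracting \<open>h v y\<close> times the relation at \<open>x\<close> from the
    relation at \<open>m x y\<close> eliminates \<open>v\<close>.\<close>
  have "(\<Sum>u\<in>T. (c u * (h u y - h v y)) * h u x) = 0" for x y
  proof -
    have "(\<Sum>u\<in>T. c u * h u (m x y)) = (\<Sum>u\<in>T. c u * (h u x * h u y))" using insert.prems(1) by simp
    then have "c v * (h v x * h v y) + (\<Sum>u\<in>T. c u * (h u x * h u y)) = 0" using rel[of "m x y"] insert.prems(1) by simp
    moreover have "h v y * (c v * h v x) + h v y * (\<Sum>u\<in>T. c u * h u x) = 0" using rel[of x] by (metis distrib_left mult_zero_right)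
    moreover have "(\<Sum>u\<in>T. (c u * (h u y - h v y)) * h u x) = (\<Sum>u\<in>T. c u * (h u x * h u y)) - h v y * (\<Sum>u\<in>T. c u * h u x)"
      by (simp add: sum_distrib_left algebra_simps flip: sum_subtractf)
    ultimately show ?thesis by (simp add: algebra_simps eq_neg_iff_add_eq_0[symmetric])
  qed
  from insert.IH[OF _ _ _ this] insert.prems have z: "c u * (h u y - h v y) = 0" if "u \<in> T" for u y using that by simp
  have cT: "c u = 0" if "u \<in> T" for u
  proof -
    have "u \<noteq> v" using that insert.hyps(2) by blast
    moreover have "u \<in> insert v T" "v \<in> insert v T" using that by auto
    ultimately obtain y where "h u y \<noteq> h v y" using insert.prems(3) by metis
    then show ?thesis using z[OF that, of y] by simp
  qed
  obtain x where "h v x \<noteq> 0" using insert.prems(2) by blast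
  moreover have "c v * h v x = 0" using rel[of x] cT by simp
  ultimately have "c v = 0" by simp
  then show ?case using cT insert.prems(5) by blast
qed simp

lemma ex_power_neq:
  assumes "a \<noteq> b" shows "\<exists>z::'k::alg_closed_field. z ^ a \<noteq> z ^ b"
proof (rule ccontr)
  assume "\<not> ?thesis"
  then have "Polynomial.monom (1 :: 'k) a = Polynomial.monom 1 b"
    by (intro poly_eqI_infinite) (simp add: poly_monom)
  then show False using assms by (metis degree_monom_eq one_neq_zero)
qed

text \<open>Monomials are multiplicative for the coordinatewise product. Two with different
  exponents at \<open>i\<close> are separated by a point whose other coordinates are all 1, the
  field being infinite.\<close>

lemma monomials_independent:
  fixes f :: "'u \<Rightarrow> nat \<Rightarrow> nat" and c :: "'u \<Rightarrow> 'k::alg_closed_field"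
  assumes T: "finite T" and inj: "\<And>u v. u \<in> T \<Longrightarrow> v \<in> T \<Longrightarrow> (\<And>i. i < n \<Longrightarrow> f u i = f v i) \<Longrightarrow> u = v"
    and zero: "\<And>x. (\<Sum>u\<in>T. c u * (\<Prod>i<n. x i ^ f u i)) = 0" and u: "u \<in> T"
  shows "c u = 0"
proof (rule multiplicative_functions_independent[where h = "\<lambda>u x. \<Prod>i<n. x i ^ f u i" and m = "\<lambda>x y i. x i * y i", OF T])
  show "\<exists>x :: nat \<Rightarrow> 'k. (\<Prod>i<n. x i ^ f u i) \<noteq> 0" for u by (intro exI[of _ "\<lambda>_. 1"]) simp
  fix u v assume uv: "u \<in> T" "v \<in> T" "u \<noteq> v"
  then obtain i where i: "i < n" "f u i \<noteq> f v i" using inj by blast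
  then obtain z :: 'k where z: "z ^ f u i \<noteq> z ^ f v i" using ex_power_neq by blast
  have "(\<Prod>k<n. (if k = i then z else 1) ^ f w k) = z ^ f w i" for w
  proof -
    have "(\<Prod>k<n. (if k = i then z else 1) ^ f w k) = (\<Prod>k<n. if k = i then z ^ f w k else 1)"
      by (rule prod.cong) auto
    also have "\<dots> = z ^ f w i" using i by simp
    finally show ?thesis .
  qed
  then show "\<exists>x :: nat \<Rightarrow> 'k. (\<Prod>i<n. x i ^ f u i) \<noteq> (\<Prod>i<n. x i ^ f v i)"
    using z by (intro exI[of _ "\<lambda>k. if k = i then z else 1"]) simp
qed (simp_all add: power_mult_distrib prod.distrib zero u)

section \<open>Chains of primes from parametrized closed subsets\<close>

text \<open>On the line joining a point where \<open>a\<close> is nonzero to one where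
  \<open>b\<close> is nonzero, the restrictions would be nonzero polynomials with product
  zero.\<close>

lemma polyfun_zero_divisors:
  fixes a b :: "('x \<Rightarrow> 'k::alg_closed_field) \<Rightarrow> 'k"
  assumes "a \<in> polyfun" "b \<in> polyfun" "\<And>z. a z * b z = 0"
  shows "(\<forall>z. a z = 0) \<or> (\<forall>z. b z = 0)"
proof (rule ccontr)
  assume "\<not> ?thesis"
  then obtain x y where xy: "a x \<noteq> 0" "b y \<noteq> 0" by blast
  obtain p where p: "\<And>t. a (\<lambda>v. x v + t * (y v - x v)) = poly p t" using polyfun_line[OF assms(1), of x "\<lambda>v. y v - x v"] by blast
  obtain q where q: "\<And>t. b (\<lambda>v. x v + t * (y v - x v)) = poly q t" using polyfun_line[OF assms(2), of x "\<lambda>v. y v - x v"] by blast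
  have "poly p 0 \<noteq> 0" "poly q 1 \<noteq> 0" using p[of 0] q[of 1] xy by simp_all
  moreover have "p * q = 0"
    by (rule poly_eqI_infinite) (simp add: assms(3) flip: p q)
  ultimately show False by auto
qed

lemma cring_coord_ring: "cring (coord_ring X)"
proof -
  have c: "restrict f X \<in> carrier (coord_ring X)" if "f \<in> polyfun" for f using that by (simp add: coord_ring_def)
  have E: "\<exists>f\<in>polyfun. a = restrict f X" if "a \<in> carrier (coord_ring X)" for a using that by (auto simp: coord_ring_def)
  have add: "restrict f X \<oplus>\<^bsub>coord_ring X\<^esub> restrict g X = restrict (\<lambda>x. f x + g x) X"
    and mult: "restrict f X \<otimes>\<^bsub>coord_ring X\<^esub> restrict g X = restrict (\<lambda>x. f x * g x) X" for f g
    by (auto simp: coord_ring_def restrict_def)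
  have zero: "\<zero>\<^bsub>coord_ring X\<^esub> = restrict (\<lambda>x. 0) X" and one: "\<one>\<^bsub>coord_ring X\<^esub> = restrict (\<lambda>x. 1) X"
    by (auto simp: coord_ring_def)
  show ?thesis
  proof (rule cringI)
    show "abelian_group (coord_ring X)"
    proof (rule abelian_groupI)
      fix x assume "x \<in> carrier (coord_ring X)"
      then obtain f where f: "f \<in> polyfun" "x = restrict f X" using E by blast
      show "\<exists>y\<in>carrier (coord_ring X). y \<oplus>\<^bsub>coord_ring X\<^esub> x = \<zero>\<^bsub>coord_ring X\<^esub>"
        using f polyfun_uminus[OF f(1)] by (intro bexI[of _ "restrict (\<lambda>x. - f x) X"]) (auto simp: add zero intro: c)
    qed (auto dest!: E simp: add zero ac_simps intro!: c polyfun.add polyfun.const)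
    show "comm_monoid (coord_ring X)"
      by (rule comm_monoidI) (auto dest!: E simp: mult one ac_simps intro!: c polyfun.mult polyfun.const)
  qed (auto dest!: E simp: add mult distrib_right)
qed

text \<open>The functions vanishing on the image of \<open>\<Psi> i\<close> form a prime ideal,
  because composition with \<open>\<Psi> i\<close> gives polynomial functions in free variables,
  where there are no zero divisors. The images decrease by \<open>mono\<close>, and
  \<open>sep\<close> names a coordinate that distinguishes consecutive ones.\<close>

lemma krull_dim_coord_ring_ge:
  fixes W :: "('w \<Rightarrow> 'k::alg_closed_field) set" and \<Psi> :: "nat \<Rightarrow> ('x \<Rightarrow> 'k) \<Rightarrow> 'w \<Rightarrow> 'k"
  assumes \<Psi>: "\<And>i v. (\<lambda>z. \<Psi> i z v) \<in> polyfun" "\<And>i z. \<Psi> i z \<in> W"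
    and mono: "\<And>i z. i < n \<Longrightarrow> \<exists>z'. \<Psi> (Suc i) z = \<Psi> i z'"
    and sep: "\<And>i. i < n \<Longrightarrow> \<exists>v. (\<forall>z. \<Psi> (Suc i) z v = 0) \<and> (\<exists>z. \<Psi> i z v \<noteq> 0)"
  shows "enat n \<le> krull_dim (coord_ring W)"
proof -
  let ?R = "coord_ring W"
  interpret R: cring ?R by (rule cring_coord_ring)
  define p where "p i = {restrict f W | f. f \<in> polyfun \<and> (\<forall>z. f (\<Psi> i z) = 0)}" for i
  have p_iff: "restrict f W \<in> p i \<longleftrightarrow> (\<forall>z. f (\<Psi> i z) = 0)" if "f \<in> polyfun" for f i
  proof
    assume "restrict f W \<in> p i"
    then obtain f' where "restrict f W = restrict f' W" "\<forall>z. f' (\<Psi> i z) = 0" unfolding p_def by blast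
    then show "\<forall>z. f (\<Psi> i z) = 0" using \<Psi>(2) by (metis restrict_apply')
  qed (use that in \<open>auto simp: p_def\<close>)
  have E: "\<exists>f\<in>polyfun. a = restrict f W" if "a \<in> carrier ?R" for a using that by (auto simp: coord_ring_def)
  have add: "restrict f W \<oplus>\<^bsub>?R\<^esub> restrict g W = restrict (\<lambda>x. f x + g x) W"
    and mult: "restrict f W \<otimes>\<^bsub>?R\<^esub> restrict g W = restrict (\<lambda>x. f x * g x) W" for f g
    by (auto simp: coord_ring_def restrict_def)
  have pE: "\<exists>f\<in>polyfun. a = restrict f W \<and> (\<forall>z. f (\<Psi> i z) = 0)" if "a \<in> p i" for a i
    using that unfolding p_def by blast
  have comp: "(\<lambda>z. f (\<Psi> i z)) \<in> polyfun" if "f \<in> polyfun" for f i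
    using that \<Psi>(1) by (rule polyfun_compose)
  have prime: "primeideal (p i) ?R" for i
  proof (rule primeidealI)
    show "ideal (p i) ?R"
    proof (rule idealI)
      show "ring ?R" by (rule R.ring_axioms)
      show "subgroup (p i) (add_monoid ?R)"
      proof (rule R.add.subgroupI)
        show "p i \<subseteq> carrier ?R" unfolding p_def by (auto simp: coord_ring_def)
        have "restrict (\<lambda>x. 0) W \<in> p i" unfolding p_iff[OF polyfun.const] by simp
        then show "p i \<noteq> {}" by blast
        fix a assume "a \<in> p i"
        then obtain f where f: "f \<in> polyfun" "a = restrict f W" "\<forall>z. f (\<Psi> i z) = 0" using pE by blast
        have "restrict (\<lambda>x. - f x) W \<oplus>\<^bsub>?R\<^esub> a = \<zero>\<^bsub>?R\<^esub>" unfolding f(2) add by (simp add: coord_ring_def)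
        then have "\<ominus>\<^bsub>?R\<^esub> a = restrict (\<lambda>x. - f x) W"
          using polyfun_uminus[OF f(1)] f by (intro R.minus_equality) (auto simp: coord_ring_def)
        then show "\<ominus>\<^bsub>?R\<^esub> a \<in> p i" using p_iff[OF polyfun_uminus[OF f(1)]] f(3) by simp
        fix b assume "b \<in> p i"
        then obtain g where g: "g \<in> polyfun" "b = restrict g W" "\<forall>z. g (\<Psi> i z) = 0" using pE by blast
        show "a \<oplus>\<^bsub>?R\<^esub> b \<in> p i" unfolding f(2) g(2) add using p_iff[OF polyfun.add[OF f(1) g(1)]] f(3) g(3) by simp
      qed
      fix a x assume "a \<in> p i" "x \<in> carrier ?R"
      then obtain f g where f: "f \<in> polyfun" "a = restrict f W" "\<forall>z. f (\<Psi> i z) = 0" and g: "g \<in> polyfun" "x = restrict g W"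
        using pE E by metis
      show "x \<otimes>\<^bsub>?R\<^esub> a \<in> p i" unfolding f(2) g(2) mult using p_iff[OF polyfun.mult[OF g(1) f(1)]] f(3) by simp
      show "a \<otimes>\<^bsub>?R\<^esub> x \<in> p i" unfolding f(2) g(2) mult using p_iff[OF polyfun.mult[OF f(1) g(1)]] f(3) by simp
    qed
    show "cring ?R" by (rule R.is_cring)
    have "\<one>\<^bsub>?R\<^esub> \<notin> p i" using p_iff[OF polyfun.const[of 1]] by (simp add: coord_ring_def)
    then show "carrier ?R \<noteq> p i" using R.one_closed by auto
    fix a b assume ab: "a \<in> carrier ?R" "b \<in> carrier ?R" "a \<otimes>\<^bsub>?R\<^esub> b \<in> p i"
    then obtain f g where f: "f \<in> polyfun" "a = restrict f W" and g: "g \<in> polyfun" "b = restrict g W" using E by metis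
    have "f (\<Psi> i z) * g (\<Psi> i z) = 0" for z
      using ab(3) unfolding f(2) g(2) mult p_iff[OF polyfun.mult[OF f(1) g(1)]] by blast
    from polyfun_zero_divisors[OF comp[OF f(1)] comp[OF g(1)] this]
    show "a \<in> p i \<or> b \<in> p i" unfolding f(2) g(2) p_iff[OF f(1)] p_iff[OF g(1)] by blast
  qed
  show ?thesis
  proof (rule krull_dim_geI[of n p, OF prime])
    fix i assume i: "i < n"
    have "p i \<subseteq> p (Suc i)"
    proof
      fix a assume "a \<in> p i"
      then obtain f where f: "f \<in> polyfun" "a = restrict f W" "\<forall>z. f (\<Psi> i z) = 0" using pE by blast
      have "f (\<Psi> (Suc i) z) = 0" for z using mono[OF i, of z] f(3) by metis
      then show "a \<in> p (Suc i)" unfolding f(2) p_iff[OF f(1)] by blast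
    qed
    moreover obtain v where "\<forall>z. \<Psi> (Suc i) z v = 0" "\<exists>z. \<Psi> i z v \<noteq> 0" using sep[OF i] by blast
    then have "restrict (\<lambda>w. w v) W \<in> p (Suc i)" "restrict (\<lambda>w. w v) W \<notin> p i"
      unfolding p_iff[OF polyfun.coord] by simp_all
    ultimately show "p i \<subset> p (Suc i)" by blast
  qed
qed

context chart_on_cone
begin

text \<open>The same kind of chain in the local ring. Every image passes through the origin, and by
  irreducibility a polynomial function that vanishes on an image near the origin vanishes on all of
  it.\<close>

lemma krull_dim_local_ring_ge:
  fixes \<Psi> :: "nat \<Rightarrow> ('x \<Rightarrow> 'k) \<Rightarrow> 'w \<Rightarrow> 'k"
  assumes \<Psi>: "\<And>i v. (\<lambda>z. \<Psi> i z v) \<in> polyfun" "\<And>i z. \<Psi> i z \<in> W" "\<And>i. \<exists>z. \<Psi> i z = (\<lambda>_. 0)"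
    and mono: "\<And>i z. i < n \<Longrightarrow> \<exists>z'. \<Psi> (Suc i) z = \<Psi> i z'"
    and sep: "\<And>i. i < n \<Longrightarrow> \<exists>v. (\<forall>z. \<Psi> (Suc i) z v = 0) \<and> (\<exists>z. \<Psi> i z v \<noteq> 0)"
  shows "enat n \<le> krull_dim \<O>"
proof -
  let ?N = "znhds W (\<lambda>_. 0)"
  define van where "van i f \<longleftrightarrow> eventually (\<lambda>w. w \<in> range (\<Psi> i) \<longrightarrow> f w = 0) ?N" for i and f :: "('w \<Rightarrow> 'k) \<Rightarrow> 'k"
  define p where "p i = {ger f | f. reg f \<and> van i (\<lambda>w. f (\<phi> w))}" for i
  have comp: "(\<lambda>z. f (\<Psi> i z)) \<in> polyfun" if "f \<in> polyfun" for f i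
    using that \<Psi>(1) by (rule polyfun_compose)
  \<comment> \<open>If \<open>u\<close> cuts out the neighbourhood, then \<open>u f\<close> vanishes
    on the whole image while \<open>u\<close> does not, so \<open>f\<close> vanishes there.\<close>
  have van_poly: "van i f \<longleftrightarrow> (\<forall>z. f (\<Psi> i z) = 0)" if f: "f \<in> polyfun" for i f
  proof
    assume "van i f"
    then obtain u where u: "u \<in> polyfun" "u (\<lambda>_. 0) \<noteq> 0" "\<forall>w\<in>W. u w \<noteq> 0 \<longrightarrow> w \<in> range (\<Psi> i) \<longrightarrow> f w = 0"
      unfolding van_def eventually_znhds by blast
    have "u (\<Psi> i z) * f (\<Psi> i z) = 0" for z using u(3) \<Psi>(2)[of i z] by (cases "u (\<Psi> i z) = 0") auto
    from polyfun_zero_divisors[OF comp[OF u(1)] comp[OF f] this] show "\<forall>z. f (\<Psi> i z) = 0"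
      using \<Psi>(3)[of i] u(2) by metis
  next
    assume "\<forall>z. f (\<Psi> i z) = 0"
    then show "van i f" unfolding van_def by (intro always_eventually) auto
  qed
  have p_iff: "ger f \<in> p i \<longleftrightarrow> van i (\<lambda>w. f (\<phi> w))" if f: "reg f" for f i
  proof
    assume "ger f \<in> p i"
    then obtain f' where f': "ger f = ger f'" "van i (\<lambda>w. f' (\<phi> w))" unfolding p_def by blast
    have "eventually (\<lambda>w. f (\<phi> w) = f' (\<phi> w)) ?N" using f'(1) near_compose_\<phi> unfolding germ_eq_iff by blast
    with f'(2) show "van i (\<lambda>w. f (\<phi> w))" unfolding van_def by eventually_elim simp
  qed (use f in \<open>auto simp: p_def\<close>)
  have pE: "\<exists>f. reg f \<and> a = ger f \<and> van i (\<lambda>w. f (\<phi> w))" if "a \<in> p i" for a i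
    using that unfolding p_def by blast
  have prime: "primeideal (p i) \<O>" for i
  proof (rule primeidealI)
    show "ideal (p i) \<O>"
    proof (rule idealI)
      show "ring \<O>" by (rule O.ring_axioms)
      show "subgroup (p i) (add_monoid \<O>)"
      proof (rule O.add.subgroupI)
        show "p i \<subseteq> carrier \<O>" unfolding p_def by auto
        have "ger (\<lambda>x. 0) \<in> p i" unfolding p_iff[OF regular_at_const[OF P_in]] by (simp add: van_def)
        then show "p i \<noteq> {}" by blast
        fix a assume "a \<in> p i"
        then obtain f where f: "reg f" "a = ger f" "van i (\<lambda>w. f (\<phi> w))" using pE by blast
        show "\<ominus>\<^bsub>\<O>\<^esub> a \<in> p i" unfolding f(2) O_uminus[OF f(1)] p_iff[OF regular_at_uminus[OF f(1)]]
          using f(3) unfolding van_def by simp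
        fix b assume "b \<in> p i"
        then obtain g' where g: "reg g'" "b = ger g'" "van i (\<lambda>w. g' (\<phi> w))" using pE by blast
        show "a \<oplus>\<^bsub>\<O>\<^esub> b \<in> p i" unfolding f(2) g(2) O_add p_iff[OF regular_at_add[OF f(1) g(1)]]
          using f(3) g(3) unfolding van_def by eventually_elim simp
      qed
      fix a x assume "a \<in> p i" "x \<in> carrier \<O>"
      then obtain f g' where f: "reg f" "a = ger f" "van i (\<lambda>w. f (\<phi> w))" and g: "reg g'" "x = ger g'"
        using pE O_carrierE by metis
      show "x \<otimes>\<^bsub>\<O>\<^esub> a \<in> p i" unfolding f(2) g(2) O_mult p_iff[OF regular_at_mult[OF g(1) f(1)]]
        using f(3) unfolding van_def by eventually_elim simp
      show "a \<otimes>\<^bsub>\<O>\<^esub> x \<in> p i" unfolding f(2) g(2) O_mult p_iff[OF regular_at_mult[OF f(1) g(1)]]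
        using f(3) unfolding van_def by eventually_elim simp
    qed
    show "cring \<O>" by (rule cring_O)
    have "\<one>\<^bsub>\<O>\<^esub> \<notin> p i"
      unfolding O_one p_iff[OF regular_at_const[OF P_in]] van_poly[OF polyfun.const] by simp
    then show "carrier \<O> \<noteq> p i" using O.one_closed by auto
    fix a b assume ab: "a \<in> carrier \<O>" "b \<in> carrier \<O>" "a \<otimes>\<^bsub>\<O>\<^esub> b \<in> p i"
    obtain f where f: "reg f" "a = ger f" using ab(1) by (rule O_carrierE)
    obtain g' where g: "reg g'" "b = ger g'" using ab(2) by (rule O_carrierE)
    obtain c d where cd: "c \<in> polyfun" "d \<in> polyfun" "d (\<lambda>_. 0) \<noteq> 0" "eventually (\<lambda>w. d w \<noteq> 0 \<and> f (\<phi> w) = c w / d w) ?N"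
      using regular_atE[OF reg_compose_\<phi>[OF f(1)]] by blast
    obtain c' d' where cd': "c' \<in> polyfun" "d' \<in> polyfun" "d' (\<lambda>_. 0) \<noteq> 0" "eventually (\<lambda>w. d' w \<noteq> 0 \<and> g' (\<phi> w) = c' w / d' w) ?N"
      using regular_atE[OF reg_compose_\<phi>[OF g(1)]] by blast
    have "van i (\<lambda>w. f (\<phi> w) * g' (\<phi> w))"
      using ab(3) unfolding f(2) g(2) O_mult p_iff[OF regular_at_mult[OF f(1) g(1)]] .
    then have "van i (\<lambda>w. c w * c' w)"
      unfolding van_def using cd(4) cd'(4) by eventually_elim auto
    then have "c (\<Psi> i z) * c' (\<Psi> i z) = 0" for z unfolding van_poly[OF polyfun.mult[OF cd(1) cd'(1)]] by blast
    from polyfun_zero_divisors[OF comp[OF cd(1)] comp[OF cd'(1)] this]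
    have "van i c \<or> van i c'" unfolding van_poly[OF cd(1)] van_poly[OF cd'(1)] .
    then have "van i (\<lambda>w. f (\<phi> w)) \<or> van i (\<lambda>w. g' (\<phi> w))"
    proof
      assume "van i c"
      then have "van i (\<lambda>w. f (\<phi> w))" unfolding van_def using cd(4) by eventually_elim simp
      then show ?thesis ..
    next
      assume "van i c'"
      then have "van i (\<lambda>w. g' (\<phi> w))" unfolding van_def using cd'(4) by eventually_elim simp
      then show ?thesis ..
    qed
    then show "a \<in> p i \<or> b \<in> p i" unfolding f(2) g(2) p_iff[OF f(1)] p_iff[OF g(1)] .
  qed
  show ?thesis
  proof (rule krull_dim_geI[of n p, OF prime])
    fix i assume i: "i < n"
    have "p i \<subseteq> p (Suc i)"
    proof
      fix a assume "a \<in> p i"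
      then obtain f where f: "reg f" "a = ger f" "van i (\<lambda>w. f (\<phi> w))" using pE by blast
      have "range (\<Psi> (Suc i)) \<subseteq> range (\<Psi> i)" using mono[OF i] by auto
      with f(3) have "van (Suc i) (\<lambda>w. f (\<phi> w))" unfolding van_def by (auto elim!: eventually_mono)
      then show "a \<in> p (Suc i)" unfolding f(2) p_iff[OF f(1)] .
    qed
    moreover obtain v where v: "\<forall>z. \<Psi> (Suc i) z v = 0" "\<exists>z. \<Psi> i z v \<noteq> 0" using sep[OF i] by blast
    \<comment> \<open>Near the origin \<open>g\<close> inverts \<open>\<phi>\<close>, so the germ of
      a chart coordinate is tested on the coordinate of the cone itself.\<close>
    have *: "van l (\<lambda>w. g (\<phi> w) v) \<longleftrightarrow> van l (\<lambda>w. w v)" for l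
    proof
      assume "van l (\<lambda>w. g (\<phi> w) v)"
      then show "van l (\<lambda>w. w v)" unfolding van_def using near_\<phi> by eventually_elim simp
    next
      assume "van l (\<lambda>w. w v)"
      then show "van l (\<lambda>w. g (\<phi> w) v)" unfolding van_def using near_\<phi> by eventually_elim simp
    qed
    have "ger (\<lambda>x. g x v) \<in> p (Suc i)" "ger (\<lambda>x. g x v) \<notin> p i"
      using v unfolding p_iff[OF g_regular] * van_poly[OF polyfun.coord] by simp_all
    ultimately show "p i \<subset> p (Suc i)" by blast
  qed
qed

end

section \<open>Krull dimension at a chart\<close>

context chart_on_cone
begin

lemma krull_dim_local_ring_le:
  assumes "\<And>T. finite {u \<in> S. deg u \<le> T}" "\<And>T. card {u \<in> S. deg u \<le> T} \<le> (T + 1) ^ D"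
  shows "krull_dim \<O> \<le> enat D"
  by (rule krull_dim_le[OF S_zero S_add deg_add assms cring_O germ_ev_hom germ_ev_cover])

lemma krull_dim_gr_le:
  assumes "\<And>T. finite {u \<in> S. deg u \<le> T}" "\<And>T. card {u \<in> S. deg u \<le> T} \<le> (T + 1) ^ D"
  shows "krull_dim (gr \<O> \<mm>) \<le> enat D"
proof (rule krull_dim_le[OF S_zero S_add deg_add assms G.cring_gr])
  show "G.gr_map \<in> ring_hom (semigroup_algebra S) (gr \<O> \<mm>)" using G.gr_map_iso unfolding ring_iso_def by blast
  interpret gr: cring "gr \<O> \<mm>" by (rule G.cring_gr)
  fix a assume a: "a \<in> carrier (gr \<O> \<mm>)"
  then obtain p where "Poly_Mapping.keys p \<subseteq> S" "G.gr_map p = a" using G.gr_map_surj by blast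
  then have "Poly_Mapping.keys p \<subseteq> S \<and> a = \<one>\<^bsub>gr \<O> \<mm>\<^esub> \<otimes>\<^bsub>gr \<O> \<mm>\<^esub> G.gr_map p" using a by simp
  then show "\<exists>s\<in>Units (gr \<O> \<mm>). \<exists>p. Poly_Mapping.keys p \<subseteq> S \<and> a = s \<otimes>\<^bsub>gr \<O> \<mm>\<^esub> G.gr_map p"
    using gr.Units_one_closed by blast
qed

lemma gr_iso_coord_ring: "alg_isomorphic (gr \<O> \<mm>) (coord_ring W)"
  and gr_iso_semigroup: "alg_isomorphic (gr \<O> \<mm>) (semigroup_algebra S :: ('k, _) module)"
proof -
  have "alg_isomorphic (gr \<O> \<mm>) (semigroup_algebra S :: ('k, ('b \<Rightarrow>\<^sub>0 int) \<Rightarrow>\<^sub>0 'k) module)"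
    by (rule alg_isomorphic_sym[OF cring.axioms(1)[OF G.cring_A]
      semigroup_algebra_smult_closed[OF S_zero S_add] G.gr_iso_semigroup_algebra])
  then show "alg_isomorphic (gr \<O> \<mm>) (semigroup_algebra S :: ('k, _) module)" .
  from alg_isomorphic_trans[OF this coord_ring_iso] show "alg_isomorphic (gr \<O> \<mm>) (coord_ring W)" .
qed

text \<open>Chains of primes for the graded ring are found in the coordinate ring of the cone, where
  they have a geometric description.\<close>

lemma krull_dim_coord_ring_le_gr: "krull_dim (coord_ring W) \<le> krull_dim (gr \<O> \<mm>)"
proof -
  obtain h where h: "h \<in> ring_iso (gr \<O> \<mm>) (coord_ring W)"
    using gr_iso_coord_ring unfolding alg_isomorphic_def by (elim bexE)
  then have "h \<in> ring_hom (gr \<O> \<mm>) (coord_ring W)" "h ` carrier (gr \<O> \<mm>) = carrier (coord_ring W)"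
    unfolding ring_iso_def bij_betw_def by simp_all
  then show ?thesis by (rule krull_dim_surj_le[OF G.cring_gr cring_coord_ring])
qed

end

section \<open>Affine space as a cone\<close>

definition orthant :: "nat \<Rightarrow> (nat \<Rightarrow>\<^sub>0 int) set" where
  "orthant N = {u. Poly_Mapping.keys u \<subseteq> {..<N} \<and> (\<forall>i. 0 \<le> Poly_Mapping.lookup u i)}"

definition orthant_deg :: "nat \<Rightarrow> (nat \<Rightarrow>\<^sub>0 int) \<Rightarrow> nat" where
  "orthant_deg N u = nat (\<Sum>i<N. Poly_Mapping.lookup u i)"

definition orthant_mon :: "nat \<Rightarrow> (nat \<Rightarrow>\<^sub>0 int) \<Rightarrow> (nat \<Rightarrow> 'k::field) \<Rightarrow> 'k" where
  "orthant_mon N u w = (\<Prod>i<N. w i ^ nat (Poly_Mapping.lookup u i))"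

lemma nat_sum_eq: "(\<And>i. i \<in> A \<Longrightarrow> 0 \<le> f i) \<Longrightarrow> nat (\<Sum>i\<in>A. f i) = (\<Sum>i\<in>A. nat (f i))"
proof -
  assume "\<And>i. i \<in> A \<Longrightarrow> 0 \<le> f i"
  then have "(\<Sum>i\<in>A. f i) = int (\<Sum>i\<in>A. nat (f i))" by simp
  then show ?thesis by (simp only: nat_int)
qed

lemma orthantD: "u \<in> orthant N \<Longrightarrow> 0 \<le> Poly_Mapping.lookup u i"
  "u \<in> orthant N \<Longrightarrow> N \<le> i \<Longrightarrow> Poly_Mapping.lookup u i = 0"
  by (simp add: orthant_def) (simp add: orthant_def, metis in_keys_iff lessThan_iff not_le subsetD)

lemma orthantI: "(\<And>i. 0 \<le> Poly_Mapping.lookup u i) \<Longrightarrow> (\<And>i. N \<le> i \<Longrightarrow> Poly_Mapping.lookup u i = 0) \<Longrightarrow> u \<in> orthant N"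
  by (auto simp: orthant_def in_keys_iff) (meson not_less)

lemma orthant_add: "u \<in> orthant N \<Longrightarrow> v \<in> orthant N \<Longrightarrow> u + v \<in> orthant N"
  by (rule orthantI) (simp_all add: lookup_add orthantD)

lemma orthant_card:
  assumes "A \<subseteq> orthant M" "\<And>u i. u \<in> A \<Longrightarrow> i < M \<Longrightarrow> Poly_Mapping.lookup u i \<le> int T"
  shows "finite A" "card A \<le> (T + 1) ^ M"
proof -
  let ?f = "\<lambda>u. restrict (\<lambda>i. nat (Poly_Mapping.lookup u i)) {..<M}"
  let ?B = "PiE {..<M} (\<lambda>_. {0..T})"
  have inj: "inj_on ?f A"
  proof (rule inj_onI)
    fix u v assume uv: "u \<in> A" "v \<in> A" "?f u = ?f v"
    then have uM: "u \<in> orthant M" "v \<in> orthant M" using assms(1) by blast+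
    show "u = v"
    proof (rule poly_mapping_eqI)
      fix i
      show "Poly_Mapping.lookup u i = Poly_Mapping.lookup v i"
      proof (cases "i < M")
        case True
        then have "nat (Poly_Mapping.lookup u i) = nat (Poly_Mapping.lookup v i)"
          using fun_cong[OF uv(3), of i] by simp
        then show ?thesis using orthantD(1)[OF uM(1), of i] orthantD(1)[OF uM(2), of i] by simp
      next
        case False
        then show ?thesis using orthantD(2)[OF uM(1), of i] orthantD(2)[OF uM(2), of i] by simp
      qed
    qed
  qed
  have sub: "?f ` A \<subseteq> ?B" by (intro image_subsetI PiE_I) (use assms(2) in \<open>auto simp: nat_le_iff\<close>)
  have fB: "finite ?B" by (simp add: finite_PiE)
  show "finite A" using inj sub fB by (meson finite_subset inj_on_finite)
  have "card A \<le> card ?B" using card_inj_on_le[OF inj sub fB] .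
  then show "card A \<le> (T + 1) ^ M" by (simp add: card_PiE)
qed

text \<open>The polynomial ring, with its ordinary monomials, is the case that shows the points of
  \<open>Y\<close> to be regular.\<close>

lemma monomial_cone_affine:
  "monomial_cone (orthant N) (orthant_deg N) {..<N} (affine_space {..<N}) (orthant_mon N :: _ \<Rightarrow> (nat \<Rightarrow> 'k::alg_closed_field) \<Rightarrow> 'k)
     (\<lambda>i. Poly_Mapping.single i 1)"
proof (unfold_locales)
  show "0 \<in> orthant N" by (rule orthantI) simp_all
next
  fix u v assume uv: "u \<in> orthant N" "v \<in> orthant N"
  show "u + v \<in> orthant N" using uv by (rule orthant_add)
  show "orthant_deg N (u + v) = orthant_deg N u + orthant_deg N v"
    unfolding orthant_deg_def lookup_add sum.distrib
    by (rule nat_add_distrib) (auto intro!: sum_nonneg orthantD uv)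
next
  fix u assume u: "u \<in> orthant N" "orthant_deg N u = 0"
  then have "(\<Sum>i<N. Poly_Mapping.lookup u i) \<le> 0" by (simp add: orthant_deg_def)
  then have "(\<Sum>i<N. Poly_Mapping.lookup u i) = 0"
    using sum_nonneg[of "{..<N}" "Poly_Mapping.lookup u"] orthantD(1)[OF u(1)] by force
  then have "\<forall>i\<in>{..<N}. Poly_Mapping.lookup u i = 0"
    by (subst (asm) sum_nonneg_eq_0_iff) (auto intro: orthantD u)
  then show "u = 0"
    using orthantD(2)[OF u(1)] by (intro poly_mapping_eqI) (simp, metis lessThan_iff not_less)
next
  show "affine_space {..<N} \<subseteq> affine_space {..<N}" by simp
next
  fix w :: "nat \<Rightarrow> 'k" and t assume "w \<in> affine_space {..<N}"
  then show "(\<lambda>v. t * w v) \<in> affine_space {..<N}" by (simp add: affine_space_def)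
next
  show "(\<lambda>_. 0 :: 'k) \<in> affine_space {..<N}" by (simp add: affine_space_def)
next
  fix u show "(orthant_mon N u :: (nat \<Rightarrow> 'k) \<Rightarrow> 'k) \<in> polyfun"
    unfolding orthant_mon_def by (intro polyfun_prod polyfun_power polyfun.coord)
next
  fix u and w :: "nat \<Rightarrow> 'k" and t assume u: "u \<in> orthant N"
  have "orthant_deg N u = (\<Sum>i<N. nat (Poly_Mapping.lookup u i))"
    unfolding orthant_deg_def by (rule nat_sum_eq) (use orthantD u in auto)
  then show "orthant_mon N u (\<lambda>v. t * w v) = t ^ orthant_deg N u * orthant_mon N u w"
    unfolding orthant_mon_def by (simp add: power_mult_distrib prod.distrib power_sum)
next
  fix u v and w :: "nat \<Rightarrow> 'k" assume "u \<in> orthant N" "v \<in> orthant N"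
  then show "orthant_mon N (u + v) w = orthant_mon N u w * orthant_mon N v w"
    unfolding orthant_mon_def by (simp add: lookup_add nat_add_distrib orthantD power_add prod.distrib)
next
  fix w :: "nat \<Rightarrow> 'k" show "orthant_mon N 0 w = 1" by (simp add: orthant_mon_def)
next
  fix j assume j: "j \<in> {..<N}"
  then show "Poly_Mapping.single j 1 \<in> orthant N"
    by (intro orthantI) (auto simp: lookup_single when_def)
  show "orthant_deg N (Poly_Mapping.single j 1) = 1"
    using j by (simp add: orthant_deg_def lookup_single when_def)
  fix w :: "nat \<Rightarrow> 'k"
  have "orthant_mon N (Poly_Mapping.single j 1) w = (\<Prod>i<N. if i = j then w i else 1)"
    unfolding orthant_mon_def by (rule prod.cong) (auto simp: lookup_single when_def)
  then show "orthant_mon N (Poly_Mapping.single j 1) w = w j" using j by simp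
next
  fix u k assume u: "u \<in> orthant N" "orthant_deg N u = Suc k"
  then have "(\<Sum>i<N. Poly_Mapping.lookup u i) > 0" unfolding orthant_deg_def by linarith
  then obtain i where i: "i < N" "Poly_Mapping.lookup u i > 0"
    by (metis lessThan_iff not_less sum_nonpos)
  let ?u = "u - Poly_Mapping.single i 1"
  have "?u \<in> orthant N"
    using i orthantD[OF u(1)] by (intro orthantI) (auto simp: lookup_minus lookup_single when_def)
  moreover have "orthant_deg N ?u = k"
    using u(2) i(1) by (simp add: orthant_deg_def lookup_minus lookup_single when_def sum_subtractf nat_diff_distrib')
  ultimately show "\<exists>j\<in>{..<N}. \<exists>u'\<in>orthant N. orthant_deg N u' = k \<and> u = Poly_Mapping.single j 1 + u'"
    using i(1) by (intro bexI[of _ i] bexI[of _ ?u]) auto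
next
  fix T :: "(nat \<Rightarrow>\<^sub>0 int) set" and c :: "_ \<Rightarrow> 'k" and u
  assume T: "finite T" "T \<subseteq> orthant N" "\<And>w. w \<in> affine_space {..<N} \<Longrightarrow> (\<Sum>u\<in>T. c u * orthant_mon N u w) = 0" "u \<in> T"
  show "c u = 0"
  proof (rule monomials_independent[OF T(1) _ _ T(4)])
    fix u v assume uv: "u \<in> T" "v \<in> T" "\<And>i. i < N \<Longrightarrow> nat (Poly_Mapping.lookup u i) = nat (Poly_Mapping.lookup v i)"
    show "u = v"
    proof (rule poly_mapping_eqI)
      fix i
      have uN: "u \<in> orthant N" "v \<in> orthant N" using uv T(2) by auto
      show "Poly_Mapping.lookup u i = Poly_Mapping.lookup v i"
        using uv(3)[of i] orthantD[OF uN(1), of i] orthantD[OF uN(2), of i] by (cases "i < N") auto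
    qed
  next
    fix x :: "nat \<Rightarrow> 'k"
    have "(\<Sum>u\<in>T. c u * orthant_mon N u (\<lambda>i. if i < N then x i else 0)) = 0"
      by (rule T(3)) (simp add: affine_space_def)
    then show "(\<Sum>u\<in>T. c u * (\<Prod>i<N. x i ^ nat (Poly_Mapping.lookup u i))) = 0"
      by (simp add: orthant_mon_def)
  qed
qed

lemma orthant_bound:
  "finite {u \<in> orthant N. orthant_deg N u \<le> T}" "card {u \<in> orthant N. orthant_deg N u \<le> T} \<le> (T + 1) ^ N"
proof -
  have *: "Poly_Mapping.lookup u i \<le> int T" if "u \<in> {u \<in> orthant N. orthant_deg N u \<le> T}" "i < N" for u i
  proof -
    have "Poly_Mapping.lookup u i \<le> (\<Sum>i<N. Poly_Mapping.lookup u i)"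
      using that by (intro member_le_sum) (auto intro: orthantD)
    then show ?thesis using that by (simp add: orthant_deg_def nat_le_iff)
  qed
  show "finite {u \<in> orthant N. orthant_deg N u \<le> T}" by (rule orthant_card[OF _ *]) auto
  show "card {u \<in> orthant N. orthant_deg N u \<le> T} \<le> (T + 1) ^ N" by (rule orthant_card[OF _ *]) auto
qed

lemma (in monomial_cone) deg_1_eq: "{u \<in> S. deg u = 1} = e ` V"
proof (intro equalityI subsetI)
  fix u assume "u \<in> {u \<in> S. deg u = 1}"
  then obtain j u' where "j \<in> V" "u' \<in> S" "deg u' = 0" "u = e j + u'"
    using S_decompose[of u 0] by auto
  then show "u \<in> e ` V" using deg_eq_0D[of u'] by auto
qed (use e_S deg_e in auto)

text \<open>The embedding dimension is the number \<open>N\<close> of monomials of degree 1. The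
  flag of coordinate subspaces gives a chain of that length, and the monomial count excludes longer
  ones.\<close>

lemma regular_point_of_affine_chart:
  fixes X :: "('v \<Rightarrow> 'k::alg_closed_field) set" and N :: nat
  assumes "local_chart X P (affine_space {..<N}) g \<phi>"
  shows "P \<notin> Sing X"
proof -
  interpret local_chart X P "affine_space {..<N}" g \<phi> by (rule assms)
  interpret monomial_cone "orthant N" "orthant_deg N" "{..<N}" "affine_space {..<N}"
    "orthant_mon N :: _ \<Rightarrow> (nat \<Rightarrow> 'k::alg_closed_field) \<Rightarrow> 'k" "\<lambda>i. Poly_Mapping.single i 1"
    by (rule monomial_cone_affine)
  interpret chart_on_cone X P "affine_space {..<N}" g \<phi> "orthant N" "orthant_deg N" "{..<N}"
    "orthant_mon N :: _ \<Rightarrow> (nat \<Rightarrow> 'k::alg_closed_field) \<Rightarrow> 'k" "\<lambda>i. Poly_Mapping.single i 1"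
    by unfold_locales
  have "finite {u \<in> orthant N. orthant_deg N u = 1}"
    by (rule finite_subset[OF _ orthant_bound(1)[of N 1]]) auto
  from G.hilbert_function_eq[OF this] have "hilbert_function \<O> \<mm> 1 = card ((\<lambda>i. Poly_Mapping.single i (1::int)) ` {..<N})"
    by (simp only: deg_1_eq)
  moreover have "inj_on (\<lambda>i. Poly_Mapping.single i (1::int)) {..<N}"
    by (rule inj_onI) (metis lookup_single_eq lookup_single_not_eq one_neq_zero)
  ultimately have H: "hilbert_function \<O> \<mm> 1 = N" by (simp add: card_image)
  define \<Psi> where "\<Psi> i z j = (if j < N \<and> i \<le> j then z j else 0)" for i :: nat and z :: "nat \<Rightarrow> 'k" and j
  have "enat N \<le> krull_dim \<O>"
  proof (rule krull_dim_local_ring_ge[of \<Psi>])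
    show "(\<lambda>z. \<Psi> i z v) \<in> polyfun" for i v
      unfolding \<Psi>_def by (cases "v < N"; cases "i \<le> v") (simp_all add: polyfun.intros)
    show "\<Psi> i z \<in> affine_space {..<N}" for i z by (simp add: \<Psi>_def affine_space_def)
    show "\<exists>z. \<Psi> i z = (\<lambda>_. 0)" for i by (intro exI[of _ "\<lambda>_. 0"]) (simp add: \<Psi>_def fun_eq_iff)
    show "\<exists>z'. \<Psi> (Suc i) z = \<Psi> i z'" for i z by (intro exI[of _ "\<Psi> (Suc i) z"]) (auto simp: \<Psi>_def fun_eq_iff)
    show "\<exists>v. (\<forall>z. \<Psi> (Suc i) z v = 0) \<and> (\<exists>z. \<Psi> i z v \<noteq> 0)" if "i < N" for i
      using that by (intro exI[of _ i]) (auto simp: \<Psi>_def intro!: exI[of _ "\<lambda>_. 1"])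
  qed
  moreover have "krull_dim \<O> \<le> enat N" using orthant_bound by (rule krull_dim_local_ring_le)
  ultimately have "krull_dim \<O> = enat N" by (rule antisym[rotated])
  then show ?thesis using H unfolding Sing_def regular_local_def by simp
qed

section \<open>The quadric cone times an affine space\<close>

text \<open>Monomials of the Segre parametrization have equal degree in \<open>s\<close> and in
  \<open>t\<close>; the inequality says that the exponent not stored is nonnegative. Entries from 3
  on belong to the free coordinates. Storing only independent exponents keeps the number of entries
  equal to the dimension \<open>N + 3\<close>.\<close>

definition quadric_semigroup :: "nat \<Rightarrow> (nat \<Rightarrow>\<^sub>0 int) set" where
  "quadric_semigroup N = {u \<in> orthant (N + 3).
     Poly_Mapping.lookup u 2 \<le> Poly_Mapping.lookup u 0 + Poly_Mapping.lookup u 1}"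

text \<open>Each of the four quadric coordinates contains exactly one of \<open>s1\<close>,
  \<open>s2\<close>, so the exponents of these two count the degree.\<close>

definition quadric_deg :: "nat \<Rightarrow> (nat \<Rightarrow>\<^sub>0 int) \<Rightarrow> nat" where
  "quadric_deg N u = nat (Poly_Mapping.lookup u 0 + Poly_Mapping.lookup u 1 + (\<Sum>k<N. Poly_Mapping.lookup u (k + 3)))"

text \<open>Writing \<open>x\<^sub>1 = s\<^sub>1 t\<^sub>1, x\<^sub>2 = s\<^sub>1 t\<^sub>2, x\<^sub>3 = s\<^sub>2 t\<^sub>1, x\<^sub>4 = s\<^sub>2 t\<^sub>2\<close>, the exponents of
  \<open>s\<^sub>1, s\<^sub>2, t\<^sub>1\<close> are the entries 0, 1, 2, and that of \<open>t\<^sub>2\<close> is determined by them.\<close>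

definition quadric_mon :: "nat \<Rightarrow> (nat \<Rightarrow>\<^sub>0 int) \<Rightarrow> (nat + nat \<Rightarrow> 'k::field) \<Rightarrow> 'k" where
  "quadric_mon N u w = (let a = Poly_Mapping.lookup u 0; b = Poly_Mapping.lookup u 1; c = Poly_Mapping.lookup u 2 in
     w (Inl 1) ^ nat (min a c) * w (Inl 2) ^ nat (a - c) * w (Inl 3) ^ nat (c - a) * w (Inl 4) ^ nat (min b (a + b - c))
     * (\<Prod>k<N. w (Inr k) ^ nat (Poly_Mapping.lookup u (k + 3))))"

definition quadric_param :: "nat \<Rightarrow> (nat \<Rightarrow> 'k::field) \<Rightarrow> nat + nat \<Rightarrow> 'k" where
  "quadric_param N z = case_sum
     (\<lambda>i. if i = 1 then z 0 * z 2 else if i = 2 then z 0 * z 3 else if i = 3 then z 1 * z 2 else if i = 4 then z 1 * z 3 else 0)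
     (\<lambda>k. if k < N then z (k + 4) else 0)"

definition quadric_var :: "nat + nat \<Rightarrow> (nat \<Rightarrow>\<^sub>0 int)" where
  "quadric_var = case_sum
     (\<lambda>i. if i = 1 then Poly_Mapping.single 0 1 + Poly_Mapping.single 2 1 else if i = 2 then Poly_Mapping.single 0 1
       else if i = 3 then Poly_Mapping.single 1 1 + Poly_Mapping.single 2 1 else Poly_Mapping.single 1 1)
     (\<lambda>k. Poly_Mapping.single (k + 3) 1)"

abbreviation quadric_product :: "nat \<Rightarrow> (nat + nat \<Rightarrow> 'k::field) set" where
  "quadric_product N \<equiv> variety_prod quadric_cone (affine_space {..<N})"

lemma variety_prod_iff: "w \<in> variety_prod X Y \<longleftrightarrow> (\<lambda>i. w (Inl i)) \<in> X \<and> (\<lambda>k. w (Inr k)) \<in> Y"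
proof
  assume "(\<lambda>i. w (Inl i)) \<in> X \<and> (\<lambda>k. w (Inr k)) \<in> Y"
  moreover have "w = case_sum (\<lambda>i. w (Inl i)) (\<lambda>k. w (Inr k))" by (rule ext) (simp split: sum.split)
  ultimately show "w \<in> variety_prod X Y" unfolding variety_prod_def by blast
qed (auto simp: variety_prod_def)

lemma set_1_4: "{1..4} = {1, 2, 3, 4 :: nat}" by auto

lemma quadric_param_in: "quadric_param N z \<in> quadric_product N"
  by (auto simp: variety_prod_iff quadric_cone_def affine_space_def quadric_param_def set_1_4)

text \<open>A 2 by 2 matrix of determinant zero is a column times a row. Hence identities between
  monomials on the cone may be checked in the parameters.\<close>

lemma quadric_param_surj:
  assumes w: "w \<in> quadric_product N" shows "\<exists>z. w = quadric_param N z"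
proof -
  have eq: "w (Inl 1) * w (Inl 4) = w (Inl 2) * w (Inl 3)"
    and Z: "\<And>i. i \<notin> {1, 2, 3, 4} \<Longrightarrow> w (Inl i) = 0" and Y: "\<And>k. \<not> k < N \<Longrightarrow> w (Inr k) = 0"
    using w by (auto simp: variety_prod_iff quadric_cone_def affine_space_def set_1_4)
  have "\<exists>s1 s2 t1 t2. w (Inl 1) = s1 * t1 \<and> w (Inl 2) = s1 * t2 \<and> w (Inl 3) = s2 * t1 \<and> w (Inl 4) = s2 * t2"
  proof (cases "w (Inl 1) = 0")
    case False
    then show ?thesis using eq
      by (intro exI[of _ "w (Inl 1)"] exI[of _ "w (Inl 3)"] exI[of _ 1] exI[of _ "w (Inl 2) / w (Inl 1)"]) (simp add: field_simps)
  next
    case True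
    then have "w (Inl 2) = 0 \<or> w (Inl 3) = 0" using eq by simp
    then show ?thesis
    proof
      assume "w (Inl 2) = 0"
      then show ?thesis using True
        by (intro exI[of _ 0] exI[of _ 1] exI[of _ "w (Inl 3)"] exI[of _ "w (Inl 4)"]) simp
    next
      assume "w (Inl 3) = 0"
      then show ?thesis using True
        by (intro exI[of _ "w (Inl 2)"] exI[of _ "w (Inl 4)"] exI[of _ 0] exI[of _ 1]) simp
    qed
  qed
  then obtain s1 s2 t1 t2 where st: "w (Inl 1) = s1 * t1" "w (Inl 2) = s1 * t2" "w (Inl 3) = s2 * t1" "w (Inl 4) = s2 * t2" by blast
  define z where "z i = (if i = 0 then s1 else if i = 1 then s2 else if i = 2 then t1 else if i = 3 then t2 else w (Inr (i - 4)))" for i :: nat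
  have "w = quadric_param N z"
  proof
    fix x show "w x = quadric_param N z x"
      using st Z Y by (cases x) (auto simp: quadric_param_def z_def)
  qed
  then show ?thesis by blast
qed

lemma quadric_semigroupD:
  assumes "u \<in> quadric_semigroup N"
  shows "u \<in> orthant (N + 3)" "0 \<le> Poly_Mapping.lookup u i" "N + 3 \<le> i \<Longrightarrow> Poly_Mapping.lookup u i = 0"
    "Poly_Mapping.lookup u 2 \<le> Poly_Mapping.lookup u 0 + Poly_Mapping.lookup u 1"
  using assms orthantD[of u "N + 3" i] unfolding quadric_semigroup_def by auto

lemma quadric_semigroupI:
  assumes "\<And>i. 0 \<le> Poly_Mapping.lookup u i" "\<And>i. N + 3 \<le> i \<Longrightarrow> Poly_Mapping.lookup u i = 0"
    "Poly_Mapping.lookup u 2 \<le> Poly_Mapping.lookup u 0 + Poly_Mapping.lookup u 1"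
  shows "u \<in> quadric_semigroup N"
  unfolding quadric_semigroup_def using assms orthantI[of u "N + 3"] by auto

text \<open>With truncated subtraction at most one of the second and third factors occurs: the
  quadric relation trades \<open>x2 x3\<close> for \<open>x1 x4\<close>, and the left side is the
  resulting normal form.\<close>

lemma quadric_monomial_identity:
  fixes s1 s2 t1 t2 :: "'k::field"
  assumes "c \<le> a + b"
  shows "(s1 * t1) ^ min a c * (s1 * t2) ^ (a - c) * (s2 * t1) ^ (c - a) * (s2 * t2) ^ min b (a + b - c)
    = s1 ^ a * s2 ^ b * t1 ^ c * t2 ^ (a + b - c)"
proof (cases "c \<le> a")
  case True
  then obtain d where "a = c + d" using le_Suc_ex by blast
  then show ?thesis by (simp add: power_mult_distrib power_add mult_ac)
next
  case False
  then obtain d where d: "c = a + d" using le_Suc_ex by (meson nat_le_linear)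
  then obtain f where "b = d + f" using assms le_Suc_ex by fastforce
  then show ?thesis using d by (simp add: power_mult_distrib power_add mult_ac)
qed

text \<open>The exponents of all parameters. Entry 3 restores the exponent of \<open>t2\<close>,
  which shifts the free coordinates by one.\<close>

definition quadric_exp :: "(nat \<Rightarrow>\<^sub>0 int) \<Rightarrow> nat \<Rightarrow> nat" where
  "quadric_exp u i = (if i < 3 then nat (Poly_Mapping.lookup u i)
     else if i = 3 then nat (Poly_Mapping.lookup u 0 + Poly_Mapping.lookup u 1 - Poly_Mapping.lookup u 2)
     else nat (Poly_Mapping.lookup u (i - 1)))"

lemma prod_lessThan_add4:
  "(\<Prod>i<N + 4. g i) = g 0 * g 1 * g 2 * g 3 * (\<Prod>k<N. g (k + 4 :: nat) :: 'k::field)"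
proof (induction N)
  case 0
  have "{..<4} = {0, 1, 2, 3 :: nat}" by auto
  then show ?case by (simp add: mult_ac)
next
  case (Suc N)
  have "(\<Prod>i<Suc N + 4. g i) = (\<Prod>i<N + 4. g i) * g (N + 4)" by (simp only: add_Suc prod.lessThan_Suc)
  then show ?case unfolding Suc.IH by (simp add: mult_ac)
qed

lemma quadric_mon_param':
  assumes u: "u \<in> quadric_semigroup N"
  shows "quadric_mon N u (quadric_param N z) = z 0 ^ quadric_exp u 0 * z 1 ^ quadric_exp u 1 * z 2 ^ quadric_exp u 2 * z 3 ^ quadric_exp u 3
    * (\<Prod>k<N. z (k + 4) ^ nat (Poly_Mapping.lookup u (k + 3)))"
proof -
  obtain a where a: "Poly_Mapping.lookup u 0 = int a" using quadric_semigroupD(2)[OF u] zero_le_imp_eq_int by blast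
  obtain b where b: "Poly_Mapping.lookup u 1 = int b" using quadric_semigroupD(2)[OF u] zero_le_imp_eq_int by blast
  obtain c where c: "Poly_Mapping.lookup u 2 = int c" using quadric_semigroupD(2)[OF u] zero_le_imp_eq_int by blast
  have le: "c \<le> a + b" using quadric_semigroupD(4)[OF u] a b c by linarith
  have "nat (min (int a) (int c)) = min a c" "nat (int a - int c) = a - c" "nat (int c - int a) = c - a"
    "nat (int a + int b - int c) = a + b - c" "nat (min (int b) (int a + int b - int c)) = min b (a + b - c)"
    using le by (auto simp: min_def)
  then show ?thesis
    using quadric_monomial_identity[OF le, of "z 0" "z 2" "z 3" "z 1"]
    by (simp add: quadric_mon_def quadric_param_def a b c quadric_exp_def Let_def del: One_nat_def)
qed

lemma quadric_mon_param:
  assumes u: "u \<in> quadric_semigroup N"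
  shows "quadric_mon N u (quadric_param N z) = (\<Prod>i<N + 4. z i ^ quadric_exp u i)"
proof -
  have "quadric_exp u (k + 4) = nat (Poly_Mapping.lookup u (k + 3))" for k by (simp add: quadric_exp_def add.commute)
  then show ?thesis unfolding prod_lessThan_add4 quadric_mon_param'[OF u] by simp
qed

lemma quadric_exp_add:
  assumes "u \<in> quadric_semigroup N" "v \<in> quadric_semigroup N"
  shows "quadric_exp (u + v) i = quadric_exp u i + quadric_exp v i"
  using quadric_semigroupD[OF assms(1)] quadric_semigroupD[OF assms(2)]
  by (auto simp: quadric_exp_def lookup_add nat_add_distrib[symmetric] algebra_simps)

lemma quadric_deg_eq:
  assumes u: "u \<in> quadric_semigroup N"
  shows "quadric_deg N u = nat (Poly_Mapping.lookup u 0) + nat (Poly_Mapping.lookup u 1) + (\<Sum>k<N. nat (Poly_Mapping.lookup u (k + 3)))"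
proof -
  have "(\<Sum>k<N. nat (Poly_Mapping.lookup u (k + 3))) = nat (\<Sum>k<N. Poly_Mapping.lookup u (k + 3))"
    by (rule nat_sum_eq[symmetric]) (use quadric_semigroupD(2)[OF u] in auto)
  moreover have "0 \<le> (\<Sum>k<N. Poly_Mapping.lookup u (k + 3))" by (intro sum_nonneg quadric_semigroupD(2)[OF u])
  ultimately show ?thesis
    using quadric_semigroupD(2)[OF u, of 0] quadric_semigroupD(2)[OF u, of 1] by (simp add: quadric_deg_def nat_add_distrib)
qed

lemma quadric_var_lookup:
  "Poly_Mapping.lookup (quadric_var (Inl i)) k = (if i = 1 then (if k = 0 \<or> k = 2 then 1 else 0) else if i = 2 then (if k = 0 then 1 else 0)
     else if i = 3 then (if k = 1 \<or> k = 2 then 1 else 0) else (if k = 1 then 1 else 0))"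
  "Poly_Mapping.lookup (quadric_var (Inr j)) k = (if k = j + 3 then 1 else 0)"
  by (auto simp: quadric_var_def lookup_add lookup_single when_def simp del: single_one One_nat_def)

lemma quadric_decompose:
  assumes u: "u \<in> quadric_semigroup N" and v: "v \<in> quadric_semigroup N" and uv: "u - v \<in> quadric_semigroup N"
    and deg: "quadric_deg N u = Suc k" "quadric_deg N v = 1"
  shows "\<exists>u'\<in>quadric_semigroup N. quadric_deg N u' = k \<and> u = v + u'"
proof -
  have "quadric_deg N u = quadric_deg N v + quadric_deg N (u - v)"
    unfolding quadric_deg_eq[OF u] quadric_deg_eq[OF v] quadric_deg_eq[OF uv]
  proof -
    have *: "nat (Poly_Mapping.lookup u i) = nat (Poly_Mapping.lookup v i) + nat (Poly_Mapping.lookup (u - v) i)" for i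
      using quadric_semigroupD(2)[OF v, of i] quadric_semigroupD(2)[OF uv, of i] by (simp add: lookup_minus)
    show "nat (Poly_Mapping.lookup u 0) + nat (Poly_Mapping.lookup u 1) + (\<Sum>k<N. nat (Poly_Mapping.lookup u (k + 3))) =
      nat (Poly_Mapping.lookup v 0) + nat (Poly_Mapping.lookup v 1) + (\<Sum>k<N. nat (Poly_Mapping.lookup v (k + 3))) +
      (nat (Poly_Mapping.lookup (u - v) 0) + nat (Poly_Mapping.lookup (u - v) 1) + (\<Sum>k<N. nat (Poly_Mapping.lookup (u - v) (k + 3))))"
      unfolding *[of 0] *[of 1] by (subst *) (simp add: sum.distrib)
  qed
  then show ?thesis using uv deg by (intro bexI[OF _ uv]) simp
qed

lemma monomial_cone_quadric:
  "monomial_cone (quadric_semigroup N) (quadric_deg N) (Inl ` {1..4} \<union> Inr ` {..<N}) (quadric_product N)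
     (quadric_mon N :: _ \<Rightarrow> (nat + nat \<Rightarrow> 'k::alg_closed_field) \<Rightarrow> 'k) quadric_var"
proof (unfold_locales)
  show "0 \<in> quadric_semigroup N" by (rule quadric_semigroupI) simp_all
next
  fix u v assume uv: "u \<in> quadric_semigroup N" "v \<in> quadric_semigroup N"
  have S: "u + v \<in> quadric_semigroup N"
    using quadric_semigroupD[OF uv(1)] quadric_semigroupD[OF uv(2)] by (intro quadric_semigroupI) (auto simp: lookup_add intro: add_mono)
  then show "u + v \<in> quadric_semigroup N" .
  show "quadric_deg N (u + v) = quadric_deg N u + quadric_deg N v"
    unfolding quadric_deg_eq[OF S] quadric_deg_eq[OF uv(1)] quadric_deg_eq[OF uv(2)]
    using quadric_semigroupD(2)[OF uv(1)] quadric_semigroupD(2)[OF uv(2)]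
    by (simp add: lookup_add nat_add_distrib sum.distrib)
  fix w :: "nat + nat \<Rightarrow> 'k" assume "w \<in> quadric_product N"
  then obtain z where z: "w = quadric_param N z" using quadric_param_surj by blast
  show "quadric_mon N (u + v) w = quadric_mon N u w * quadric_mon N v w"
    unfolding z quadric_mon_param[OF S] quadric_mon_param[OF uv(1)] quadric_mon_param[OF uv(2)] quadric_exp_add[OF uv]
    by (simp add: power_add prod.distrib)
next
  fix u assume u: "u \<in> quadric_semigroup N" "quadric_deg N u = 0"
  note D = quadric_semigroupD[OF u(1)]
  have z: "Poly_Mapping.lookup u 0 = 0" "Poly_Mapping.lookup u 1 = 0" "\<forall>k<N. Poly_Mapping.lookup u (k + 3) = 0"
    using u(2) D(2)[of 0] D(2)[of 1] D(2) unfolding quadric_deg_eq[OF u(1)] by (simp_all add: order_antisym)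
  show "u = 0"
  proof (rule poly_mapping_eqI)
    fix i
    consider "i = 0" | "i = 1" | "i = 2" | k where "i = k + 3" "k < N" | "N + 3 \<le> i"
      by (metis Suc_1 Suc_eq_plus1 add_less_cancel_right add.commute le_add_diff_inverse less_Suc0 less_antisym not_less numeral_3_eq_3 One_nat_def)
    then show "Poly_Mapping.lookup u i = Poly_Mapping.lookup 0 i"
      by cases (use z D(2)[of 2] D(3,4) in auto)
  qed
next
  show "(quadric_product N :: (nat + nat \<Rightarrow> 'k) set) \<subseteq> affine_space (Inl ` {1..4} \<union> Inr ` {..<N})"
  proof
    fix w :: "nat + nat \<Rightarrow> 'k" assume "w \<in> quadric_product N"
    then have "(\<forall>i. i \<notin> {1..4} \<longrightarrow> w (Inl i) = 0) \<and> (\<forall>k. k \<notin> {..<N} \<longrightarrow> w (Inr k) = 0)"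
      unfolding variety_prod_iff quadric_cone_def affine_space_def by blast
    then have "w v = 0" if "v \<notin> Inl ` {1..4} \<union> Inr ` {..<N}" for v using that by (cases v) blast+
    then show "w \<in> affine_space (Inl ` {1..4} \<union> Inr ` {..<N})" unfolding affine_space_def by blast
  qed
next
  fix w :: "nat + nat \<Rightarrow> 'k" and t assume "w \<in> quadric_product N"
  then show "(\<lambda>v. t * w v) \<in> quadric_product N"
    by (auto simp: variety_prod_iff affine_space_def quadric_cone_def)
next
  show "(\<lambda>_. 0 :: 'k) \<in> quadric_product N" by (simp add: variety_prod_iff affine_space_def quadric_cone_def)
next
  fix u show "(quadric_mon N u :: (nat + nat \<Rightarrow> 'k) \<Rightarrow> 'k) \<in> polyfun"
    unfolding quadric_mon_def Let_def by (intro polyfun.mult polyfun_prod polyfun_power polyfun.coord)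
next
  fix u and w :: "nat + nat \<Rightarrow> 'k" and t assume u: "u \<in> quadric_semigroup N" and w: "w \<in> quadric_product N"
  obtain z where z: "w = quadric_param N z" using w quadric_param_surj by blast
  \<comment> \<open>Scaling \<open>s1\<close>, \<open>s2\<close> and the free parameters, but not
    \<open>t1\<close>, \<open>t2\<close>, scales every coordinate exactly once.\<close>
  define z' where "z' i = (if i = 2 \<or> i = 3 then z i else t * z i)" for i
  have sc: "(\<lambda>v. t * w v) = quadric_param N z'"
  proof
    fix v show "t * w v = quadric_param N z' v" by (cases v) (auto simp: z quadric_param_def z'_def)
  qed
  show "quadric_mon N u (\<lambda>v. t * w v) = t ^ quadric_deg N u * quadric_mon N u w"
    unfolding sc quadric_mon_param'[OF u] unfolding z quadric_mon_param'[OF u] quadric_deg_eq[OF u]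
    by (simp add: z'_def quadric_exp_def power_mult_distrib prod.distrib power_add power_sum mult_ac)
next
  fix w :: "nat + nat \<Rightarrow> 'k" show "quadric_mon N 0 w = 1" by (simp add: quadric_mon_def)
next
  fix j :: "nat + nat" assume j: "j \<in> Inl ` {1..4} \<union> Inr ` {..<N}"
  have S: "quadric_var j \<in> quadric_semigroup N"
    using j by (intro quadric_semigroupI; cases j) (auto simp: quadric_var_lookup)
  then show "quadric_var j \<in> quadric_semigroup N" .
  show "quadric_deg N (quadric_var j) = 1"
    using j by (cases j) (auto simp: quadric_deg_def quadric_var_lookup set_1_4)
  fix w :: "nat + nat \<Rightarrow> 'k"
  show "quadric_mon N (quadric_var j) w = w j"
  proof (cases j)
    case (Inl i)
    then have "i \<in> {1, 2, 3, 4}" using j set_1_4 by blast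
    then show ?thesis using Inl by (auto simp: quadric_mon_def quadric_var_lookup)
  next
    case (Inr k)
    have "(\<Prod>l<N. w (Inr l) ^ nat (if l = k then 1 else 0)) = (\<Prod>l<N. if l = k then w (Inr l) else 1)"
      by (rule prod.cong) auto
    also have "\<dots> = w j" using j Inr by auto
    finally show ?thesis using Inr by (simp add: quadric_mon_def quadric_var_lookup)
  qed
next
  fix u k assume u: "u \<in> quadric_semigroup N" "quadric_deg N u = Suc k"
  note D = quadric_semigroupD[OF u(1)]
  let ?V = "Inl ` {1..4} \<union> Inr ` {..<N}"
  have fin: "\<exists>j\<in>?V. \<exists>u'\<in>quadric_semigroup N. quadric_deg N u' = k \<and> u = quadric_var j + u'"
    if "j \<in> ?V" "quadric_var j \<in> quadric_semigroup N" "u - quadric_var j \<in> quadric_semigroup N" "quadric_deg N (quadric_var j) = 1" for j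
    using quadric_decompose[OF u(1) that(2,3) u(2) that(4)] that(1) by blast
  have varS: "quadric_var j \<in> quadric_semigroup N" if "j \<in> ?V" for j
    using that by (intro quadric_semigroupI; cases j) (auto simp: quadric_var_lookup)
  have vard: "quadric_deg N (quadric_var j) = 1" if "j \<in> ?V" for j
    using that by (cases j) (auto simp: quadric_deg_def quadric_var_lookup set_1_4)
  show "\<exists>j\<in>?V. \<exists>u'\<in>quadric_semigroup N. quadric_deg N u' = k \<and> u = quadric_var j + u'"
  proof (cases "\<exists>l<N. Poly_Mapping.lookup u (l + 3) > 0")
    case True
    then obtain l where l: "l < N" "Poly_Mapping.lookup u (l + 3) > 0" by blast
    have "u - quadric_var (Inr l) \<in> quadric_semigroup N"
      using D l by (intro quadric_semigroupI) (auto simp: lookup_minus quadric_var_lookup)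
    then show ?thesis using l varS vard by (intro fin[of "Inr l"]) auto
  next
    case False
    then have "Poly_Mapping.lookup u (l + 3) \<le> 0" if "l < N" for l using that by (meson not_le)
    then have "(\<Sum>k<N. nat (Poly_Mapping.lookup u (k + 3))) = 0" by (intro sum.neutral) simp
    then have pos: "Poly_Mapping.lookup u 0 > 0 \<or> Poly_Mapping.lookup u 1 > 0"
      using u(2) unfolding quadric_deg_eq[OF u(1)] by linarith
    \<comment> \<open>The coordinate split off contains an available \<open>s\<close>, and
      \<open>t1\<close> whenever its exponent is positive, otherwise \<open>t2\<close>. This
      preserves the inequality that defines the semigroup.\<close>
    let ?j = "if Poly_Mapping.lookup u 0 > 0 then (if Poly_Mapping.lookup u 2 > 0 then 1 else 2)
      else (if Poly_Mapping.lookup u 2 > 0 then 3 else 4 :: nat)"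
    have "u - quadric_var (Inl ?j) \<in> quadric_semigroup N"
    proof (rule quadric_semigroupI)
      fix i show "0 \<le> Poly_Mapping.lookup (u - quadric_var (Inl ?j)) i"
        using D(2)[of i] pos by (auto simp: lookup_minus quadric_var_lookup)
      show "N + 3 \<le> i \<Longrightarrow> Poly_Mapping.lookup (u - quadric_var (Inl ?j)) i = 0"
        using D(3)[of i] by (auto simp: lookup_minus quadric_var_lookup)
    next
      show "Poly_Mapping.lookup (u - quadric_var (Inl ?j)) 2 \<le> Poly_Mapping.lookup (u - quadric_var (Inl ?j)) 0 + Poly_Mapping.lookup (u - quadric_var (Inl ?j)) 1"
        using D(2)[of 0] D(2)[of 1] D(2)[of 2] D(4) pos by (auto simp: lookup_minus quadric_var_lookup)
    qed
    then show ?thesis using varS vard by (intro fin[of "Inl ?j"]) auto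
  qed
next
  fix T :: "(nat \<Rightarrow>\<^sub>0 int) set" and c :: "_ \<Rightarrow> 'k" and u
  assume T: "finite T" "T \<subseteq> quadric_semigroup N" "\<And>w. w \<in> quadric_product N \<Longrightarrow> (\<Sum>u\<in>T. c u * quadric_mon N u w) = 0" "u \<in> T"
  show "c u = 0"
  \<comment> \<open>Pulled back to the parameters, different elements of the semigroup have
    different exponents in \<open>N + 4\<close> variables.\<close>
  proof (rule monomials_independent[OF T(1) _ _ T(4)])
    fix u v assume uv: "u \<in> T" "v \<in> T" "\<And>i. i < N + 4 \<Longrightarrow> quadric_exp u i = quadric_exp v i"
    then have uN: "u \<in> quadric_semigroup N" "v \<in> quadric_semigroup N" using T(2) by auto
    show "u = v"
    proof (rule poly_mapping_eqI)
      fix i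
      have "nat (Poly_Mapping.lookup u i) = nat (Poly_Mapping.lookup v i)" if "i < N + 3"
        using uv(3)[of i] uv(3)[of "Suc i"] that by (cases "i < 3") (auto simp: quadric_exp_def)
      then show "Poly_Mapping.lookup u i = Poly_Mapping.lookup v i"
        using quadric_semigroupD(2,3)[OF uN(1), of i] quadric_semigroupD(2,3)[OF uN(2), of i] by (cases "i < N + 3") auto
    qed
  next
    fix x :: "nat \<Rightarrow> 'k"
    have "(\<Sum>u\<in>T. c u * quadric_mon N u (quadric_param N x)) = 0" using quadric_param_in by (rule T(3))
    moreover have "(\<Sum>u\<in>T. c u * quadric_mon N u (quadric_param N x)) = (\<Sum>u\<in>T. c u * (\<Prod>i<N + 4. x i ^ quadric_exp u i))"
      using T(2) by (intro sum.cong) (auto simp: quadric_mon_param)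
    ultimately show "(\<Sum>u\<in>T. c u * (\<Prod>i<N + 4. x i ^ quadric_exp u i)) = 0" by simp
  qed
qed

text \<open>The first two entries and the free ones add up to the degree, and entry 2 is at most the
  sum of the first two. The number of entries is the exponent in the dimension bound.\<close>

lemma quadric_bound:
  "finite {u \<in> quadric_semigroup N. quadric_deg N u \<le> T}" "card {u \<in> quadric_semigroup N. quadric_deg N u \<le> T} \<le> (T + 1) ^ (N + 3)"
proof -
  have *: "Poly_Mapping.lookup u i \<le> int T" if "u \<in> {u \<in> quadric_semigroup N. quadric_deg N u \<le> T}" "i < N + 3" for u i
  proof -
    have u: "u \<in> quadric_semigroup N" and d: "quadric_deg N u \<le> T" and iN: "i < N + 3" using that by auto
    note D = quadric_semigroupD[OF u]
    have s0: "0 \<le> (\<Sum>k<N. Poly_Mapping.lookup u (k + 3))" by (intro sum_nonneg D(2))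
    have T: "Poly_Mapping.lookup u 0 + Poly_Mapping.lookup u 1 + (\<Sum>k<N. Poly_Mapping.lookup u (k + 3)) \<le> int T"
      using d by (simp add: quadric_deg_def nat_le_iff)
    show ?thesis
    proof (cases "i < 3")
      case True
      then have "i = 0 \<or> i = 1 \<or> i = 2" by linarith
      then show ?thesis using T s0 D(2)[of 0] D(2)[of 1] D(4) by auto
    next
      case False
      then obtain k where k: "i = k + 3" "k < N" using iN le_Suc_ex[of 3 i] by (auto simp: add.commute)
      have "Poly_Mapping.lookup u (k + 3) \<le> (\<Sum>k<N. Poly_Mapping.lookup u (k + 3))"
        using k(2) by (intro member_le_sum[of k "{..<N}" "\<lambda>k. Poly_Mapping.lookup u (k + 3)"] D(2)) auto
      then show ?thesis using T D(2)[of 0] D(2)[of 1] k(1) by simp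
    qed
  qed
  have sub: "{u \<in> quadric_semigroup N. quadric_deg N u \<le> T} \<subseteq> orthant (N + 3)" using quadric_semigroupD(1) by blast
  show "finite {u \<in> quadric_semigroup N. quadric_deg N u \<le> T}" by (rule orthant_card[OF sub *])
  show "card {u \<in> quadric_semigroup N. quadric_deg N u \<le> T} \<le> (T + 1) ^ (N + 3)" by (rule orthant_card[OF sub *])
qed

text \<open>For fixed \<open>k\<close> the exponents of \<open>s1\<close> and \<open>t1\<close>
  range freely over \<open>{..k}\<close> and determine the others.\<close>

lemma quadric_card_0: "card {u \<in> quadric_semigroup 0. quadric_deg 0 u = k} = (k + 1) ^ 2"
proof -
  define f :: "nat \<times> nat \<Rightarrow> nat \<Rightarrow>\<^sub>0 int" where
    "f = (\<lambda>(a, c). Poly_Mapping.single 0 (int a) + Poly_Mapping.single 1 (int (k - a)) + Poly_Mapping.single 2 (int c))"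
  have l: "Poly_Mapping.lookup (f (a, c)) i = (if i = 0 then int a else if i = 1 then int (k - a) else if i = 2 then int c else 0)" for a c i
    by (auto simp: f_def lookup_add lookup_single when_def simp del: single_of_nat single_one One_nat_def)
  have "{u \<in> quadric_semigroup 0. quadric_deg 0 u = k} = f ` ({..k} \<times> {..k})"
  proof (intro equalityI subsetI)
    fix u assume "u \<in> {u \<in> quadric_semigroup 0. quadric_deg 0 u = k}"
    then have u: "u \<in> quadric_semigroup 0" and d: "quadric_deg 0 u = k" by auto
    note D = quadric_semigroupD[OF u]
    define a where "a = nat (Poly_Mapping.lookup u 0)"
    define c where "c = nat (Poly_Mapping.lookup u 2)"
    have ac: "Poly_Mapping.lookup u 0 = int a" "Poly_Mapping.lookup u 2 = int c" using D(2) by (simp_all add: a_def c_def)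
    have s: "Poly_Mapping.lookup u 0 + Poly_Mapping.lookup u 1 = int k" using d D(2)[of 0] D(2)[of 1] by (simp add: quadric_deg_def)
    have "a \<le> k" "c \<le> k" "Poly_Mapping.lookup u 1 = int (k - a)" using s ac D(4) D(2)[of 1] by auto
    moreover have "u = f (a, c)"
    proof (rule poly_mapping_eqI)
      fix i show "Poly_Mapping.lookup u i = Poly_Mapping.lookup (f (a, c)) i"
        unfolding l using ac \<open>Poly_Mapping.lookup u 1 = int (k - a)\<close> D(3)[of i] by auto
    qed
    ultimately show "u \<in> f ` ({..k} \<times> {..k})" by blast
  next
    fix u assume "u \<in> f ` ({..k} \<times> {..k})"
    then obtain a c where u: "u = f (a, c)" "a \<le> k" "c \<le> k" by auto
    then show "u \<in> {u \<in> quadric_semigroup 0. quadric_deg 0 u = k}"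
      by (auto simp: l quadric_deg_def intro!: quadric_semigroupI)
  qed
  moreover have "inj_on f ({..k} \<times> {..k})"
  proof (rule inj_onI, clarify)
    fix a c a' c' assume eq: "f (a, c) = f (a', c')"
    have "Poly_Mapping.lookup (f (a, c)) 0 = Poly_Mapping.lookup (f (a', c')) 0"
      "Poly_Mapping.lookup (f (a, c)) 2 = Poly_Mapping.lookup (f (a', c')) 2" using eq by simp_all
    then show "a = a' \<and> c = c'" by (simp add: l)
  qed
  ultimately show ?thesis by (simp add: card_image power2_eq_square)
qed

text \<open>The new free coordinate takes the degree \<open>k - m\<close> left over by the
  others.\<close>

lemma quadric_card_Suc:
  "card {u \<in> quadric_semigroup (Suc N). quadric_deg (Suc N) u = k} = (\<Sum>m\<le>k. card {u \<in> quadric_semigroup N. quadric_deg N u = m})"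
proof -
  let ?A = "\<lambda>N k. {u \<in> quadric_semigroup N. quadric_deg N u = k}"
  define f where "f = (\<lambda>(m, u). u + Poly_Mapping.single (N + 3) (int (k - m)))"
  have l: "Poly_Mapping.lookup (f (m, u)) i = Poly_Mapping.lookup u i + (if i = N + 3 then int (k - m) else 0)" for m u i
    by (simp add: f_def lookup_add lookup_single when_def)
  have "?A (Suc N) k = f ` (SIGMA m:{..k}. ?A N m)"
  proof (intro equalityI subsetI)
    fix u assume "u \<in> ?A (Suc N) k"
    then have u: "u \<in> quadric_semigroup (Suc N)" and d: "quadric_deg (Suc N) u = k" by auto
    note D = quadric_semigroupD[OF u]
    define b where "b = nat (Poly_Mapping.lookup u (N + 3))"
    have b: "Poly_Mapping.lookup u (N + 3) = int b" using D(2) by (simp add: b_def)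
    let ?v = "u - Poly_Mapping.single (N + 3) (int b)"
    have lv: "Poly_Mapping.lookup ?v i = (if i = N + 3 then 0 else Poly_Mapping.lookup u i)" for i
      using b by (simp add: lookup_minus lookup_single when_def)
    have v: "?v \<in> quadric_semigroup N"
    proof (rule quadric_semigroupI)
      show "0 \<le> Poly_Mapping.lookup ?v i" for i using D(2)[of i] by (simp add: lv)
      show "Poly_Mapping.lookup ?v i = 0" if "N + 3 \<le> i" for i using D(3)[of i] that by (simp add: lv)
    qed (use D(4) in \<open>simp add: lv\<close>)
    have "k = quadric_deg N ?v + b"
      unfolding d[symmetric] quadric_deg_eq[OF u] quadric_deg_eq[OF v] by (simp add: lv b add.commute)
    then have "(k - b, ?v) \<in> (SIGMA m:{..k}. ?A N m)" "u = f (k - b, ?v)" using v by (auto simp: f_def)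
    then show "u \<in> f ` (SIGMA m:{..k}. ?A N m)" by blast
  next
    fix u assume "u \<in> f ` (SIGMA m:{..k}. ?A N m)"
    then obtain v m where v: "v \<in> quadric_semigroup N" "m = quadric_deg N v" "m \<le> k" "u = f (m, v)" by auto
    note D = quadric_semigroupD[OF v(1)]
    have u: "u \<in> quadric_semigroup (Suc N)"
      unfolding v(4) using D by (intro quadric_semigroupI) (auto simp: l)
    have "quadric_deg (Suc N) u = quadric_deg N v + (k - m)"
      unfolding quadric_deg_eq[OF u] quadric_deg_eq[OF v(1)] unfolding v(4) using D(3)[of "N + 3"] by (simp add: l add.commute)
    then show "u \<in> ?A (Suc N) k" using u v by simp
  qed
  moreover have "inj_on f (SIGMA m:{..k}. ?A N m)"
  proof (rule inj_onI)
    fix x y assume xy: "x \<in> (SIGMA m:{..k}. ?A N m)" "y \<in> (SIGMA m:{..k}. ?A N m)" "f x = f y"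
    then obtain u v where u: "u \<in> quadric_semigroup N" and v: "v \<in> quadric_semigroup N"
      and x: "x = (quadric_deg N u, u)" and y: "y = (quadric_deg N v, v)" by auto
    have eq: "f (quadric_deg N u, u) = f (quadric_deg N v, v)" using xy(3) x y by simp
    have "Poly_Mapping.lookup u i = Poly_Mapping.lookup v i" for i
    proof (cases "i = N + 3")
      case True
      then show ?thesis using quadric_semigroupD(3)[OF u, of i] quadric_semigroupD(3)[OF v, of i] by simp
    next
      case False
      have "Poly_Mapping.lookup (f (quadric_deg N u, u)) i = Poly_Mapping.lookup (f (quadric_deg N v, v)) i" using eq by simp
      then show ?thesis using False by (simp add: l)
    qed
    then have "u = v" by (rule poly_mapping_eqI)
    then show "x = y" using x y by simp
  qed
  moreover have "finite (?A N m)" for m by (rule finite_subset[OF _ quadric_bound(1)[of N m]]) auto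
  ultimately show ?thesis by (simp add: card_image card_SigmaI)
qed

text \<open>The Hilbert series of the quadric cone is \<open>(1 + x) / (1 - x)^3\<close>, and every
  free coordinate contributes a factor \<open>1 / (1 - x)\<close>; the two binomials come from the
  terms \<open>1\<close> and \<open>x\<close> of the numerator.\<close>

lemma quadric_card:
  "card {u \<in> quadric_semigroup N. quadric_deg N u = k} = (k + N + 2 choose (N + 2)) + (k + N + 1 choose (N + 2))"
proof (induction N arbitrary: k)
  case 0
  have "(Suc (Suc k) choose Suc (Suc 0)) + (Suc k choose Suc (Suc 0)) = Suc k * Suc k"
    by (induction k) simp_all
  then show ?case unfolding quadric_card_0 by (simp add: power2_eq_square numeral_2_eq_2)
next
  case (Suc N)
  have "(\<Sum>m\<le>k. (m + N + 2 choose (N + 2)) + (m + N + 1 choose (N + 2))) = (k + N + 3 choose (N + 3)) + (k + N + 2 choose (N + 3))"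
  proof (induction k)
    case (Suc k)
    \<comment> \<open>Pascal's rule makes the sums of both binomials telescope.\<close>
    have "Suc k + N + 3 = Suc (k + N + 3)" "Suc k + N + 2 = Suc (k + N + 2)" "N + 3 = Suc (N + 2)" by simp_all
    then have p: "(Suc k + N + 3 choose (N + 3)) = (k + N + 3 choose (N + 2)) + (k + N + 3 choose (N + 3))"
      "(Suc k + N + 2 choose (N + 3)) = (k + N + 2 choose (N + 2)) + (k + N + 2 choose (N + 3))"
      by (simp_all only: binomial_Suc_Suc)
    have q: "Suc k + N + 2 = k + N + 3" "Suc k + N + 1 = k + N + 2" by simp_all
    show ?case unfolding sum.atMost_Suc Suc p unfolding q by simp
  qed (simp add: binomial_eq_0)
  then show ?case unfolding quadric_card_Suc Suc.IH by (simp add: numeral_3_eq_3)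
qed

section \<open>The Hilbert polynomial\<close>

text \<open>Polynomials that agree at all large integers are equal, which makes the description in
  \<open>hilbert_poly\<close> unique.\<close>

lemma hilbert_poly_eqI:
  fixes p :: "rat poly"
  assumes "\<And>k. poly p (of_nat k) = of_nat (hilbert_function R I k)"
  shows "hilbert_poly R I = p"
  unfolding hilbert_poly_def
proof (rule the_equality)
  show "\<exists>k0. \<forall>k\<ge>k0. poly p (of_nat k) = of_nat (hilbert_function R I k)" using assms by blast
next
  fix q :: "rat poly" assume "\<exists>k0. \<forall>k\<ge>k0. poly q (of_nat k) = of_nat (hilbert_function R I k)"
  then obtain k0 where k0: "\<forall>k\<ge>k0. poly q (of_nat k) = of_nat (hilbert_function R I k)" by blast
  show "q = p"
  proof (rule ccontr)
    assume "q \<noteq> p"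
    then have "finite {x. poly (q - p) x = 0}" by (intro poly_roots_finite) simp
    moreover have "of_nat ` {k0..} \<subseteq> {x. poly (q - p) x = 0}" using k0 assms by auto
    ultimately have "finite (of_nat ` {k0..} :: rat set)" by (rule finite_subset[rotated])
    then have "finite {k0..}" by (rule finite_imageD) (simp add: inj_on_def)
    then show False using infinite_Ici by blast
  qed
qed

text \<open>The polynomial in \<open>x\<close> given by \<open>x + s\<close> choose
  \<open>r\<close>.\<close>

definition binomial_poly :: "nat \<Rightarrow> nat \<Rightarrow> rat poly" where
  "binomial_poly s r = Polynomial.smult (1 / fact r) (\<Prod>i<r. [:of_nat s - of_nat i, 1:])"

lemma poly_binomial_poly: "poly (binomial_poly s r) (of_nat k) = of_nat (k + s choose r)"
proof -
  have "poly (binomial_poly s r) (of_nat k) = (\<Prod>i<r. of_nat (k + s) - of_nat i) / fact r"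
    by (simp add: binomial_poly_def poly_prod algebra_simps)
  also have "\<dots> = (of_nat (k + s) :: rat) gchoose r"
    by (simp add: gbinomial_prod_rev atLeast0LessThan)
  finally show ?thesis by (simp only: binomial_gbinomial)
qed

lemma binomial_poly_degree: "degree (binomial_poly s r) \<le> r" and binomial_poly_coeff: "Polynomial.coeff (binomial_poly s r) r = 1 / fact r"
proof -
  let ?p = "\<Prod>i<r. [:of_nat s - of_nat i, 1:] :: rat poly"
  have d: "degree ?p = (\<Sum>i<r. degree [:of_nat s - of_nat i, 1 :: rat:])" by (rule degree_prod_eq_sum_degree) simp
  then have d: "degree ?p = r" by simp
  have "lead_coeff ?p = (\<Prod>i<r. lead_coeff [:of_nat s - of_nat i, 1 :: rat:])" by (rule lead_coeff_prod)
  then have "lead_coeff ?p = 1" by simp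
  then show "degree (binomial_poly s r) \<le> r" "Polynomial.coeff (binomial_poly s r) r = 1 / fact r"
    using d unfolding binomial_poly_def by (simp_all add: degree_smult_eq)
qed

theorem quadric_chart:
  fixes X :: "('v \<Rightarrow> 'k::alg_closed_field) set" and N :: nat
  assumes "local_chart X P (quadric_product N) g \<phi>"
  shows "P \<in> Sing X" "alg_isomorphic (tangent_cone X P) (coord_ring (quadric_product N :: (nat + nat \<Rightarrow> 'k) set))"
    "alg_isomorphic (tangent_cone X P) (semigroup_algebra (quadric_semigroup N) :: ('k, _) module)"
    "multiplicity_at X P = 2"
proof -
  interpret local_chart X P "quadric_product N" g \<phi> by (rule assms)
  interpret monomial_cone "quadric_semigroup N" "quadric_deg N" "Inl ` {1..4} \<union> Inr ` {..<N}" "quadric_product N"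
    "quadric_mon N :: (nat \<Rightarrow>\<^sub>0 int) \<Rightarrow> (nat + nat \<Rightarrow> 'k) \<Rightarrow> 'k" quadric_var
    by (rule monomial_cone_quadric)
  interpret chart_on_cone X P "quadric_product N" g \<phi> "quadric_semigroup N" "quadric_deg N" "Inl ` {1..4} \<union> Inr ` {..<N}"
    "quadric_mon N :: (nat \<Rightarrow>\<^sub>0 int) \<Rightarrow> (nat + nat \<Rightarrow> 'k) \<Rightarrow> 'k" quadric_var
    by unfold_locales
  have fin: "finite {u \<in> quadric_semigroup N. quadric_deg N u = k}" for k
    by (rule finite_subset[OF _ quadric_bound(1)[of N k]]) auto
  have H: "hilbert_function \<O> \<mm> k = (k + N + 2 choose (N + 2)) + (k + N + 1 choose (N + 2))" for k
    unfolding G.hilbert_function_eq[OF fin] by (rule quadric_card)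
  have "krull_dim \<O> \<le> enat (N + 3)" using quadric_bound by (rule krull_dim_local_ring_le)
  moreover have "hilbert_function \<O> \<mm> 1 = N + 4"
  proof -
    have "1 + N + 2 = Suc (N + 2)" "1 + N + 1 = N + 2" by simp_all
    then show ?thesis unfolding H by (simp only: binomial_Suc_n binomial_n_n)
  qed
  ultimately have "\<not> regular_local \<O> \<mm>"
    unfolding regular_local_def by (auto simp del: One_nat_def dest!: sym[of _ "krull_dim \<O>"])
  then show "P \<in> Sing X" using P_in unfolding Sing_def by blast
  show "alg_isomorphic (tangent_cone X P) (coord_ring (quadric_product N :: (nat + nat \<Rightarrow> 'k) set))"
    unfolding tangent_cone_def by (rule gr_iso_coord_ring)
  show "alg_isomorphic (tangent_cone X P) (semigroup_algebra (quadric_semigroup N) :: ('k, _) module)"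
    unfolding tangent_cone_def by (rule gr_iso_semigroup)
  \<comment> \<open>Stage 0 is the whole cone. Stage 1 is the plane \<open>x1 = x2 = 0\<close> of
    the quadric, times the affine space; there \<open>s2\<close> is set to 1, so that
    \<open>t1\<close>, \<open>t2\<close> become coordinates. Later stages set one more parameter to
    zero each, which makes \<open>N + 3\<close> strict inclusions.\<close>
  define \<sigma> where "\<sigma> i z j = (if j = 0 then (if i = 0 then z 0 else 0) else if j = 1 then (if i = 0 then z 1 else 1)
    else if i < j then z j else 0)" for i :: nat and z :: "nat \<Rightarrow> 'k" and j :: nat
  have "enat (N + 3) \<le> krull_dim (coord_ring (quadric_product N :: (nat + nat \<Rightarrow> 'k) set))"
  proof (rule krull_dim_coord_ring_ge[of "\<lambda>i z. quadric_param N (\<sigma> i z)"])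
    have \<sigma>_poly: "(\<lambda>z. \<sigma> i z j) \<in> polyfun" for i j
      unfolding \<sigma>_def by (cases "j = 0"; cases "j = 1"; cases "i = 0"; cases "i < j") (simp_all add: polyfun.intros)
    show "(\<lambda>z. quadric_param N (\<sigma> i z) v) \<in> polyfun" for i v
    proof (cases v)
      case (Inl l)
      then show ?thesis by (cases "l = 1"; cases "l = 2"; cases "l = 3"; cases "l = 4")
        (simp_all add: quadric_param_def polyfun.mult polyfun.const \<sigma>_poly del: One_nat_def)
    next
      case (Inr l)
      then show ?thesis by (cases "l < N") (simp_all add: quadric_param_def polyfun.const \<sigma>_poly)
    qed
    show "quadric_param N (\<sigma> i z) \<in> quadric_product N" for i z by (rule quadric_param_in)
    show "\<exists>z'. quadric_param N (\<sigma> (Suc i) z) = quadric_param N (\<sigma> i z')" for i z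
    proof -
      have "\<sigma> i (\<sigma> (Suc i) z) = \<sigma> (Suc i) z" by (rule ext) (auto simp: \<sigma>_def)
      then show ?thesis by metis
    qed
    fix i assume i: "i < N + 3"
    \<comment> \<open>The coordinate lost at this stage: \<open>x2\<close>, \<open>x3\<close>,
      \<open>x4\<close>, then the free ones in order.\<close>
    let ?v = "if i < 3 then Inl (i + 2) else Inr (i - 3)"
    have "quadric_param N (\<sigma> (Suc i) z) ?v = 0" for z
      using i by (auto simp: quadric_param_def \<sigma>_def)
    moreover have "quadric_param N (\<sigma> i (\<lambda>_. 1)) ?v \<noteq> 0"
      using i by (auto simp: quadric_param_def \<sigma>_def)
    ultimately show "\<exists>v. (\<forall>z. quadric_param N (\<sigma> (Suc i) z) v = 0) \<and> (\<exists>z. quadric_param N (\<sigma> i z) v \<noteq> 0)"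
      by blast
  qed
  also have "\<dots> \<le> krull_dim (gr \<O> \<mm>)" by (rule krull_dim_coord_ring_le_gr)
  finally have ge: "enat (N + 3) \<le> krull_dim (gr \<O> \<mm>)" .
  have "krull_dim (gr \<O> \<mm>) \<le> enat (N + 3)" using quadric_bound by (rule krull_dim_gr_le)
  with ge have dim: "krull_dim (gr \<O> \<mm>) = enat (N + 3)" by (rule antisym[rotated])
  let ?p = "binomial_poly (N + 2) (N + 2) + binomial_poly (N + 1) (N + 2)"
  have hp: "hilbert_poly \<O> \<mm> = ?p"
    by (rule hilbert_poly_eqI) (simp only: poly_add poly_binomial_poly H of_nat_add[symmetric] add.assoc)
  \<comment> \<open>Each binomial contributes \<open>1 / fact (N + 2)\<close>, whence the
    multiplicity 2.\<close>
  have c: "Polynomial.coeff ?p (N + 2) = 2 / fact (N + 2)" by (simp only: coeff_add binomial_poly_coeff)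
  have "degree ?p \<le> N + 2" by (intro degree_add_le binomial_poly_degree)
  moreover have "Polynomial.coeff ?p (N + 2) \<noteq> 0" unfolding c by simp
  then have "N + 2 \<le> degree ?p" by (rule le_degree)
  ultimately have lc: "lead_coeff ?p = 2 / fact (N + 2)" using c by (metis antisym)
  show "multiplicity_at X P = 2"
    unfolding multiplicity_at_def gr_degree_def hp lc dim
  proof (rule the_equality)
    show "\<exists>r. enat (N + 3) = enat (r + 1) \<and> 2 / fact (N + 2) = 2 / (fact r :: rat)" by (intro exI[of _ "N + 2"]) simp
  next
    fix e :: rat assume "\<exists>r. enat (N + 3) = enat (r + 1) \<and> 2 / fact (N + 2) = e / fact r"
    then obtain r where "r = N + 2" "2 / fact (N + 2) = e / fact r" by auto
    then have "2 / fact (N + 2) = e / fact (N + 2)" by simp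
    moreover have "fact (N + 2) \<noteq> (0 :: rat)" by (rule fact_nonzero)
    ultimately show "e = 2" by (simp only: divide_cancel_right) auto
  qed
qed

section \<open>The tangent cone is toric\<close>

lemma quadric_semigroup_toric:
  assumes "alg_isomorphic A (semigroup_algebra (quadric_semigroup N) :: ('k::field, _) module)"
  shows "affine_toric A"
proof -
  \<comment> \<open>Pairing with \<open>h\<close> is the inequality that defines the semigroup; the
    unit vectors give nonnegativity of the entries.\<close>
  define h :: "nat \<Rightarrow> real" where "h = (\<lambda>z. unit_vec 0 z + unit_vec 1 z - unit_vec 2 z)"
  define G where "G = insert h (unit_vec ` {..<N + 3})"
  have finG: "finite G" unfolding G_def by simp
  have cone: "cone_gen G = {\<lambda>z. \<Sum>g\<in>G. c g * g z | c. \<forall>g\<in>G. 0 \<le> c g}" by (simp add: cone_gen_def)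
  have gen: "g \<in> cone_gen G" if "g \<in> G" for g
  proof -
    have "(\<Sum>g'\<in>G. (if g' = g then 1 else 0) * g' z) = g z" for z
    proof -
      have "(\<Sum>g'\<in>G. (if g' = g then 1 else 0) * g' z) = (\<Sum>g'\<in>G. if g' = g then g' z else 0)"
        by (rule sum.cong) auto
      then show ?thesis using finG that by simp
    qed
    then show ?thesis unfolding cone by (intro CollectI exI[of _ "\<lambda>g'. if g' = g then 1 else 0"]) auto
  qed
  have nonneg: "0 \<le> (\<Sum>z\<in>{..<N + 3}. u z * v z)" if v: "v \<in> cone_gen G" and "\<And>g. g \<in> G \<Longrightarrow> 0 \<le> (\<Sum>z\<in>{..<N + 3}. u z * g z)" for u v
  proof -
    obtain c where c: "v = (\<lambda>z. \<Sum>g\<in>G. c g * g z)" "\<forall>g\<in>G. 0 \<le> c g" using v unfolding cone by blast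
    have "(\<Sum>z\<in>{..<N + 3}. u z * v z) = (\<Sum>g\<in>G. c g * (\<Sum>z\<in>{..<N + 3}. u z * g z))"
      unfolding c(1) sum_distrib_left by (subst sum.swap) (simp add: mult_ac)
    also have "\<dots> \<ge> 0" by (rule sum_nonneg) (use c(2) that(2) in \<open>simp add: mult_nonneg_nonneg\<close>)
    finally show ?thesis .
  qed
  have unit: "(\<Sum>z\<in>{..<N + 3}. u z * unit_vec i z) = u i" if "i < N + 3" for u :: "nat \<Rightarrow> real" and i
  proof -
    have "(\<Sum>z\<in>{..<N + 3}. u z * unit_vec i z) = (\<Sum>z\<in>{..<N + 3}. if z = i then u z else 0)"
      by (rule sum.cong) (auto simp: unit_vec_def)
    then show ?thesis using that by simp
  qed
  have pair_h: "(\<Sum>z\<in>{..<N + 3}. u z * h z) = u 0 + u 1 - u 2" for u :: "nat \<Rightarrow> real"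
    using unit[of 0 u] unit[of 1 u] unit[of 2 u] by (simp add: h_def algebra_simps sum.distrib sum_subtractf)
  have S: "dual_semigroup {..<N + 3} (cone_gen G) = quadric_semigroup N"
  proof (intro equalityI subsetI)
    fix u assume u: "u \<in> dual_semigroup {..<N + 3} (cone_gen G)"
    then have k: "Poly_Mapping.keys u \<subseteq> {..<N + 3}"
      and n: "\<And>v. v \<in> cone_gen G \<Longrightarrow> 0 \<le> (\<Sum>z\<in>{..<N + 3}. of_int (Poly_Mapping.lookup u z) * v z)"
      unfolding dual_semigroup_def pairing_def by auto
    have z: "Poly_Mapping.lookup u i = 0" if "N + 3 \<le> i" for i using k that by (metis in_keys_iff lessThan_iff not_le subsetD)
    have nn: "0 \<le> Poly_Mapping.lookup u i" for i
    proof (cases "i < N + 3")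
      case True
      then have "unit_vec i \<in> G" unfolding G_def by blast
      from n[OF gen[OF this]] show ?thesis unfolding unit[OF True] by simp
    qed (use z in simp)
    have "h \<in> G" unfolding G_def by simp
    from n[OF gen[OF this]] have "(0 :: real) \<le> of_int (Poly_Mapping.lookup u 0 + Poly_Mapping.lookup u 1 - Poly_Mapping.lookup u 2)"
      unfolding pair_h by simp
    then have "0 \<le> Poly_Mapping.lookup u 0 + Poly_Mapping.lookup u 1 - Poly_Mapping.lookup u 2" by (simp only: of_int_0_le_iff)
    then show "u \<in> quadric_semigroup N" using nn z by (intro quadric_semigroupI) auto
  next
    fix u assume u: "u \<in> quadric_semigroup N"
    note D = quadric_semigroupD[OF u]
    have "Poly_Mapping.keys u \<subseteq> {..<N + 3}" using D(1) unfolding orthant_def by blast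
    moreover have "0 \<le> (\<Sum>z\<in>{..<N + 3}. real_of_int (Poly_Mapping.lookup u z) * v z)" if "v \<in> cone_gen G" for v
    proof (rule nonneg[OF that])
      fix g assume "g \<in> G"
      then consider "g = h" | i where "i < N + 3" "g = unit_vec i" unfolding G_def by auto
      then show "0 \<le> (\<Sum>z\<in>{..<N + 3}. real_of_int (Poly_Mapping.lookup u z) * g z)"
      proof cases
        case 1
        have "0 \<le> real_of_int (Poly_Mapping.lookup u 0 + Poly_Mapping.lookup u 1 - Poly_Mapping.lookup u 2)" using D(4) by simp
        then show ?thesis unfolding 1 pair_h by simp
      next
        case 2
        then show ?thesis using D(2)[of i] by (simp add: unit)
      qed
    qed
    ultimately show "u \<in> dual_semigroup {..<N + 3} (cone_gen G)" unfolding dual_semigroup_def pairing_def by blast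
  qed
  have convex: "v = (\<lambda>z. 0)" if v: "v \<in> cone_gen G" "(\<lambda>z. - v z) \<in> cone_gen G" for v
  proof -
    \<comment> \<open>The coordinates other than 2, and the sum of coordinates 0 and 2, are
      nonnegative on all generators and have only 0 as common zero; hence the cone contains no
      line.\<close>
    have pos: "0 \<le> w i" "0 \<le> w 0 + w 2" if w: "w \<in> cone_gen G" and "i \<noteq> 2" for w i
    proof -
      obtain c where c: "w = (\<lambda>z. \<Sum>g\<in>G. c g * g z)" "\<forall>g\<in>G. 0 \<le> c g" using w unfolding cone by blast
      have "0 \<le> g i" "0 \<le> g 0 + g 2" if "g \<in> G" for g
        using that \<open>i \<noteq> 2\<close> unfolding G_def h_def by (auto simp: unit_vec_def)
      then have "0 \<le> (\<Sum>g\<in>G. c g * g i)" "0 \<le> (\<Sum>g\<in>G. c g * (g 0 + g 2))" using c(2) by (auto intro!: sum_nonneg mult_nonneg_nonneg)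
      then show "0 \<le> w i" "0 \<le> w 0 + w 2" unfolding c(1) by (simp_all add: distrib_left sum.distrib)
    qed
    have "v i = 0" if "i \<noteq> 2" for i using pos(1)[OF v(1) that] pos(1)[OF v(2) that] by simp
    moreover have "v 0 + v 2 = 0" using pos(2)[OF v(1), of 0] pos(2)[OF v(2), of 0] by simp
    ultimately have "v i = 0" for i by (cases "i = 2") auto
    then show ?thesis by blast
  qed
  have int: "g z \<in> \<int> \<and> (z \<ge> N + 3 \<longrightarrow> g z = 0)" if "g \<in> G" for g z
    using that unfolding G_def h_def by (auto simp: unit_vec_def)
  show ?thesis
    unfolding affine_toric_def
    using finG int convex assms unfolding S[symmetric] by (intro exI[of _ "N + 3"] exI[of _ G]) blast
qed

section \<open>Maps with regular coordinates\<close>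

text \<open>Both conditions on a morphism can be tested point by point, where they follow by
  composition with regular coordinates.\<close>

lemma variety_morphismI:
  assumes into: "\<And>x. x \<in> X \<Longrightarrow> \<phi> x \<in> Y" and reg: "\<And>P v. P \<in> X \<Longrightarrow> regular_at X P (\<lambda>x. \<phi> x v)"
  shows "variety_morphism X Y \<phi>"
  unfolding variety_morphism_def
proof (intro conjI allI impI)
  have near: "eventually (\<lambda>x. \<phi> x \<in> Y) (znhds X P)" for P
    using eventually_znhds_in by (rule eventually_mono) (rule into)
  have top: "topspace (subtopology zariski X) = X" "topspace (subtopology zariski Y) = Y" by (simp_all add: topspace_zariski)
  show "continuous_map (subtopology zariski X) (subtopology zariski Y) \<phi>"
    unfolding continuous_map_def top
  proof (intro conjI allI impI)
    show "\<phi> \<in> X \<rightarrow> Y" using into by blast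
    fix U assume U: "openin (subtopology zariski Y) U"
    show "openin (subtopology zariski X) {x \<in> X. \<phi> x \<in> U}"
    proof (subst openin_subopen, intro ballI)
      fix P assume P: "P \<in> {x \<in> X. \<phi> x \<in> U}"
      then have "eventually (\<lambda>y. y \<in> U) (znhds Y (\<phi> P))"
        using U into by (subst ex_open_iff_eventually[symmetric]) auto
      then have "eventually (\<lambda>x. \<phi> x \<in> U) (znhds X P)"
        using P by (intro eventually_znhds_compose[OF _ reg near]) auto
      then obtain T where T: "openin (subtopology zariski X) T" "P \<in> T" "\<forall>x\<in>T. \<phi> x \<in> U"
        using ex_open_iff_eventually[of P X "\<lambda>x. \<phi> x \<in> U"] P by blast
      have "T \<subseteq> X" using openin_subset[OF T(1)] by (simp only: top)
      then show "\<exists>T. openin (subtopology zariski X) T \<and> P \<in> T \<and> T \<subseteq> {x \<in> X. \<phi> x \<in> U}"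
        using T by (intro exI[of _ T]) blast
    qed
  qed
  fix V f assume V: "openin (subtopology zariski Y) V \<and> regular_on Y V f"
  show "regular_on X (X \<inter> \<phi> -` V) (f \<circ> \<phi>)"
    unfolding regular_on_def
  proof
    fix P assume P: "P \<in> X \<inter> \<phi> -` V"
    then have "regular_at Y (\<phi> P) f" using V unfolding regular_on_def by blast
    then show "regular_at X P (f \<circ> \<phi>)"
      using regular_at_compose[OF _ reg near, of P f] P by (simp add: o_def)
  qed
qed

lemma variety_isomorphismI:
  assumes "\<And>x. x \<in> X \<Longrightarrow> \<phi> x \<in> Y" "\<And>P v. P \<in> X \<Longrightarrow> regular_at X P (\<lambda>x. \<phi> x v)"
    "\<And>y. y \<in> Y \<Longrightarrow> \<psi> y \<in> X" "\<And>P v. P \<in> Y \<Longrightarrow> regular_at Y P (\<lambda>y. \<psi> y v)"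
    "\<And>x. x \<in> X \<Longrightarrow> \<psi> (\<phi> x) = x" "\<And>y. y \<in> Y \<Longrightarrow> \<phi> (\<psi> y) = y"
  shows "variety_isomorphism X Y \<phi>"
  unfolding variety_isomorphism_def
  using variety_morphismI[of X \<phi> Y] variety_morphismI[of Y \<psi> X] assms by blast

section \<open>A square in a finite poset\<close>

lemma Diff_insert_remove: "b \<in> A \<Longrightarrow> b \<notin> S \<Longrightarrow> A - S = insert b ((A - {b}) - S)"
  by blast

text \<open>The interval from \<open>p\<close> to \<open>t\<close> consists of exactly the four
  elements of the square. The local structure depends only on this, so the grid does not appear
  until \<open>tuple_square\<close>.\<close>

locale poset_square =
  fixes Q :: "'q set" and le :: "'q \<Rightarrow> 'q \<Rightarrow> bool" and p q1 q2 t :: 'q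
  assumes finite_Q: "finite Q"
    and le_refl: "x \<in> Q \<Longrightarrow> le x x"
    and le_antisym: "x \<in> Q \<Longrightarrow> y \<in> Q \<Longrightarrow> le x y \<Longrightarrow> le y x \<Longrightarrow> x = y"
    and le_trans: "x \<in> Q \<Longrightarrow> y \<in> Q \<Longrightarrow> z \<in> Q \<Longrightarrow> le x y \<Longrightarrow> le y z \<Longrightarrow> le x z"
    and sq_Q: "p \<in> Q" "q1 \<in> Q" "q2 \<in> Q" "t \<in> Q"
    and sq_le: "le p q1" "le p q2" "le q1 t" "le q2 t"
    and incomparable: "\<not> le q1 q2" "\<not> le q2 q1"
    and between: "x \<in> Q \<Longrightarrow> le p x \<Longrightarrow> le x t \<Longrightarrow> x \<in> {p, q1, q2, t}"
begin

abbreviation "sq \<equiv> {p, q1, q2, t}"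

definition downset :: "'q set \<Rightarrow> bool" where
  "downset A \<longleftrightarrow> A \<subseteq> Q \<and> (\<forall>x\<in>A. \<forall>y\<in>Q. le y x \<longrightarrow> y \<in> A)"

definition down :: "'q \<Rightarrow> 'q set" where "down b = {y \<in> Q. le y b}"

text \<open>The reference ideal for the square: every order ideal of the square can be added to it,
  and adding the whole square gives \<open>down t\<close>.\<close>

definition base :: "'q set" where "base = down t - sq"

text \<open>A downset with maximal element \<open>b\<close> in which, as well as in its complement at \<open>b\<close>, the square
  is either absent or complete.\<close>

definition up :: "'q \<Rightarrow> 'q set" where "up b = (if le p b then down b \<union> down t else down b)"

text \<open>For an order ideal this says that the square, with bottom \<open>p\<close> and top
  \<open>t\<close>, is absent or complete. These ideals index the coordinates that are nonzero at
  the vertex.\<close>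

definition full :: "'q set \<Rightarrow> bool" where "full A \<longleftrightarrow> p \<notin> A \<or> t \<in> A"

lemma le_pt: "le p t" using le_trans[OF sq_Q(1,2,4) sq_le(1,3)] .

lemma sq_distinct: "p \<noteq> q1" "p \<noteq> q2" "p \<noteq> t" "q1 \<noteq> q2" "q1 \<noteq> t" "q2 \<noteq> t"
  using incomparable sq_le le_refl sq_Q le_antisym by metis+

lemma downsetD: "downset A \<Longrightarrow> x \<in> A \<Longrightarrow> y \<in> Q \<Longrightarrow> le y x \<Longrightarrow> y \<in> A"
  unfolding downset_def by blast

lemma downset_sub: "downset A \<Longrightarrow> A \<subseteq> Q" unfolding downset_def by blast

lemma downset_finite: "downset A \<Longrightarrow> finite A" using finite_Q downset_sub finite_subset by blast

lemma downset_Un: "downset A \<Longrightarrow> downset B \<Longrightarrow> downset (A \<union> B)"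
  and downset_Int: "downset A \<Longrightarrow> downset B \<Longrightarrow> downset (A \<inter> B)"
  unfolding downset_def by blast+

lemma downset_empty: "downset {}" unfolding downset_def by blast

lemma downset_down: "b \<in> Q \<Longrightarrow> downset (down b)"
  unfolding downset_def down_def using le_trans by blast

lemma downset_sq:
  assumes "downset A"
  shows "q1 \<in> A \<Longrightarrow> p \<in> A" "q2 \<in> A \<Longrightarrow> p \<in> A" "t \<in> A \<Longrightarrow> q1 \<in> A" "t \<in> A \<Longrightarrow> q2 \<in> A" "t \<in> A \<Longrightarrow> p \<in> A"
  using downsetD[OF assms] sq_Q sq_le le_pt by blast+

lemma sq_down: "sq \<subseteq> down t"
  unfolding down_def using sq_Q sq_le le_pt le_refl by blast

lemma sq_shape:
  assumes "downset A"
  shows "p \<notin> A \<and> q1 \<notin> A \<and> q2 \<notin> A \<and> t \<notin> A \<or> p \<in> A \<and> q1 \<notin> A \<and> q2 \<notin> A \<and> t \<notin> A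
    \<or> p \<in> A \<and> q1 \<in> A \<and> q2 \<notin> A \<and> t \<notin> A \<or> p \<in> A \<and> q1 \<notin> A \<and> q2 \<in> A \<and> t \<notin> A
    \<or> p \<in> A \<and> q1 \<in> A \<and> q2 \<in> A \<and> t \<notin> A \<or> p \<in> A \<and> q1 \<in> A \<and> q2 \<in> A \<and> t \<in> A"
  using downset_sq[OF assms] by blast

lemma p_le_sq: "x \<in> sq \<Longrightarrow> le p x" "x \<in> sq \<Longrightarrow> le x t"
  using sq_Q sq_le le_pt le_refl by blast+

lemma down_t: "down t = base \<union> sq" unfolding base_def using sq_down by blast

text \<open>An element of \<open>base\<close> above an element of the square would lie between
  \<open>p\<close> and \<open>t\<close>, hence in the square.\<close>

lemma downset_base_Un:
  assumes "T \<subseteq> sq" "\<And>x y. x \<in> T \<Longrightarrow> y \<in> sq \<Longrightarrow> le y x \<Longrightarrow> y \<in> T"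
  shows "downset (base \<union> T)"
  unfolding downset_def
proof (intro conjI ballI impI)
  have TQ: "T \<subseteq> Q" using assms(1) sq_Q by blast
  then show "base \<union> T \<subseteq> Q" unfolding base_def down_def by blast
  fix x y assume x: "x \<in> base \<union> T" and y: "y \<in> Q" "le y x"
  have xQ: "x \<in> Q" "le x t" using x assms(1) p_le_sq(2) TQ unfolding base_def down_def by blast+
  then have yt: "y \<in> down t" unfolding down_def using y le_trans sq_Q(4) by blast
  show "y \<in> base \<union> T"
  proof (cases "y \<in> sq")
    case True
    have "x \<in> T"
    proof (rule ccontr)
      assume "x \<notin> T"
      then have "x \<in> base" using x by blast
      moreover have "le p x" using le_trans[OF sq_Q(1) y(1) xQ(1) p_le_sq(1)[OF True] y(2)] .
      ultimately show False using between[OF xQ(1) _ xQ(2)] unfolding base_def by blast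
    qed
    then show ?thesis using assms(2) True y(2) by blast
  qed (use yt in \<open>auto simp: base_def\<close>)
qed

lemma downset_base: "downset base" using downset_base_Un[of "{}"] by simp

lemma base_sq: "base \<inter> sq = {}" unfolding base_def by blast

lemma downset_up: "b \<in> Q \<Longrightarrow> downset (up b)"
  unfolding up_def using downset_down downset_Un sq_Q(4) by simp

lemma in_up: "b \<in> Q \<Longrightarrow> b \<in> up b" unfolding up_def down_def using le_refl by simp

lemma ex_maximal_above:
  assumes AQ: "A \<subseteq> Q" shows "a \<in> A \<Longrightarrow> \<exists>m\<in>A. le a m \<and> (\<forall>y\<in>A. le m y \<longrightarrow> y = m)"
proof (induction "card {y \<in> A. le a y}" arbitrary: a rule: less_induct)
  case (less a)
  show ?case
  proof (cases "\<forall>y\<in>A. le a y \<longrightarrow> y = a")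
    case True
    then show ?thesis using less.prems AQ le_refl by blast
  next
    case F: False
    then obtain y where y: "y \<in> A" "le a y" "y \<noteq> a" by blast
    have "{z \<in> A. le y z} \<subset> {z \<in> A. le a z}"
    proof
      show "{z \<in> A. le y z} \<subseteq> {z \<in> A. le a z}" using le_trans y less.prems AQ by blast
      have "a \<in> {z \<in> A. le a z}" "a \<notin> {z \<in> A. le y z}" using less.prems AQ le_refl le_antisym y by blast+
      then show "{z \<in> A. le y z} \<noteq> {z \<in> A. le a z}" by blast
    qed
    moreover have "finite {z \<in> A. le a z}" using finite_subset[OF AQ finite_Q] by simp
    ultimately have "card {z \<in> A. le y z} < card {z \<in> A. le a z}" by (intro psubset_card_mono)
    from less.hyps[OF this y(1)] show ?thesis using le_trans y less.prems AQ by blast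
  qed
qed

text \<open>A maximal element \<open>b\<close> of \<open>A\<close> splits \<open>A\<close> into
  \<open>down b\<close> and \<open>A - {b}\<close>, so a nonempty irreducible ideal is principal.
  The empty ideal counts as irreducible, as the minimum does in
  \<open>join_irreducibles\<close>.\<close>

lemma downset_irreducible_iff:
  assumes A: "downset A"
  shows "(\<forall>B B'. downset B \<longrightarrow> downset B' \<longrightarrow> A = B \<union> B' \<longrightarrow> A = B \<or> A = B') \<longleftrightarrow> A = {} \<or> (\<exists>b\<in>Q. A = down b)"
proof
  assume irr: "\<forall>B B'. downset B \<longrightarrow> downset B' \<longrightarrow> A = B \<union> B' \<longrightarrow> A = B \<or> A = B'"
  show "A = {} \<or> (\<exists>b\<in>Q. A = down b)"
  proof (cases "A = {}")
    case False
    then obtain b where b: "b \<in> A" "\<forall>y\<in>A. le b y \<longrightarrow> y = b" using ex_maximal_above[OF downset_sub[OF A]] by blast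
    have bQ: "b \<in> Q" using b(1) downset_sub[OF A] by blast
    have "downset (A - {b})" using A b(2) unfolding downset_def by blast
    moreover have "A = down b \<union> (A - {b})"
      using downsetD[OF A b(1)] b(1) bQ le_refl[OF bQ] unfolding down_def by blast
    ultimately have "A = down b \<or> A = A - {b}" using irr downset_down[OF bQ] by blast
    then show ?thesis using b(1) bQ by blast
  qed simp
next
  assume "A = {} \<or> (\<exists>b\<in>Q. A = down b)"
  then show "\<forall>B B'. downset B \<longrightarrow> downset B' \<longrightarrow> A = B \<union> B' \<longrightarrow> A = B \<or> A = B'"
  proof
    assume "\<exists>b\<in>Q. A = down b"
    then obtain b where b: "b \<in> Q" "A = down b" by blast
    have "A = B" if "downset B" "b \<in> B" "B \<subseteq> A" for B
      using downsetD[OF that(1,2)] that(3) unfolding b(2) down_def by blast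
    moreover have "b \<in> A" using b le_refl unfolding down_def by blast
    ultimately show ?thesis by blast
  qed blast
qed

lemma down_inj: "a \<in> Q \<Longrightarrow> b \<in> Q \<Longrightarrow> down a = down b \<Longrightarrow> a = b"
  using le_refl le_antisym unfolding down_def by blast

lemma card_irreducible: "card ({{}} \<union> down ` Q) = card Q + 1"
proof -
  have "{} \<notin> down ` Q" using le_refl unfolding down_def by blast
  moreover have "card (down ` Q) = card Q" using down_inj by (intro card_image inj_onI)
  ultimately show ?thesis using finite_Q by simp
qed

lemma downset_Diff_maximal:
  assumes A: "downset A" and max: "\<And>y. y \<in> A \<Longrightarrow> le b y \<Longrightarrow> b \<in> Q \<Longrightarrow> y = b"
  shows "downset (A - {b})"
  using A max unfolding downset_def by blast

text \<open>Completing the square puts nothing above \<open>b\<close>: an element of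
  \<open>down t\<close> above \<open>b\<close> would force \<open>b\<close> into the interval from
  \<open>p\<close> to \<open>t\<close>.\<close>

lemma up_maximal: 
  assumes b: "b \<in> Q" "b \<notin> sq" and y: "y \<in> up b" "le b y" shows "y = b"
proof (cases "y \<in> down b")
  case True
  then show ?thesis using le_antisym[OF _ b(1)] y(2) unfolding down_def by blast
next
  case False
  then have *: "le p b" "y \<in> Q" "le y t" using y(1) unfolding up_def down_def by (auto split: if_splits)
  then have "le b t" using le_trans[OF b(1) *(2) sq_Q(4) y(2)] by blast
  then show ?thesis using between[OF b(1) *(1)] b(2) by blast
qed

lemma downset_up_Diff: "b \<in> Q \<Longrightarrow> b \<notin> sq \<Longrightarrow> downset (up b - {b})"
  using downset_Diff_maximal[OF downset_up] up_maximal by blast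

lemma full_up: "b \<in> Q \<Longrightarrow> b \<notin> sq \<Longrightarrow> full (up b) \<and> full (up b - {b})"
  unfolding full_def up_def down_def using le_refl[OF sq_Q(4)] sq_Q(4) by auto

lemma full_cases: "downset A \<Longrightarrow> full A \<Longrightarrow> A \<inter> sq = {} \<or> sq \<subseteq> A"
  unfolding full_def using downset_sq[of A] by blast

end

section \<open>The local structure of a Hibi variety at a square\<close>

text \<open>\<open>I\<close> identifies the coordinates with order ideals. The boxes outside the
  square are numbered from 2, as the torus coordinates 0 and 1 belong to the empty ideal and to the
  complete square.\<close>

locale hibi_square = poset_square Q le p q1 q2 t
  for Q :: "'q set" and le p q1 q2 t +
  fixes C :: "'a set" and I :: "'a \<Rightarrow> 'q set" and X :: "('a \<Rightarrow> 'k::alg_closed_field) set" and ix :: "'q \<Rightarrow> nat" and N :: nat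
  assumes bij_I: "bij_betw I C {A. downset A}"
    and X_iff: "x \<in> X \<longleftrightarrow> x \<in> affine_space C \<and> (\<forall>\<alpha>\<in>C. \<forall>\<beta>\<in>C. \<forall>\<gamma>\<in>C. \<forall>\<delta>\<in>C.
       I \<gamma> = I \<alpha> \<union> I \<beta> \<longrightarrow> I \<delta> = I \<alpha> \<inter> I \<beta> \<longrightarrow> x \<alpha> * x \<beta> = x \<gamma> * x \<delta>)"
    and bij_ix: "bij_betw ix (Q - sq) {2..<N}" and N2: "2 \<le> N"
begin

definition el :: "'q set \<Rightarrow> 'a" where "el = inv_into C I"

lemma el: "downset A \<Longrightarrow> el A \<in> C" "downset A \<Longrightarrow> I (el A) = A"
proof -
  assume "downset A"
  then have "A \<in> I ` C" using bij_I unfolding bij_betw_def by blast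
  then show "el A \<in> C" "I (el A) = A" unfolding el_def by (rule inv_into_into, rule f_inv_into_f)
qed

lemma el_I: "\<alpha> \<in> C \<Longrightarrow> el (I \<alpha>) = \<alpha>" "\<alpha> \<in> C \<Longrightarrow> downset (I \<alpha>)"
  using bij_I unfolding el_def bij_betw_def by auto

lemma relation:
  assumes x: "x \<in> X" and A: "downset A" and B: "downset B"
  shows "x (el A) * x (el B) = x (el (A \<union> B)) * x (el (A \<inter> B))"
proof -
  note U = downset_Un[OF A B] and J = downset_Int[OF A B]
  have "\<forall>\<alpha>\<in>C. \<forall>\<beta>\<in>C. \<forall>\<gamma>\<in>C. \<forall>\<delta>\<in>C. I \<gamma> = I \<alpha> \<union> I \<beta> \<longrightarrow> I \<delta> = I \<alpha> \<inter> I \<beta> \<longrightarrow> x \<alpha> * x \<beta> = x \<gamma> * x \<delta>"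
    using x unfolding X_iff by (rule conjunct2)
  from this[rule_format, OF el(1)[OF A] el(1)[OF B] el(1)[OF U] el(1)[OF J]]
  show ?thesis unfolding el(2)[OF A] el(2)[OF B] el(2)[OF U] el(2)[OF J] by simp
qed

text \<open>Since \<open>T\<close> is disjoint from both ideals, the two products are indexed by
  pairs with the same union and the same intersection.\<close>

lemma exchange:
  assumes x: "x \<in> X" and A: "downset A" "downset (A \<union> T)" "A \<inter> T = {}" and G: "downset G" "downset (G \<union> T)" "G \<inter> T = {}"
  shows "x (el (A \<union> T)) * x (el G) = x (el A) * x (el (G \<union> T))"
proof -
  have "(A \<union> T) \<union> G = A \<union> (G \<union> T)" "(A \<union> T) \<inter> G = A \<inter> (G \<union> T)" using A G by blast+
  then show ?thesis using relation[OF x A(2) G(1)] relation[OF x A(1) G(2)] by metis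
qed

section \<open>The chart onto the quadric cone times a torus, and its inverse\<close>

definition U :: "('a \<Rightarrow> 'k) set" where "U = {x \<in> X. \<forall>A. downset A \<longrightarrow> full A \<longrightarrow> x (el A) \<noteq> 0}"

text \<open>The torus, translated so that its unit point is the origin; the vertex then corresponds
  to the origin of the cone.\<close>

definition Y :: "(nat \<Rightarrow> 'k) set" where "Y = {y \<in> affine_space {..<N}. \<forall>k<N. 1 + y k \<noteq> 0}"

definition box :: "nat \<Rightarrow> 'q" where "box = inv_into (Q - sq) ix"

text \<open>The denominators are coordinates at full ideals, hence nonzero on \<open>U\<close>. The
  use of \<open>up\<close> makes the ideals in the numerators of the box factors full as well, which
  is why these factors are units.\<close>

definition chart :: "('a \<Rightarrow> 'k) \<Rightarrow> nat + nat \<Rightarrow> 'k" where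
  "chart x = case_sum
     (\<lambda>i. if i = 1 then x (el (base \<union> {p})) / x (el base) else if i = 2 then x (el (base \<union> {p, q1})) / x (el base)
       else if i = 3 then x (el (base \<union> {p, q2})) / x (el base) else if i = 4 then x (el (base \<union> {p, q1, q2})) / x (el base) else 0)
     (\<lambda>k. if k = 0 then x (el {}) - 1 else if k = 1 then x (el (down t)) / x (el base) - 1
       else if k < N then x (el (up (box k))) / x (el (up (box k) - {box k})) - 1 else 0)"

definition square_factor :: "(nat + nat \<Rightarrow> 'k) \<Rightarrow> 'q set \<Rightarrow> 'k" where
  "square_factor w A = (if p \<notin> A then 1 else if t \<in> A then 1 + w (Inr 1)
     else if q1 \<in> A then (if q2 \<in> A then w (Inl 4) else w (Inl 2)) else (if q2 \<in> A then w (Inl 3) else w (Inl 1)))"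

definition value_at :: "(nat + nat \<Rightarrow> 'k) \<Rightarrow> 'q set \<Rightarrow> 'k" where
  "value_at w A = (1 + w (Inr 0)) * (\<Prod>b\<in>A - sq. 1 + w (Inr (ix b))) * square_factor w A"

definition param :: "(nat + nat \<Rightarrow> 'k) \<Rightarrow> 'a \<Rightarrow> 'k" where
  "param w \<alpha> = (if \<alpha> \<in> C then value_at w (I \<alpha>) else 0)"

lemma param_el: "downset A \<Longrightarrow> param w (el A) = value_at w A"
  unfolding param_def using el by simp

lemma box: "2 \<le> k \<Longrightarrow> k < N \<Longrightarrow> box k \<in> Q - sq" "2 \<le> k \<Longrightarrow> k < N \<Longrightarrow> ix (box k) = k"
proof -
  assume "2 \<le> k" "k < N"
  then have "k \<in> ix ` (Q - sq)" using bij_ix unfolding bij_betw_def by auto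
  then show "box k \<in> Q - sq" "ix (box k) = k" unfolding box_def by (rule inv_into_into, rule f_inv_into_f)
qed

lemma ix: "b \<in> Q - sq \<Longrightarrow> box (ix b) = b" "b \<in> Q - sq \<Longrightarrow> 2 \<le> ix b \<and> ix b < N"
  using bij_ix unfolding box_def bij_betw_def by (auto simp: inv_into_f_f)

lemma productD:
  assumes "w \<in> variety_prod quadric_cone Y"
  shows "w (Inl 1) * w (Inl 4) = w (Inl 2) * w (Inl 3)" "i \<notin> {1..4} \<Longrightarrow> w (Inl i) = 0"
    "k < N \<Longrightarrow> 1 + w (Inr k) \<noteq> 0" "\<not> k < N \<Longrightarrow> w (Inr k) = 0"
proof -
  have "(\<lambda>i. w (Inl i)) \<in> quadric_cone" "(\<lambda>k. w (Inr k)) \<in> Y" using assms unfolding variety_prod_iff by auto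
  then show "w (Inl 1) * w (Inl 4) = w (Inl 2) * w (Inl 3)" "i \<notin> {1..4} \<Longrightarrow> w (Inl i) = 0"
    "k < N \<Longrightarrow> 1 + w (Inr k) \<noteq> 0" "\<not> k < N \<Longrightarrow> w (Inr k) = 0"
    unfolding quadric_cone_def Y_def affine_space_def by auto
qed

lemma square_downsets: "downset base" "downset (base \<union> {p})" "downset (base \<union> {p, q1})" "downset (base \<union> {p, q2})" "downset (base \<union> {p, q1, q2})"
proof -
  have n: "\<not> le q1 p" "\<not> le q2 p" "\<not> le t p" "\<not> le t q1" "\<not> le t q2"
    using sq_distinct le_antisym sq_Q sq_le le_pt by metis+
  show "downset base" by (rule downset_base)
  show "downset (base \<union> {p})" "downset (base \<union> {p, q1})" "downset (base \<union> {p, q2})" "downset (base \<union> {p, q1, q2})"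
    by (rule downset_base_Un; use n incomparable in blast)+
qed

lemma full_base: "full base" unfolding full_def using base_sq by blast

lemma full_down_t: "full (down t)" unfolding full_def using sq_down by blast

lemma full_empty: "full {}" unfolding full_def by blast

lemma U_nonzero: "x \<in> U \<Longrightarrow> downset A \<Longrightarrow> full A \<Longrightarrow> x (el A) \<noteq> 0" and U_X: "x \<in> U \<Longrightarrow> x \<in> X"
  unfolding U_def by blast+

lemma chart_in:
  assumes x: "x \<in> U" shows "chart x \<in> variety_prod quadric_cone Y"
  unfolding variety_prod_iff
proof
  note nz = U_nonzero[OF x] and X = U_X[OF x]
  \<comment> \<open>The quadric equation is the binomial relation of the two incomparable ideals
    obtained from \<open>base\<close> by adding \<open>{p, q1}\<close> and
    \<open>{p, q2}\<close>.\<close>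
  have "x (el (base \<union> {p, q1})) * x (el (base \<union> {p, q2})) = x (el (base \<union> {p, q1, q2})) * x (el (base \<union> {p}))"
  proof -
    have "(base \<union> {p, q1}) \<union> (base \<union> {p, q2}) = base \<union> {p, q1, q2}" by blast
    moreover have "(base \<union> {p, q1}) \<inter> (base \<union> {p, q2}) = base \<union> {p}" using sq_distinct base_sq by blast
    ultimately show ?thesis using relation[OF X square_downsets(3,4)] by simp
  qed
  then show "(\<lambda>i. chart x (Inl i)) \<in> quadric_cone"
    by (auto simp: quadric_cone_def affine_space_def chart_def mult.commute)
  have "1 + chart x (Inr k) \<noteq> 0" if "k < N" for k
  proof -
    consider "k = 0" | "k = 1" | "2 \<le> k" by linarith
    then show ?thesis
    proof cases
      case 1
      then show ?thesis using nz[OF downset_empty full_empty] by (simp add: chart_def)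
    next
      case 2
      then show ?thesis using nz[OF downset_base full_base] nz[OF downset_down[OF sq_Q(4)] full_down_t] by (simp add: chart_def)
    next
      case 3
      have b: "box k \<in> Q" "box k \<notin> sq" using box(1)[OF 3 that] by auto
      show ?thesis
        using 3 that nz[OF downset_up[OF b(1)]] nz[OF downset_up_Diff[OF b]] full_up[OF b] by (simp add: chart_def)
    qed
  qed
  then show "(\<lambda>k. chart x (Inr k)) \<in> Y" using N2 by (auto simp: Y_def affine_space_def chart_def)
qed

lemma square_factor_remove:
  assumes "b \<notin> sq" shows "square_factor w A = square_factor w (A - {b})"
proof -
  have "z \<in> A - {b} \<longleftrightarrow> z \<in> A" if "z \<in> sq" for z using assms that by blast
  then show ?thesis unfolding square_factor_def by simp
qed

text \<open>Among the six order ideals of the square only \<open>{p, q1}\<close> and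
  \<open>{p, q2}\<close> are incomparable, and only for them does the quadric equation
  enter.\<close>

lemma square_factor_mult:
  assumes "w (Inl 1) * w (Inl 4) = w (Inl 2) * w (Inl 3)" "downset A" "downset B"
  shows "square_factor w A * square_factor w B = square_factor w (A \<union> B) * square_factor w (A \<inter> B)"
  using sq_shape[OF assms(2)] sq_shape[OF assms(3)] assms(1)
  by (elim disjE conjE) (simp_all add: square_factor_def mult.commute)

lemma value_at_mult:
  assumes "w (Inl 1) * w (Inl 4) = w (Inl 2) * w (Inl 3)" "downset A" "downset B"
  shows "value_at w A * value_at w B = value_at w (A \<union> B) * value_at w (A \<inter> B)"
proof -
  let ?f = "\<lambda>b. 1 + w (Inr (ix b))"
  have "prod ?f ((A - sq) \<union> (B - sq)) * prod ?f ((A - sq) \<inter> (B - sq)) = prod ?f (A - sq) * prod ?f (B - sq)"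
    using downset_finite assms by (intro prod.union_inter) auto
  moreover have "(A - sq) \<union> (B - sq) = (A \<union> B) - sq" "(A - sq) \<inter> (B - sq) = (A \<inter> B) - sq" by blast+
  ultimately have P: "prod ?f ((A \<union> B) - sq) * prod ?f ((A \<inter> B) - sq) = prod ?f (A - sq) * prod ?f (B - sq)" by simp
  have "value_at w A * value_at w B = (1 + w (Inr 0)) ^ 2 * (prod ?f (A - sq) * prod ?f (B - sq)) * (square_factor w A * square_factor w B)"
    unfolding value_at_def power2_eq_square by (simp only: mult_ac)
  also have "\<dots> = value_at w (A \<union> B) * value_at w (A \<inter> B)"
    unfolding P[symmetric] square_factor_mult[OF assms] value_at_def power2_eq_square by (simp only: mult_ac)
  finally show ?thesis .
qed

lemma value_at_nonzero:
  assumes w: "w \<in> variety_prod quadric_cone Y" and A: "downset A" "full A"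
  shows "value_at w A \<noteq> 0"
proof -
  note n = productD(3)[OF w]
  have "(\<Prod>b\<in>A - sq. 1 + w (Inr (ix b))) \<noteq> 0"
    using downset_finite[OF A(1)] downset_sub[OF A(1)] ix(2) n by (subst prod_zero_iff) auto
  moreover have "square_factor w A \<noteq> 0"
    using full_cases[OF A] n[of 1] N2 by (auto simp: square_factor_def)
  ultimately show ?thesis using n[of 0] N2 by (simp add: value_at_def)
qed

lemma param_in:
  assumes w: "w \<in> variety_prod quadric_cone Y" shows "param w \<in> U"
proof -
  have q: "w (Inl 1) * w (Inl 4) = w (Inl 2) * w (Inl 3)"
    by (rule productD(1)[OF w])
  have "param w \<in> X"
    unfolding X_iff
  proof (intro conjI ballI impI)
    show "param w \<in> affine_space C" by (simp add: affine_space_def param_def)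
    fix \<alpha> \<beta> \<gamma> \<delta> assume "\<alpha> \<in> C" "\<beta> \<in> C" "\<gamma> \<in> C" "\<delta> \<in> C" "I \<gamma> = I \<alpha> \<union> I \<beta>" "I \<delta> = I \<alpha> \<inter> I \<beta>"
    then show "param w \<alpha> * param w \<beta> = param w \<gamma> * param w \<delta>"
      using value_at_mult[OF q el_I(2) el_I(2), of \<alpha> \<beta>] by (simp add: param_def)
  qed
  then show ?thesis unfolding U_def using value_at_nonzero[OF w] by (simp add: param_el)
qed

lemma value_at_base_Un:
  assumes "T \<subseteq> sq" shows "value_at w (base \<union> T) = value_at w base * square_factor w (base \<union> T)"
proof -
  have "(base \<union> T) - sq = base - sq" "p \<notin> base" using assms base_sq by blast+
  then show ?thesis by (simp add: value_at_def square_factor_def)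
qed

lemma chart_param:
  assumes w: "w \<in> variety_prod quadric_cone Y" shows "chart (param w) = w"
proof
  fix v
  note nz = value_at_nonzero[OF w]
  have nb: "value_at w base \<noteq> 0" by (rule nz[OF downset_base full_base])
  have ratio: "value_at w (base \<union> T) / value_at w base = square_factor w (base \<union> T)" if "T \<subseteq> sq" for T
    using value_at_base_Un[OF that] nb by simp
  have nin: "p \<notin> base" "q1 \<notin> base" "q2 \<notin> base" "t \<notin> base" using base_sq by blast+
  show "chart (param w) v = w v"
  proof (cases v)
    case (Inl i)
    have s: "square_factor w (base \<union> {p}) = w (Inl 1)" "square_factor w (base \<union> {p, q1}) = w (Inl 2)"
      "square_factor w (base \<union> {p, q2}) = w (Inl 3)" "square_factor w (base \<union> {p, q1, q2}) = w (Inl 4)"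
      using nin sq_distinct by (auto simp: square_factor_def)
    have "w (Inl i) = 0" if "i \<noteq> 1" "i \<noteq> 2" "i \<noteq> 3" "i \<noteq> 4"
    proof -
      have "i \<notin> {1..4}" using that by auto
      then show ?thesis by (rule productD(2)[OF w])
    qed
    then show ?thesis
      unfolding Inl chart_def using square_downsets ratio[of "{p}"] ratio[of "{p, q1}"] ratio[of "{p, q2}"] ratio[of "{p, q1, q2}"] s
      by (simp add: param_el)
  next
    case (Inr k)
    consider "k = 0" | "k = 1" | "2 \<le> k" "k < N" | "2 \<le> k" "\<not> k < N" by linarith
    then show ?thesis
    proof cases
      case 1
      then show ?thesis unfolding Inr chart_def by (simp add: param_el downset_empty value_at_def square_factor_def)
    next
      case 2
      have "value_at w (down t) / value_at w base = square_factor w (base \<union> sq)" unfolding down_t by (rule ratio) simp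
      also have "\<dots> = 1 + w (Inr 1)" by (simp add: square_factor_def)
      finally show ?thesis unfolding Inr chart_def using 2 by (simp add: param_el downset_base downset_down sq_Q)
    next
      case 3
      let ?b = "box k"
      have b: "?b \<in> Q" "?b \<notin> sq" "ix ?b = k" using box[OF 3] by auto
      have "up ?b - sq = insert ?b ((up ?b - {?b}) - sq)" by (rule Diff_insert_remove[OF in_up[OF b(1)] b(2)])
      moreover have "finite ((up ?b - {?b}) - sq)" using downset_finite[OF downset_up[OF b(1)]] by blast
      ultimately have "(\<Prod>b\<in>up ?b - sq. 1 + w (Inr (ix b))) = (1 + w (Inr k)) * (\<Prod>b\<in>(up ?b - {?b}) - sq. 1 + w (Inr (ix b)))"
        using b(3) by simp
      moreover have "square_factor w (up ?b) = square_factor w (up ?b - {?b})" by (rule square_factor_remove[OF b(2)])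
      ultimately have "value_at w (up ?b) = (1 + w (Inr k)) * value_at w (up ?b - {?b})" by (simp add: value_at_def)
      moreover have "value_at w (up ?b - {?b}) \<noteq> 0" using nz[OF downset_up_Diff[OF b(1,2)]] full_up[OF b(1,2)] by blast
      ultimately have "value_at w (up ?b) / value_at w (up ?b - {?b}) - 1 = w (Inr k)" by simp
      then show ?thesis unfolding Inr chart_def using 3 by (simp add: param_el downset_up[OF b(1)] downset_up_Diff[OF b(1,2)])
    next
      case 4
      then have "w (Inr k) = 0" by (intro productD(4)[OF w])
      then show ?thesis unfolding Inr chart_def using 4 by simp
    qed
  qed
qed

text \<open>Boxes outside the square are removed one at a time; once every maximal box lies in the square,
  the whole part in the square is removed at once by comparison with \<open>base\<close>.\<close>

lemma value_at_chart:
  assumes x: "x \<in> U" and A: "downset A"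
  shows "x (el A) = value_at (chart x) A"
  using A
proof (induction "card A" arbitrary: A rule: less_induct)
  case less
  note nz = U_nonzero[OF x] and X = U_X[OF x]
  let ?w = "chart x"
  have finA: "finite A" using downset_finite[OF less.prems] .
  have AQ: "A \<subseteq> Q" using downset_sub[OF less.prems] .
  show ?case
  proof (cases "\<exists>b\<in>A. b \<notin> sq \<and> (\<forall>y\<in>A. le b y \<longrightarrow> y = b)")
    case True
    then obtain b where b: "b \<in> A" "b \<notin> sq" "\<forall>y\<in>A. le b y \<longrightarrow> y = b" by blast
    have bQ: "b \<in> Q" using b(1) AQ by blast
    have A1: "downset (A - {b})" using downset_Diff_maximal[OF less.prems] b(3) by blast
    have eqA: "(A - {b}) \<union> {b} = A" "(up b - {b}) \<union> {b} = up b" using b(1) in_up[OF bQ] by blast+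
    have "x (el A) * x (el (up b - {b})) = x (el (A - {b})) * x (el (up b))"
      using exchange[OF X A1, of "{b}" "up b - {b}"] eqA less.prems downset_up_Diff[OF bQ b(2)] downset_up[OF bQ] by simp
    moreover have n: "x (el (up b - {b})) \<noteq> 0" using nz[OF downset_up_Diff[OF bQ b(2)]] full_up[OF bQ b(2)] by blast
    ultimately have "x (el A) = x (el (A - {b})) * (x (el (up b)) / x (el (up b - {b})))" by (simp add: field_simps)
    also have "x (el (up b)) / x (el (up b - {b})) = 1 + ?w (Inr (ix b))"
      using ix[of b] bQ b(2) by (auto simp: chart_def)
    also have "x (el (A - {b})) = value_at ?w (A - {b})"
      by (intro less.hyps A1 card_Diff1_less finA b(1))
    also have "value_at ?w (A - {b}) * (1 + ?w (Inr (ix b))) = value_at ?w A"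
    proof -
      have "A - sq = insert b ((A - {b}) - sq)" by (rule Diff_insert_remove[OF b(1,2)])
      then have "(\<Prod>b\<in>A - sq. 1 + ?w (Inr (ix b))) = (1 + ?w (Inr (ix b))) * (\<Prod>b\<in>(A - {b}) - sq. 1 + ?w (Inr (ix b)))"
        using finA by simp
      moreover have "square_factor ?w A = square_factor ?w (A - {b})" by (rule square_factor_remove[OF b(2)])
      ultimately show ?thesis by (simp add: value_at_def)
    qed
    finally show ?thesis .
  next
    case False
    \<comment> \<open>Every element lies below a maximal one, and all maximal ones now belong to the
      square.\<close>
    have above: "\<exists>m\<in>A \<inter> sq. le a m" if "a \<in> A" for a
      using ex_maximal_above[OF AQ that] False by blast
    define T where "T = A \<inter> sq"
    have n0: "x (el base) \<noteq> 0" by (rule nz[OF downset_base full_base])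
    show ?thesis
    proof (cases "T = {}")
      case True
      then have "A = {}" using above unfolding T_def by blast
      then show ?thesis by (simp add: value_at_def square_factor_def chart_def)
    next
      case T: False
      have pA: "p \<in> A" using T downset_sq[OF less.prems] unfolding T_def by blast
      have A1: "downset (A - T)"
        unfolding downset_def
      proof (intro conjI ballI impI)
        show "A - T \<subseteq> Q" using AQ by blast
        fix a y assume a: "a \<in> A - T" and y: "y \<in> Q" "le y a"
        have aA: "a \<in> A" "a \<in> Q" "a \<notin> sq" using a AQ unfolding T_def by blast+
        \<comment> \<open>Otherwise \<open>a\<close> would lie between \<open>p\<close> and a box of
          the square, so in the square itself.\<close>
        have "y \<notin> sq"
        proof
          assume "y \<in> sq"
          then have pa: "le p a" using le_trans[OF sq_Q(1) y(1) aA(2) p_le_sq(1) y(2)] by blast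
          obtain m where m: "m \<in> sq" "le a m" using above[OF aA(1)] by blast
          have "m \<in> Q" using m(1) sq_Q by blast
          then have "le a t" using le_trans[OF aA(2) _ sq_Q(4) m(2) p_le_sq(2)[OF m(1)]] by blast
          then show False using between[OF aA(2) pa] aA(3) by blast
        qed
        then show "y \<in> A - T" using downsetD[OF less.prems aA(1) y] unfolding T_def by blast
      qed
      have baseT: "downset (base \<union> T)"
        using downsetD[OF less.prems] sq_Q by (intro downset_base_Un) (auto simp: T_def)
      have "(A - T) \<union> T = A" "(A - T) \<inter> T = {}" "base \<inter> T = {}" using base_sq unfolding T_def by blast+
      then have "x (el A) * x (el base) = x (el (A - T)) * x (el (base \<union> T))"
        using exchange[OF X A1, of T base] less.prems downset_base baseT by simp
      then have "x (el A) = x (el (A - T)) * (x (el (base \<union> T)) / x (el base))" using n0 by (simp add: field_simps)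
      also have "x (el (base \<union> T)) / x (el base) = square_factor ?w A"
      proof -
        note s = downset_sq[OF less.prems]
        consider "T = {p}" "q1 \<notin> A" "q2 \<notin> A" "t \<notin> A" | "T = {p, q1}" "q1 \<in> A" "q2 \<notin> A" "t \<notin> A"
          | "T = {p, q2}" "q1 \<notin> A" "q2 \<in> A" "t \<notin> A" | "T = {p, q1, q2}" "q1 \<in> A" "q2 \<in> A" "t \<notin> A" | "T = sq" "t \<in> A"
          using pA s unfolding T_def by (cases "q1 \<in> A"; cases "q2 \<in> A"; cases "t \<in> A") blast+
        then show ?thesis
        proof cases
          case 5
          have "base \<union> T = down t" unfolding 5(1) down_t ..
          then show ?thesis using pA 5 by (simp add: square_factor_def chart_def)
        qed (use pA in \<open>simp_all add: square_factor_def chart_def\<close>)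
      qed
      also have "x (el (A - T)) = value_at ?w (A - T)"
        using T finA by (intro less.hyps A1 psubset_card_mono) (auto simp: T_def)
      also have "value_at ?w (A - T) * square_factor ?w A = value_at ?w A"
      proof -
        have "(A - T) - sq = A - sq" "p \<notin> A - T" using pA unfolding T_def by blast+
        then show ?thesis by (simp add: value_at_def square_factor_def)
      qed
      finally show ?thesis .
    qed
  qed
qed

lemma param_chart:
  assumes x: "x \<in> U" shows "param (chart x) = x"
proof
  fix \<alpha>
  show "param (chart x) \<alpha> = x \<alpha>"
  proof (cases "\<alpha> \<in> C")
    case True
    then show ?thesis using value_at_chart[OF x el_I(2)[OF True]] el_I(1)[OF True] by (simp add: param_def)
  next
    case False
    then show ?thesis using U_X[OF x] unfolding X_iff affine_space_def param_def by simp
  qed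
qed

lemma param_polyfun: "(\<lambda>w. param w \<alpha>) \<in> polyfun"
proof -
  have "(\<lambda>w. square_factor w A) \<in> polyfun" for A
    unfolding square_factor_def by (cases "p \<in> A"; cases "t \<in> A"; cases "q1 \<in> A"; cases "q2 \<in> A") (simp_all add: polyfun.intros)
  then have "(\<lambda>w. value_at w A) \<in> polyfun" for A
    unfolding value_at_def by (intro polyfun.mult polyfun.add polyfun.const polyfun.coord polyfun_prod)
  then show ?thesis unfolding param_def by (cases "\<alpha> \<in> C") (simp_all add: polyfun.const)
qed

lemma chart_regular:
  assumes P: "P \<in> U" shows "regular_at X P (\<lambda>x. chart x v)"
proof -
  note nz = U_nonzero[OF P] and PX = U_X[OF P]
  have frac: "regular_at X P (\<lambda>x. x a / x b)" if "P b \<noteq> 0" for a b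
    using that PX by (intro regular_at_fraction polyfun.coord)
  have frac1: "regular_at X P (\<lambda>x. x a / x b - 1)" if "P b \<noteq> 0" for a b
    using regular_at_diff[OF frac[OF that] regular_at_const[OF PX]] .
  show ?thesis
  proof (cases v)
    case (Inl i)
    have n: "P (el base) \<noteq> 0" by (rule nz[OF downset_base full_base])
    show ?thesis unfolding Inl chart_def sum.case
      using frac[OF n] regular_at_const[OF PX, of 0]
      by (cases "i = 1"; cases "i = 2"; cases "i = 3"; cases "i = 4") (simp_all del: One_nat_def)
  next
    case (Inr k)
    consider "k = 0" | "k = 1" | "2 \<le> k" "k < N" | "2 \<le> k" "\<not> k < N" by linarith
    then show ?thesis
    proof cases
      case 1
      then show ?thesis unfolding Inr chart_def sum.case
        using regular_at_diff[OF regular_at_polyfun[OF PX polyfun.coord] regular_at_const[OF PX]] by simp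
    next
      case 2
      then show ?thesis unfolding Inr chart_def sum.case
        using frac1[OF nz[OF downset_base full_base]] by simp
    next
      case 3
      have b: "box k \<in> Q" "box k \<notin> sq" using box[OF 3] by auto
      show ?thesis unfolding Inr chart_def sum.case
        using 3 frac1[OF nz[OF downset_up_Diff[OF b]]] full_up[OF b] by simp
    next
      case 4
      then show ?thesis unfolding Inr chart_def sum.case using regular_at_const[OF PX] by simp
    qed
  qed
qed

definition vertex :: "'a \<Rightarrow> 'k" where "vertex = param (\<lambda>_. 0)"

lemma origin_in_product: "(\<lambda>_. 0) \<in> variety_prod quadric_cone Y"
  unfolding variety_prod_iff by (simp add: quadric_cone_def Y_def affine_space_def)

text \<open>At the origin all unit factors are 1 and the quadric coordinates are 0, so a coordinate
  survives exactly when the square is absent or complete.\<close>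

lemma vertex_eq: "vertex \<alpha> = (if \<alpha> \<in> C \<and> full (I \<alpha>) then 1 else 0)"
proof (cases "\<alpha> \<in> C")
  case True
  show ?thesis using sq_shape[OF el_I(2)[OF True]] True
    by (elim disjE conjE) (simp_all add: vertex_def param_def value_at_def square_factor_def full_def)
qed (simp add: vertex_def param_def)

lemma vertex_in: "vertex \<in> U" unfolding vertex_def by (rule param_in[OF origin_in_product])

lemma U_nonvanishing:
  obtains u where "u \<in> polyfun" "U = {x \<in> X. u x \<noteq> 0}"
proof
  let ?F = "{A. downset A \<and> full A}"
  have fin: "finite ?F"
    by (rule finite_subset[of _ "Pow Q"]) (use finite_Q downset_sub in auto)
  show "(\<lambda>x. \<Prod>A\<in>?F. x (el A)) \<in> polyfun" by (intro polyfun_prod polyfun.coord)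
  show "U = {x \<in> X. (\<Prod>A\<in>?F. x (el A)) \<noteq> 0}" unfolding U_def prod_zero_iff[OF fin] by blast
qed

lemma Y_nonvanishing: "Y = {y \<in> affine_space {..<N}. (\<Prod>k<N. 1 + y k) \<noteq> 0}"
  unfolding Y_def by (auto simp: prod_zero_iff)

text \<open>\<open>Y\<close> is an open neighbourhood of the origin in affine space, so enlarging
  the target to a cone leaves the germs at the vertex unchanged.\<close>

lemma chart_local: "local_chart X vertex (variety_prod quadric_cone (affine_space {..<N})) chart param"
proof -
  let ?W = "variety_prod quadric_cone (affine_space {..<N}) :: (nat + nat \<Rightarrow> 'k) set"
  have sub: "variety_prod quadric_cone Y \<subseteq> ?W" unfolding variety_prod_def Y_def by blast
  obtain u where u: "u \<in> polyfun" "U = {x \<in> X. u x \<noteq> 0}" by (rule U_nonvanishing)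
  have nearU: "eventually (\<lambda>x. x \<in> U) (znhds X vertex)"
    unfolding eventually_znhds using u vertex_in by (intro bexI[of _ u]) auto
  have nearY: "eventually (\<lambda>w. w \<in> variety_prod quadric_cone Y) (znhds ?W (\<lambda>_. 0))"
    unfolding eventually_znhds
  proof (intro bexI conjI ballI impI)
    show "(\<lambda>w :: nat + nat \<Rightarrow> 'k. \<Prod>k<N. 1 + w (Inr k)) \<in> polyfun"
      by (intro polyfun_prod polyfun.add polyfun.const polyfun.coord)
    fix w :: "nat + nat \<Rightarrow> 'k" assume "w \<in> ?W" "(\<Prod>k<N. 1 + w (Inr k)) \<noteq> 0"
    then show "w \<in> variety_prod quadric_cone Y"
      unfolding variety_prod_iff Y_nonvanishing by blast
  qed simp
  show ?thesis
  proof
    show "vertex \<in> X" using U_X[OF vertex_in] .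
    show "(\<lambda>_. 0) \<in> ?W" using sub origin_in_product by blast
    show "chart vertex = (\<lambda>_. 0)" unfolding vertex_def by (rule chart_param[OF origin_in_product])
    show "param (\<lambda>_. 0) = vertex" by (simp add: vertex_def)
    show "regular_at X vertex (\<lambda>x. chart x v)" for v by (rule chart_regular[OF vertex_in])
    show "regular_at ?W (\<lambda>_. 0) (\<lambda>w. param w a)" for a
      using sub origin_in_product by (intro regular_at_polyfun param_polyfun) blast
    show "eventually (\<lambda>x. chart x \<in> ?W \<and> param (chart x) = x) (znhds X vertex)"
      using nearU by eventually_elim (use chart_in sub param_chart in blast)
    show "eventually (\<lambda>w. param w \<in> X \<and> chart (param w) = w) (znhds ?W (\<lambda>_. 0))"
      using nearY by eventually_elim (use param_in U_X chart_param in blast)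
  qed
qed

text \<open>Translating \<open>y\<close> to the origin makes every point of \<open>Y\<close> the
  vertex of the cone formed by affine space.\<close>

lemma Y_chart:
  assumes y: "y \<in> Y" shows "local_chart Y y (affine_space {..<N}) (\<lambda>x v. x v - y v) (\<lambda>w v. w v + y v)"
proof
  have ya: "y \<in> affine_space {..<N}" using y unfolding Y_def by blast
  show "y \<in> Y" by (rule y)
  show "(\<lambda>_. 0 :: 'k) \<in> affine_space {..<N}" by (simp add: affine_space_def)
  show "regular_at Y y (\<lambda>x. x v - y v)" for v
    by (intro regular_at_polyfun polyfun_diff polyfun.coord polyfun.const y)
  show "regular_at (affine_space {..<N}) (\<lambda>_. 0) (\<lambda>w. w a + y a)" for a
    by (intro regular_at_polyfun polyfun.add polyfun.coord polyfun.const) (simp add: affine_space_def)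
  show "eventually (\<lambda>x. (\<lambda>v. x v - y v) \<in> affine_space {..<N} \<and> (\<lambda>v. x v - y v + y v) = x) (znhds Y y)"
    using eventually_znhds_in by eventually_elim (use ya in \<open>auto simp: Y_def affine_space_def\<close>)
  show "eventually (\<lambda>w. (\<lambda>v. w v + y v) \<in> Y \<and> (\<lambda>v. w v + y v - y v) = w) (znhds (affine_space {..<N}) (\<lambda>_. 0))"
    unfolding eventually_znhds
  proof (intro bexI conjI ballI impI)
    show "(\<lambda>w :: nat \<Rightarrow> 'k. \<Prod>k<N. 1 + (w k + y k)) \<in> polyfun"
      by (intro polyfun_prod polyfun.add polyfun.const polyfun.coord)
    show "(\<Prod>k<N. 1 + ((0 :: 'k) + y k)) \<noteq> 0" using y unfolding Y_nonvanishing by simp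
    fix w :: "nat \<Rightarrow> 'k" assume "w \<in> affine_space {..<N}" "(\<Prod>k<N. 1 + (w k + y k)) \<noteq> 0"
    then show "(\<lambda>v. w v + y v) \<in> Y" unfolding Y_nonvanishing using ya by (simp add: affine_space_def)
  qed simp
qed (simp_all)

end

context hibi_square
begin

lemma Sing_Y: "Sing Y = {}"
proof -
  have "y \<notin> Sing Y" if "y \<in> Y" for y by (rule regular_point_of_affine_chart[OF Y_chart[OF that]])
  then show ?thesis unfolding Sing_def by blast
qed

lemma same_type: "same_type_as_vertex X vertex quadric_cone"
proof -
  obtain u where u: "u \<in> polyfun" "U = {x \<in> X. u x \<noteq> 0}" by (rule U_nonvanishing)
  have open_U: "openin (subtopology zariski X) U" unfolding u(2) by (rule openin_zariski_nonzero[OF u(1)])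
  have UX: "U \<subseteq> X" using U_X by blast
  have quasi: "quasi_affine {..<N} Y"
    unfolding quasi_affine_def
  proof (intro conjI exI)
    let ?C = "affine_space {..<N} :: (nat \<Rightarrow> 'k) set"
    have "zariski_open (- ?C)"
      unfolding zariski_open_def affine_space_def
      by (intro exI[of _ "{(\<lambda>x. x v) | v. v \<notin> {..<N}}"]) (auto intro: polyfun.coord)
    then show "closedin zariski ?C"
      unfolding closedin_def topspace_zariski openin_zariski by (simp add: Compl_eq_Diff_UNIV)
    show "openin (subtopology zariski ?C) Y"
      unfolding Y_nonvanishing
      by (intro openin_zariski_nonzero polyfun_prod polyfun.add polyfun.const polyfun.coord)
  qed (auto simp: Y_def)
  have iso: "variety_isomorphism U (variety_prod quadric_cone Y) chart"
  proof (rule variety_isomorphismI[where \<psi> = param])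
    show "regular_at U P (\<lambda>x. chart x v)" if "P \<in> U" for P v
      by (rule regular_at_subset[OF chart_regular[OF that] UX that])
    show "regular_at (variety_prod quadric_cone Y) P (\<lambda>y. param y v)" if "P \<in> variety_prod quadric_cone Y" for P v
      by (rule regular_at_polyfun[OF that param_polyfun])
  qed (use chart_in param_in param_chart chart_param in auto)
  have "chart vertex = case_sum (\<lambda>_. 0) (\<lambda>_. 0)"
    unfolding vertex_def chart_param[OF origin_in_product] by (rule ext) (simp split: sum.split)
  moreover have "(\<lambda>_. 0) \<in> Y" by (simp add: Y_def affine_space_def)
  ultimately show ?thesis
    unfolding same_type_as_vertex_def using open_U vertex_in quasi Sing_Y iso by blast
qed

end

section \<open>The lattice \<open>I\<^sub>d\<^sub>,\<^sub>n\<close> as a lattice of order ideals\<close>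

text \<open>A tuple corresponds to the order ideal of the boxes \<open>(r, c)\<close> below it in a \<open>d \<times> (n - d)\<close> grid;
  rows and columns are numbered from 0, and row \<open>r\<close> has \<open>x\<^sub>r - (r + 1)\<close> boxes.\<close>

locale tuple_lattice =
  fixes d m :: nat
begin

abbreviation "L \<equiv> I_lat d (d + m)"
abbreviation "grid \<equiv> {..<d} \<times> {..<m}"

text \<open>Row lengths do not decrease with the row number, so a box forces those to its left and
  in later rows; hence larger row numbers mean smaller boxes.\<close>

definition box_le :: "nat \<times> nat \<Rightarrow> nat \<times> nat \<Rightarrow> bool" where
  "box_le x y \<longleftrightarrow> fst y \<le> fst x \<and> snd x \<le> snd y"

definition boxes :: "nat list \<Rightarrow> (nat \<times> nat) set" where
  "boxes xs = {(r, c) \<in> grid. c + r + 1 < xs ! r}"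

lemma carrierD:
  assumes xs: "xs \<in> carrier L"
  shows "length xs = d" "r \<le> s \<Longrightarrow> s < d \<Longrightarrow> xs ! r + (s - r) \<le> xs ! s"
    "r < d \<Longrightarrow> r + 1 \<le> xs ! r" "r < d \<Longrightarrow> xs ! r \<le> m + r + 1"
proof -
  have len: "length xs = d" and sorted: "sorted_wrt (<) xs" and sub: "set xs \<subseteq> {1..d + m}" using xs by (auto simp: I_lat_def)
  show "length xs = d" by (rule len)
  have gap: "xs ! r + (s - r) \<le> xs ! s" if "r \<le> s" "s < d" for r s
    using that
  proof (induction s rule: dec_induct)
    case (step s)
    have "xs ! s < xs ! Suc s" using sorted_wrt_nth_less[OF sorted, of s "Suc s"] step len by simp
    then show ?case using step by simp
  qed simp
  then show "r \<le> s \<Longrightarrow> s < d \<Longrightarrow> xs ! r + (s - r) \<le> xs ! s" .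
  have mem: "xs ! r \<in> {1..d + m}" if "r < d" for r using sub len that nth_mem by blast
  show "r + 1 \<le> xs ! r" if "r < d" using gap[of 0 r] mem[of 0] that by simp
  show "xs ! r \<le> m + r + 1" if r: "r < d"
  proof -
    obtain l where l: "d = Suc (r + l)" using less_imp_Suc_add[OF r] by blast
    then have rl: "r + l < d" by simp
    have "xs ! r + (r + l - r) \<le> xs ! (r + l)" by (rule gap[OF le_add1 rl])
    moreover have "xs ! (r + l) \<le> d + m" using mem[OF rl] by simp
    ultimately show ?thesis using l by linarith
  qed
qed

lemma carrierI:
  assumes "length xs = d" "\<And>r. r < d \<Longrightarrow> r + 1 \<le> xs ! r" "\<And>r. r < d \<Longrightarrow> xs ! r \<le> m + r + 1"
    "\<And>r. Suc r < d \<Longrightarrow> xs ! r < xs ! Suc r"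
  shows "xs \<in> carrier L"
proof -
  have "sorted_wrt (<) xs" using assms(1,4) by (subst sorted_wrt_iff_nth_Suc_transp) (auto simp: transp_def)
  moreover have "set xs \<subseteq> {1..d + m}"
  proof
    fix x assume "x \<in> set xs"
    then obtain r where "r < d" "x = xs ! r" using assms(1) by (metis in_set_conv_nth)
    then show "x \<in> {1..d + m}" using assms(2,3)[of r] by simp
  qed
  ultimately show ?thesis using assms(1) by (simp add: I_lat_def)
qed

lemma in_boxes: "(r, c) \<in> boxes xs \<longleftrightarrow> r < d \<and> c < m \<and> c + r + 1 < xs ! r"
  by (simp add: boxes_def)

lemma le_iff_boxes:
  assumes xs: "xs \<in> carrier L" and ys: "ys \<in> carrier L"
  shows "xs \<sqsubseteq>\<^bsub>L\<^esub> ys \<longleftrightarrow> boxes xs \<subseteq> boxes ys"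
proof -
  have "xs \<sqsubseteq>\<^bsub>L\<^esub> ys \<longleftrightarrow> (\<forall>r<d. xs ! r \<le> ys ! r)"
    using carrierD(1)[OF xs] carrierD(1)[OF ys] by (simp add: I_lat_def list_all2_conv_all_nth)
  also have "\<dots> \<longleftrightarrow> boxes xs \<subseteq> boxes ys"
  proof
    assume "\<forall>r<d. xs ! r \<le> ys ! r"
    then show "boxes xs \<subseteq> boxes ys" by (fastforce simp: in_boxes)
  next
    assume sub: "boxes xs \<subseteq> boxes ys"
    show "\<forall>r<d. xs ! r \<le> ys ! r"
    proof (intro allI impI, rule ccontr)
      fix r assume r: "r < d" "\<not> xs ! r \<le> ys ! r"
      \<comment> \<open>This is the first box missing from row \<open>r\<close> of
        \<open>ys\<close>.\<close>
      have "(r, ys ! r - (r + 1)) \<in> boxes xs"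
        using r carrierD(3)[OF ys r(1)] carrierD(4)[OF xs r(1)] by (auto simp: in_boxes)
      then have "(r, ys ! r - (r + 1)) \<in> boxes ys" using sub by blast
      then show False using carrierD(3)[OF ys r(1)] by (simp add: in_boxes)
    qed
  qed
  finally show ?thesis .
qed

lemma boxes_inj: "xs \<in> carrier L \<Longrightarrow> ys \<in> carrier L \<Longrightarrow> boxes xs = boxes ys \<Longrightarrow> xs = ys"
proof -
  assume xs: "xs \<in> carrier L" and ys: "ys \<in> carrier L" and eq: "boxes xs = boxes ys"
  then have "xs \<sqsubseteq>\<^bsub>L\<^esub> ys" "ys \<sqsubseteq>\<^bsub>L\<^esub> xs" using le_iff_boxes by simp_all
  then show ?thesis
    by (intro nth_equalityI) (auto simp: I_lat_def list_all2_conv_all_nth intro: le_antisym)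
qed

end

locale tuple_square = tuple_lattice +
  fixes i j :: nat
  assumes i: "1 \<le> i" "i < m" and j: "1 \<le> j" "j < d"

text \<open>The bottom of the square is in row \<open>j\<close> because later rows are lower in
  \<open>box_le\<close>. The corners are such that containing \<open>p\<close> means lying above
  \<open>mu\<close> and missing \<open>t\<close> means lying below \<open>lam\<close>, as the proof
  of \<open>interval_iff\<close> shows.\<close>

sublocale tuple_square \<subseteq> poset_square "{..<d} \<times> {..<m}" box_le "(j, i - 1)" "(j - 1, i - 1)" "(j, i)" "(j - 1, i)"
proof
  fix x assume x: "x \<in> {..<d} \<times> {..<m}" "box_le (j, i - 1) x" "box_le x (j - 1, i)"
  then have "(fst x = j \<or> fst x = j - 1) \<and> (snd x = i \<or> snd x = i - 1)" by (auto simp: box_le_def)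
  then show "x \<in> {(j, i - 1), (j - 1, i - 1), (j, i), (j - 1, i)}" by (cases x) auto
qed (use i j in \<open>auto simp: box_le_def\<close>)

context tuple_square
begin

lemma downset_boxes:
  assumes xs: "xs \<in> carrier L" shows "downset (boxes xs)"
  unfolding downset_def
proof (intro conjI ballI impI)
  show "boxes xs \<subseteq> grid" by (auto simp: boxes_def)
  fix x y assume xy: "x \<in> boxes xs" "y \<in> grid" "box_le y x"
  obtain r c r' c' where e: "x = (r, c)" "y = (r', c')" by (cases x, cases y)
  have "r \<le> r'" "r' < d" "c' \<le> c" "c' < m" using xy e by (auto simp: box_le_def)
  then have "xs ! r + (r' - r) \<le> xs ! r'" using carrierD(2)[OF xs] by blast
  then show "y \<in> boxes xs" using xy(1) \<open>r \<le> r'\<close> \<open>r' < d\<close> \<open>c' \<le> c\<close> \<open>c' < m\<close> unfolding e in_boxes by linarith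
qed

lemma boxes_surj:
  assumes A: "downset A" shows "\<exists>xs\<in>carrier L. boxes xs = A"
proof -
  define a where "a r = card {c. (r, c) \<in> A}" for r
  have row: "{c. (r, c) \<in> A} = {..<a r}" and a_le: "a r \<le> m" for r
  proof -
    have sub: "{c. (r, c) \<in> A} \<subseteq> {..<m}" using downset_sub[OF A] by auto
    then have fin: "finite {c. (r, c) \<in> A}" by (rule finite_subset) simp
    show "a r \<le> m" unfolding a_def using card_mono[OF _ sub] by simp
    have down: "c' \<in> {c. (r, c) \<in> A}" if "c \<in> {c. (r, c) \<in> A}" "c' \<le> c" for c c'
      using downsetD[OF A, of "(r, c)" "(r, c')"] that downset_sub[OF A] by (auto simp: box_le_def)
    show "{c. (r, c) \<in> A} = {..<a r}"
    proof (cases "{c. (r, c) \<in> A} = {}")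
      case True
      then show ?thesis unfolding a_def by simp
    next
      case False
      let ?M = "Max {c. (r, c) \<in> A}"
      have "{c. (r, c) \<in> A} = {..?M}"
        using Max_in[OF fin False] Max_ge[OF fin] down by blast
      then show ?thesis unfolding a_def by (metis card_atMost lessThan_Suc_atMost)
    qed
  qed
  have a_mono: "a r \<le> a (Suc r)" if "Suc r < d" for r
  proof -
    have "{c. (r, c) \<in> A} \<subseteq> {c. (Suc r, c) \<in> A}"
      using downsetD[OF A] downset_sub[OF A] that by (force simp: box_le_def)
    then show ?thesis unfolding row by simp
  qed
  \<comment> \<open>Row \<open>r\<close> of the ideal has \<open>a r\<close> boxes, and
    \<open>r + 1\<close> is the corresponding entry of the smallest tuple.\<close>
  let ?xs = "map (\<lambda>r. r + 1 + a r) [0..<d]"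
  have "?xs \<in> carrier L"
  proof (rule carrierI)
    show "?xs ! r \<le> m + r + 1" if "r < d" for r using a_le[of r] that by simp
    show "?xs ! r < ?xs ! Suc r" if "Suc r < d" for r using a_mono[OF that] that by simp
  qed simp_all
  moreover have "boxes ?xs = A"
  proof (intro equalityI subrelI)
    fix r c assume "(r, c) \<in> boxes ?xs"
    then have "c \<in> {..<a r}" by (auto simp: in_boxes)
    then show "(r, c) \<in> A" unfolding row[symmetric] by simp
  next
    fix r c assume rc: "(r, c) \<in> A"
    then have "c \<in> {..<a r}" unfolding row[symmetric] by simp
    then show "(r, c) \<in> boxes ?xs" using rc downset_sub[OF A] by (auto simp: in_boxes)
  qed
  ultimately show ?thesis by blast
qed

lemma bij_boxes: "bij_betw boxes (carrier L) {A. downset A}"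
  unfolding bij_betw_def
proof
  show "inj_on boxes (carrier L)" using boxes_inj by (rule inj_onI)
  show "boxes ` carrier L = {A. downset A}" using downset_boxes boxes_surj by blast
qed

text \<open>The join is defined by choice among least upper bounds; uniqueness makes it computable
  from the boxes.\<close>

lemma least_unique:
  assumes "least L x A" "least L y A" shows "x = y"
proof -
  have "x \<in> carrier L" "y \<in> carrier L" "x \<sqsubseteq>\<^bsub>L\<^esub> y" "y \<sqsubseteq>\<^bsub>L\<^esub> x" using assms unfolding least_def by auto
  then show ?thesis using le_iff_boxes boxes_inj by (metis subset_antisym)
qed

lemma greatest_unique:
  assumes "greatest L x A" "greatest L y A" shows "x = y"
proof -
  have "x \<in> carrier L" "y \<in> carrier L" "x \<sqsubseteq>\<^bsub>L\<^esub> y" "y \<sqsubseteq>\<^bsub>L\<^esub> x" using assms unfolding greatest_def by auto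
  then show ?thesis using le_iff_boxes boxes_inj by (metis subset_antisym)
qed

lemma join_boxes:
  assumes x: "x \<in> carrier L" and y: "y \<in> carrier L"
  shows "x \<squnion>\<^bsub>L\<^esub> y \<in> carrier L" "boxes (x \<squnion>\<^bsub>L\<^esub> y) = boxes x \<union> boxes y"
proof -
  obtain z where z: "z \<in> carrier L" "boxes z = boxes x \<union> boxes y"
    using boxes_surj[OF downset_Un[OF downset_boxes[OF x] downset_boxes[OF y]]] by blast
  have up: "u \<in> Upper L {x, y} \<longleftrightarrow> u \<in> carrier L \<and> boxes x \<subseteq> boxes u \<and> boxes y \<subseteq> boxes u" for u
    unfolding Upper_def using x y le_iff_boxes[OF x, of u] le_iff_boxes[OF y, of u] by blast
  have "least L z (Upper L {x, y})"
    unfolding least_def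
  proof (intro conjI ballI)
    show "Upper L {x, y} \<subseteq> carrier L" by (rule Upper_closed)
    show "z \<in> Upper L {x, y}" unfolding up using z by blast
    fix u assume "u \<in> Upper L {x, y}"
    then show "z \<sqsubseteq>\<^bsub>L\<^esub> u" unfolding up using z le_iff_boxes[OF z(1), of u] by blast
  qed
  note lz = this
  have "x \<squnion>\<^bsub>L\<^esub> y = z" unfolding join_def sup_def by (rule some_equality[where P = "\<lambda>z. least L z (Upper L {x, y})", OF lz]) (rule least_unique[OF _ lz])
  then show "x \<squnion>\<^bsub>L\<^esub> y \<in> carrier L" "boxes (x \<squnion>\<^bsub>L\<^esub> y) = boxes x \<union> boxes y" using z by simp_all
qed

lemma meet_boxes:
  assumes x: "x \<in> carrier L" and y: "y \<in> carrier L"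
  shows "x \<sqinter>\<^bsub>L\<^esub> y \<in> carrier L" "boxes (x \<sqinter>\<^bsub>L\<^esub> y) = boxes x \<inter> boxes y"
proof -
  obtain z where z: "z \<in> carrier L" "boxes z = boxes x \<inter> boxes y"
    using boxes_surj[OF downset_Int[OF downset_boxes[OF x] downset_boxes[OF y]]] by blast
  have low: "u \<in> Lower L {x, y} \<longleftrightarrow> u \<in> carrier L \<and> boxes u \<subseteq> boxes x \<and> boxes u \<subseteq> boxes y" for u
    unfolding Lower_def using x y le_iff_boxes[OF _ x, of u] le_iff_boxes[OF _ y, of u] by blast
  have "greatest L z (Lower L {x, y})"
    unfolding greatest_def
  proof (intro conjI ballI)
    show "Lower L {x, y} \<subseteq> carrier L" by (rule Lower_closed)
    show "z \<in> Lower L {x, y}" unfolding low using z by blast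
    fix u assume "u \<in> Lower L {x, y}"
    then show "u \<sqsubseteq>\<^bsub>L\<^esub> z" unfolding low using z le_iff_boxes[OF _ z(1), of u] by blast
  qed
  note gz = this
  have "x \<sqinter>\<^bsub>L\<^esub> y = z" unfolding meet_def inf_def by (rule some_equality[where P = "\<lambda>z. greatest L z (Lower L {x, y})", OF gz]) (rule greatest_unique[OF _ gz])
  then show "x \<sqinter>\<^bsub>L\<^esub> y \<in> carrier L" "boxes (x \<sqinter>\<^bsub>L\<^esub> y) = boxes x \<inter> boxes y" using z by simp_all
qed

lemma hibi_variety_iff:
  fixes x :: "nat list \<Rightarrow> 'k::field"
  shows "x \<in> hibi_variety L \<longleftrightarrow> x \<in> affine_space (carrier L) \<and>
    (\<forall>\<alpha>\<in>carrier L. \<forall>\<beta>\<in>carrier L. \<forall>\<gamma>\<in>carrier L. \<forall>\<delta>\<in>carrier L.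
       boxes \<gamma> = boxes \<alpha> \<union> boxes \<beta> \<longrightarrow> boxes \<delta> = boxes \<alpha> \<inter> boxes \<beta> \<longrightarrow> x \<alpha> * x \<beta> = x \<gamma> * x \<delta>)"
proof -
  have "x \<alpha> * x \<beta> - x (\<alpha> \<squnion>\<^bsub>L\<^esub> \<beta>) * x (\<alpha> \<sqinter>\<^bsub>L\<^esub> \<beta>) = 0 \<longleftrightarrow>
      (\<forall>\<gamma>\<in>carrier L. \<forall>\<delta>\<in>carrier L. boxes \<gamma> = boxes \<alpha> \<union> boxes \<beta> \<longrightarrow> boxes \<delta> = boxes \<alpha> \<inter> boxes \<beta> \<longrightarrow> x \<alpha> * x \<beta> = x \<gamma> * x \<delta>)"
    if a: "\<alpha> \<in> carrier L" and b: "\<beta> \<in> carrier L" for \<alpha> \<beta>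
  proof -
    note J = join_boxes[OF a b] and M = meet_boxes[OF a b]
    have "\<gamma> = \<alpha> \<squnion>\<^bsub>L\<^esub> \<beta>" if "\<gamma> \<in> carrier L" "boxes \<gamma> = boxes \<alpha> \<union> boxes \<beta>" for \<gamma>
      using that boxes_inj J by metis
    moreover have "\<delta> = \<alpha> \<sqinter>\<^bsub>L\<^esub> \<beta>" if "\<delta> \<in> carrier L" "boxes \<delta> = boxes \<alpha> \<inter> boxes \<beta>" for \<delta>
      using that boxes_inj M by metis
    ultimately show ?thesis using J M by (metis eq_iff_diff_eq_0)
  qed
  then show ?thesis unfolding hibi_variety_def by simp
qed

lemma join_irreducibles_eq: "join_irreducibles L = {z \<in> carrier L. boxes z \<in> {{}} \<union> down ` grid}"
proof -
  have "(\<forall>x\<in>carrier L. \<forall>y\<in>carrier L. z = x \<squnion>\<^bsub>L\<^esub> y \<longrightarrow> z = x \<or> z = y) \<longleftrightarrow> boxes z \<in> {{}} \<union> down ` grid"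
    if z: "z \<in> carrier L" for z
  proof -
    have "(\<forall>x\<in>carrier L. \<forall>y\<in>carrier L. z = x \<squnion>\<^bsub>L\<^esub> y \<longrightarrow> z = x \<or> z = y) \<longleftrightarrow>
      (\<forall>x\<in>carrier L. \<forall>y\<in>carrier L. boxes z = boxes x \<union> boxes y \<longrightarrow> boxes z = boxes x \<or> boxes z = boxes y)"
      using z join_boxes boxes_inj by (intro ball_cong refl) metis
    also have "\<dots> \<longleftrightarrow> (\<forall>B B'. downset B \<longrightarrow> downset B' \<longrightarrow> boxes z = B \<union> B' \<longrightarrow> boxes z = B \<or> boxes z = B')"
    proof
      assume irr: "\<forall>x\<in>carrier L. \<forall>y\<in>carrier L. boxes z = boxes x \<union> boxes y \<longrightarrow> boxes z = boxes x \<or> boxes z = boxes y"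
      show "\<forall>B B'. downset B \<longrightarrow> downset B' \<longrightarrow> boxes z = B \<union> B' \<longrightarrow> boxes z = B \<or> boxes z = B'"
      proof (intro allI impI)
        fix B B' assume B: "downset B" "downset B'" "boxes z = B \<union> B'"
        obtain x where x: "x \<in> carrier L" "boxes x = B" using boxes_surj[OF B(1)] by blast
        obtain y where y: "y \<in> carrier L" "boxes y = B'" using boxes_surj[OF B(2)] by blast
        show "boxes z = B \<or> boxes z = B'"
          using irr[rule_format, OF x(1) y(1)] B(3) unfolding x(2) y(2) by blast
      qed
    next
      assume irr: "\<forall>B B'. downset B \<longrightarrow> downset B' \<longrightarrow> boxes z = B \<union> B' \<longrightarrow> boxes z = B \<or> boxes z = B'"
      show "\<forall>x\<in>carrier L. \<forall>y\<in>carrier L. boxes z = boxes x \<union> boxes y \<longrightarrow> boxes z = boxes x \<or> boxes z = boxes y"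
      proof (intro ballI impI)
        fix x y assume "x \<in> carrier L" "y \<in> carrier L" "boxes z = boxes x \<union> boxes y"
        then show "boxes z = boxes x \<or> boxes z = boxes y"
          using irr[rule_format, OF downset_boxes downset_boxes] by blast
      qed
    qed
    also have "\<dots> \<longleftrightarrow> boxes z \<in> {{}} \<union> down ` grid"
      unfolding downset_irreducible_iff[OF downset_boxes[OF z]] by blast
    finally show ?thesis .
  qed
  then show ?thesis unfolding join_irreducibles_def by blast
qed

text \<open>There is one for each box, and one more for the minimum, whose order ideal is
  empty.\<close>

lemma card_join_irreducibles: "card (join_irreducibles L) = d * m + 1"
proof -
  have "boxes ` join_irreducibles L = {{}} \<union> down ` grid"
  proof (intro equalityI subsetI)
    fix A assume A: "A \<in> {{}} \<union> down ` grid"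
    then have "downset A" using downset_empty downset_down by blast
    then obtain z where "z \<in> carrier L" "boxes z = A" using boxes_surj by blast
    then show "A \<in> boxes ` join_irreducibles L" using A unfolding join_irreducibles_eq by blast
  qed (auto simp: join_irreducibles_eq)
  moreover have "inj_on boxes (join_irreducibles L)"
    using boxes_inj unfolding join_irreducibles_eq by (intro inj_onI) blast
  ultimately have "card (join_irreducibles L) = card ({{}} \<union> down ` grid)" by (metis card_image)
  then show ?thesis unfolding card_irreducible by simp
qed

text \<open>In each of the two comparisons a single entry decides: strict increase and the extreme
  values of the entries take care of the other positions.\<close>

lemma interval_iff:
  assumes x: "x \<in> carrier L"
  shows "x \<in> L_sub d (d + m) i j \<longleftrightarrow> full (boxes x)"
proof -
  note D = carrierD[OF x]
  have mu: "mu d i j ! r = (if r < j then r + 1 else i + r + 1)" if "r < d" for r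
    using that j by (auto simp: mu_def nth_append)
  have lam: "lam d (d + m) i j ! r = (if r < j then i + r + 1 else m + r + 1)" if "r < d" for r
    using that j by (auto simp: lam_def nth_append)
  have len: "length (mu d i j) = d" "length (lam d (d + m) i j) = d" using j by (auto simp: mu_def lam_def)
  have 1: "mu d i j \<sqsubseteq>\<^bsub>L\<^esub> x \<longleftrightarrow> (j, i - 1) \<in> boxes x"
  proof -
    have "mu d i j \<sqsubseteq>\<^bsub>L\<^esub> x \<longleftrightarrow> (\<forall>r<d. mu d i j ! r \<le> x ! r)"
      using len D(1) by (simp add: I_lat_def list_all2_conv_all_nth)
    also have "\<dots> \<longleftrightarrow> i + j + 1 \<le> x ! j"
    proof
      assume "\<forall>r<d. mu d i j ! r \<le> x ! r"
      then show "i + j + 1 \<le> x ! j" using mu[of j] j by auto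
    next
      assume a: "i + j + 1 \<le> x ! j"
      show "\<forall>r<d. mu d i j ! r \<le> x ! r"
      proof (intro allI impI)
        fix r assume r: "r < d"
        show "mu d i j ! r \<le> x ! r" using mu[OF r] D(3)[OF r] D(2)[of j r] r a by (cases "r < j") auto
      qed
    qed
    also have "\<dots> \<longleftrightarrow> (j, i - 1) \<in> boxes x" using i j by (auto simp: in_boxes)
    finally show ?thesis .
  qed
  have 2: "x \<sqsubseteq>\<^bsub>L\<^esub> lam d (d + m) i j \<longleftrightarrow> (j - 1, i) \<notin> boxes x"
  proof -
    have "x \<sqsubseteq>\<^bsub>L\<^esub> lam d (d + m) i j \<longleftrightarrow> (\<forall>r<d. x ! r \<le> lam d (d + m) i j ! r)"
      using len D(1) by (simp add: I_lat_def list_all2_conv_all_nth)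
    also have "\<dots> \<longleftrightarrow> x ! (j - 1) \<le> i + j"
    proof
      assume "\<forall>r<d. x ! r \<le> lam d (d + m) i j ! r"
      moreover have "j - 1 < d" using j by simp
      ultimately have "x ! (j - 1) \<le> lam d (d + m) i j ! (j - 1)" by blast
      then show "x ! (j - 1) \<le> i + j" using lam[OF \<open>j - 1 < d\<close>] j by simp
    next
      assume a: "x ! (j - 1) \<le> i + j"
      show "\<forall>r<d. x ! r \<le> lam d (d + m) i j ! r"
      proof (intro allI impI)
        fix r assume r: "r < d"
        show "x ! r \<le> lam d (d + m) i j ! r"
        proof (cases "r < j")
          case True
          obtain l where l: "j = Suc (r + l)" using less_imp_Suc_add[OF True] by blast
          have "x ! r + (r + l - r) \<le> x ! (r + l)" by (rule D(2)) (use l j in auto)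
          then have "x ! r + l \<le> x ! (r + l)" by simp
          moreover have "x ! (r + l) \<le> i + j" using a unfolding l by simp
          moreover have "lam d (d + m) i j ! r = i + r + 1" using lam[OF r] True by simp
          ultimately show ?thesis using l by linarith
        next
          case False
          then show ?thesis using lam[OF r] D(4)[OF r] by simp
        qed
      qed
    qed
    also have "\<dots> \<longleftrightarrow> (j - 1, i) \<notin> boxes x" using i j by (auto simp: in_boxes)
    finally show ?thesis .
  qed
  show ?thesis unfolding L_sub_def at_least_at_most_def full_def using x 1 2 by blast
qed

end

theorem theorem6p15:
  fixes d n i j :: nat
    and \<tau> :: "(nat list \<Rightarrow> real) set"
    and L :: "nat list gorder"
    and X :: "(nat list \<Rightarrow> 'k::alg_closed_field) set"
    and P :: "nat list \<Rightarrow> 'k"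
  assumes "1 \<le> d" "d \<le> n"
    and "1 \<le> i" "i \<le> n - d - 1" "1 \<le> j" "j \<le> d - 1"
  defines "L \<equiv> I_lat d n"
  defines "X \<equiv> hibi_variety L"
  defines "P \<equiv> P_face L \<tau>"
  assumes "is_face (join_irreducibles L) \<tau> (hibi_cone L)"
    and "D_face TYPE('k) L \<tau> = L_sub d n i j"
  shows "P \<in> Sing X
    \<and> (alg_isomorphic (tangent_cone X P)
         (coord_ring (variety_prod quadric_cone
            (affine_space {..<card (join_irreducibles L) - 3})))
       \<and> affine_toric (tangent_cone X P))
    \<and> (same_type_as_vertex X P quadric_cone \<and> multiplicity_at X P = 2)"
proof -
  define m where "m = n - d"
  have n: "n = d + m" using assms(2) by (simp add: m_def)
  interpret T: tuple_square d m i j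
    by unfold_locales (use assms(1,3-6) in \<open>auto simp: m_def\<close>)
  define N where "N = card (join_irreducibles L) - 3"
  have L: "L = I_lat d (d + m)" by (simp add: L_def n)
  have N: "N = d * m - 2" unfolding N_def L T.card_join_irreducibles by simp
  have "2 \<le> d" "2 \<le> m" using T.i T.j by linarith+
  then have dm: "4 \<le> d * m" using mult_le_mono[of 2 d 2 m] by simp
  \<comment> \<open>Together with the torus coordinates 0 and 1, the boxes outside the square number
    exactly \<open>N\<close>.\<close>
  have "card ({..<d} \<times> {..<m} - T.sq) = d * m - 4"
    using T.sq_Q T.sq_distinct by (subst card_Diff_subset) simp_all
  then have "card ({..<d} \<times> {..<m} - T.sq) = card {2..<N}" unfolding N by simp
  then obtain ix where ix: "bij_betw ix ({..<d} \<times> {..<m} - T.sq) {2..<N}"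
    using finite_same_card_bij[of "{..<d} \<times> {..<m} - T.sq" "{2..<N}"] by auto
  interpret H: hibi_square "{..<d} \<times> {..<m}" T.box_le "(j, i - 1)" "(j - 1, i - 1)" "(j, i)" "(j - 1, i)"
    "carrier L" T.boxes X ix N
  proof
    show "bij_betw T.boxes (carrier L) {A. T.downset A}" unfolding L by (rule T.bij_boxes)
    show "x \<in> X \<longleftrightarrow> x \<in> affine_space (carrier L) \<and>
      (\<forall>\<alpha>\<in>carrier L. \<forall>\<beta>\<in>carrier L. \<forall>\<gamma>\<in>carrier L. \<forall>\<delta>\<in>carrier L.
       T.boxes \<gamma> = T.boxes \<alpha> \<union> T.boxes \<beta> \<longrightarrow> T.boxes \<delta> = T.boxes \<alpha> \<inter> T.boxes \<beta> \<longrightarrow> x \<alpha> * x \<beta> = x \<gamma> * x \<delta>)" for x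
      unfolding X_def L by (rule T.hibi_variety_iff)
    show "bij_betw ix ({..<d} \<times> {..<m} - T.sq) {2..<N}" by (rule ix)
    show "2 \<le> N" using dm by (simp add: N)
  qed
  \<comment> \<open>The coordinates of \<open>P\<close> are 0 or 1, so \<open>P\<close> is
    determined by its support. By assumption this is \<open>L_sub\<close>, which by
    \<open>interval_iff\<close> consists of the full ideals.\<close>
  have "P = H.vertex"
  proof
    fix \<alpha>
    show "P \<alpha> = H.vertex \<alpha>"
    proof (cases "\<alpha> \<in> carrier L")
      case True
      have "P \<alpha> \<noteq> 0 \<longleftrightarrow> \<alpha> \<in> D_face TYPE('k) L \<tau>" using True by (simp add: D_face_def P_def)
      also have "\<dots> \<longleftrightarrow> T.full (T.boxes \<alpha>)"
        using T.interval_iff[of \<alpha>] True unfolding assms(11) by (simp add: L n)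
      finally have "P \<alpha> \<noteq> 0 \<longleftrightarrow> T.full (T.boxes \<alpha>)" .
      moreover have "P \<alpha> = 0 \<or> P \<alpha> = 1" unfolding P_def P_face_def by simp
      ultimately show ?thesis using True unfolding H.vertex_eq by auto
    next
      case False
      then show ?thesis unfolding H.vertex_eq by (simp add: P_def P_face_def)
    qed
  qed
  moreover note chart = quadric_chart[OF H.chart_local]
  ultimately show ?thesis
    using chart(1,2,4) quadric_semigroup_toric[OF chart(3)] H.same_type unfolding N_def[symmetric] by simp
qed

end
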